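(* For each of the following graphs $G$ on $5$ vertices, the given lists are exactly all the ordered multiplicity lists allowed in $\ddot{\mathcal{S}}(G)$. Each of these lists is spectrally arbitrary with the SSP in $\ddot{\mathcal{S}}(G)$ unless it is marked "(no SSP)". If a list is marked "(no SSP)", then every matrix in $\ddot{\mathcal{S}}(G)$ realizing that ordered multiplicity list does not have the SSP. \begin{itemize} \item $P_5$: $11111$; \item $S(2,1,1)$: $11111$, $1211$, $1121$; \item $K_{1,4}$: $11111$, $1211$, $1121$, $131$ (no SSP); \item $L(3,2)$: $11111$, $1211$, $1121$, $1112$; \item $\mathsf{Bull}$: $11111$, $1211$, $1121$, $1112$; \item $C_5$: $11111$, $1211$, $1112$, $122$; \item $\mathsf{Camp}$: $11111$, $1211$, $1121$, $1112$, $122$; \item $\mathsf{Bnr}$: $11111$, $1211$, $1121$; \item $\mathsf{Dart}$: $11111$, $1211$, $1121$, $1112$, $122$; \item $\mathsf{Kite}$: $11111$, $1211$, $1121$, $1112$; \item $\mathsf{Hs}$: $11111$, $1211$, $1121$, $1112$, $122$; \item $\mathsf{Gem}$: $11111$, $1211$, $1121$, $1112$, $122$; \item $\mathsf{Bfly}$: $11111$, $1211$, $1121$, $1112$, $122$, $113$ (no SSP); \item $K_{2,3}$: $11111$, $1211$, $1121$, $131$; \item $T_5$: $11111$, $1211$, $1121$, $1112$, $122$, $131$; \item $L(4,1)$: $11111$, $1211$, $1121$, $1112$, $122$, $131$, $113$; \item $(K_4)_e$: $11111$, $1211$, $1121$, $1112$, $122$, $131$; \item $W_5$: $11111$, $1211$,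 $1121$, $1112$, $122$, $131$; \item $\mathsf{FHs}$: $11111$, $1211$, $1121$, $1112$, $122$, $131$, $113$; \item $K_5-e$: $11111$, $1211$, $1121$, $1112$, $122$, $131$, $113$; \item $K_5$: $11111$, $1211$, $1121$, $1112$, $122$, $131$, $113$, $14$. \end{itemize}
   Context: For a simple graph $G$ on $n$ vertices, $\ddot{\mathcal{S}}(G)$ is the set of discrete Schrödinger operators of $G$: $n\times n$ real symmetric matrices (indexed by $V(G)$) whose off-diagonal $i,j$-entry is negative if $\{i,j\}$ is an edge and zero if it is not; diagonal entries are arbitrary. If a real symmetric matrix $A$ has distinct eigenvalues $\lambda_1<\cdots<\lambda_q$ with multiplicities $m_1,\ldots,m_q$, its ordered multiplicity list is $m_1\cdots m_q$ (written as a string of digits). An ordered multiplicity list is allowed in $\ddot{\mathcal{S}}(G)$ if some $A\in\ddot{\mathcal{S}}(G)$ has (realizes) it. A real symmetric matrix $A$ has the strong spectral property (SSP) if $X=O$ is the only real symmetric matrix with $A\circ X=O$, $I\circ X=O$ and $AX-XA=O$ ($\circ$ is the entrywise product). An ordered multiplicity list $m_1\cdots m_q$ is spectrally arbitrary with the SSP in $\ddot{\mathcal{S}}(G)$ if for all real numbers $\lambda_1<\cdots<\lambda_q$ there is a matrix in $\ddot{\mathcal{S}}(G)$ with the SSP whose distinct eigenvalues are $\lambda_1,\ldots,\lambda_q$ with multiplicities $m_1,\ldots,m_q$ respectively. The graphs, on vertex set $\{1,2,3,4,5\}$ with edge $\{i,j\}$ written $ij$ (up to isomorphism): $P_5$,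 $C_5$, $K_5$ are the path, cycle and complete graph, $K_{1,4}$ and $K_{2,3}$ are complete bipartite graphs, $K_5-e$ is $K_5$ minus one edge; $S(2,1,1)$: $12,23,34,35$; $L(3,2)$: $12,23,34,45,35$; $\mathsf{Bull}$: $12,23,34,25,35$; $\mathsf{Camp}$: $12,23,13,14,15$; $\mathsf{Bnr}$: $12,23,34,45,25$; $\mathsf{Dart}$: $12,23,34,45,25,24$; $\mathsf{Kite}$: $12,23,34,45,25,35$; $\mathsf{Hs}$: $12,23,34,14,35,45$; $\mathsf{Gem}$: $12,23,34,45,15,13,14$; $\mathsf{Bfly}$: $12,23,13,14,45,15$; $T_5$: $13,23,25,15,14,24,12$; $L(4,1)$: $12,23,34,45,25,24,35$; $(K_4)_e$: $14,12,23,34,45,25,13$; $W_5$: $14,12,23,34,45,25,15,13$; $\mathsf{FHs}$: $12,23,34,14,13,35,45,24$. *)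

theory Defs
  imports "HOL-Analysis.Analysis"
begin

text \<open>
  A simple graph is given by its set of edges, each a two-element set of vertices; its
  vertex set is the whole finite index type \<^typ>\<open>'n\<close>.
\<close>

definition schroedinger :: "'n::finite set set \<Rightarrow> (real^'n^'n) set" where
  "schroedinger G = {A. transpose A = A \<and>
     (\<forall>i j. i \<noteq> j \<longrightarrow> (if {i, j} \<in> G then A $ i $ j < 0 else A $ i $ j = 0))}"

definition eigenvalues :: "real^'n^'n \<Rightarrow> real set" where
  "eigenvalues A = {c. \<exists>v. v \<noteq> 0 \<and> A *v v = c *\<^sub>R v}"

text \<open>
  The multiplicity is the geometric one; for the symmetric matrices considered here it
  coincides with the algebraic one.
\<close>

definition multiplicity_of :: "real^'n^'n \<Rightarrow> real \<Rightarrow> nat" where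
  "multiplicity_of A c = dim {v. A *v v = c *\<^sub>R v}"

definition has_spectrum :: "real^'n^'n \<Rightarrow> real list \<Rightarrow> nat list \<Rightarrow> bool" where
  "has_spectrum A ls ms \<longleftrightarrow>
     sorted_wrt (<) ls \<and> set ls = eigenvalues A \<and> map (multiplicity_of A) ls = ms"

definition has_ordered_mult_list :: "real^'n^'n \<Rightarrow> nat list \<Rightarrow> bool" where
  "has_ordered_mult_list A ms \<longleftrightarrow> (\<exists>ls. has_spectrum A ls ms)"

definition allowed :: "'n::finite set set \<Rightarrow> nat list \<Rightarrow> bool" where
  "allowed G ms \<longleftrightarrow> (\<exists>A\<in>schroedinger G. has_ordered_mult_list A ms)"

text \<open>
  On \<^typ>\<open>real^'n^'n\<close> the operation \<open>*\<close> is the entrywise product, \<open>**\<close> is the matrix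
  product, and \<open>mat 1\<close> is the identity matrix.
\<close>

definition SSP :: "real^'n^'n \<Rightarrow> bool" where
  "SSP A \<longleftrightarrow> transpose A = A \<and>
     (\<forall>X :: real^'n^'n. transpose X = X \<and> A * X = 0 \<and> mat 1 * X = 0 \<and> A ** X - X ** A = 0
        \<longrightarrow> X = 0)"

definition spectrally_arbitrary_SSP :: "'n::finite set set \<Rightarrow> nat list \<Rightarrow> bool" where
  "spectrally_arbitrary_SSP G ms \<longleftrightarrow>
     (\<forall>ls :: real list. length ls = length ms \<and> sorted_wrt (<) ls \<longrightarrow>
        (\<exists>A\<in>schroedinger G. SSP A \<and> has_spectrum A ls ms))"

text \<open>
  The vertices of the graphs below are the elements \<open>1, 2, 3, 4, 5\<close> of the
  five-element type \<open>5\<close> of integers modulo five, where \<open>5 = 0\<close>.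
\<close>

type_synonym graph5 = "5 set set"

definition P5 :: graph5 where
  "P5 = {{1,2}, {2,3}, {3,4}, {4,5}}"

definition S211 :: graph5 where
  "S211 = {{1,2}, {2,3}, {3,4}, {3,5}}"

definition K14 :: graph5 where
  "K14 = {{1, j} | j. j \<in> {2,3,4,5}}"

definition L32 :: graph5 where
  "L32 = {{1,2}, {2,3}, {3,4}, {4,5}, {3,5}}"

definition Bull :: graph5 where
  "Bull = {{1,2}, {2,3}, {3,4}, {2,5}, {3,5}}"

definition C5 :: graph5 where
  "C5 = {{1,2}, {2,3}, {3,4}, {4,5}, {1,5}}"

definition Camp :: graph5 where
  "Camp = {{1,2}, {2,3}, {1,3}, {1,4}, {1,5}}"

definition Bnr :: graph5 where
  "Bnr = {{1,2}, {2,3}, {3,4}, {4,5}, {2,5}}"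

definition Dart :: graph5 where
  "Dart = {{1,2}, {2,3}, {3,4}, {4,5}, {2,5}, {2,4}}"

definition Kite :: graph5 where
  "Kite = {{1,2}, {2,3}, {3,4}, {4,5}, {2,5}, {3,5}}"

definition Hs :: graph5 where
  "Hs = {{1,2}, {2,3}, {3,4}, {1,4}, {3,5}, {4,5}}"

definition Gem :: graph5 where
  "Gem = {{1,2}, {2,3}, {3,4}, {4,5}, {1,5}, {1,3}, {1,4}}"

definition Bfly :: graph5 where
  "Bfly = {{1,2}, {2,3}, {1,3}, {1,4}, {4,5}, {1,5}}"

definition K23 :: graph5 where
  "K23 = {{i, j} | i j. i \<in> {1,2} \<and> j \<in> {3,4,5}}"

definition T5 :: graph5 where
  "T5 = {{1,3}, {2,3}, {2,5}, {1,5}, {1,4}, {2,4}, {1,2}}"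

definition L41 :: graph5 where
  "L41 = {{1,2}, {2,3}, {3,4}, {4,5}, {2,5}, {2,4}, {3,5}}"

definition K4e :: graph5 where
  "K4e = {{1,4}, {1,2}, {2,3}, {3,4}, {4,5}, {2,5}, {1,3}}"

definition W5 :: graph5 where
  "W5 = {{1,4}, {1,2}, {2,3}, {3,4}, {4,5}, {2,5}, {1,5}, {1,3}}"

definition FHs :: graph5 where
  "FHs = {{1,2}, {2,3}, {3,4}, {1,4}, {1,3}, {3,5}, {4,5}, {2,4}}"

definition K5 :: graph5 where
  "K5 = {{i, j} | i j. i \<noteq> j}"

definition K5_minus_e :: graph5 where
  "K5_minus_e = K5 - {{1,2}}"

end

theory Submission
  imports Defs
begin

text \<open>
  Realizability.  The SSP says that the orthogonal conjugates of \<open>A\<close> are transversal to the matrices with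
  the pattern of \<open>G\<close>, so an open mapping argument lets a matrix of \<open>G\<close> with the SSP be perturbed to one of any
  supergraph, keeping the spectrum and the SSP.  It therefore suffices to treat a few sparse graphs: the empty
  graph, \<open>K\<^sub>1\<^sub>,\<^sub>3\<close>, \<open>K\<^sub>3\<close> and \<open>K\<^sub>4\<close> with isolated vertices added, \<open>Camp\<close>, \<open>K\<^sub>2\<^sub>,\<^sub>3\<close>, \<open>C\<^sub>5\<close> and \<open>K\<^sub>5\<close>.

  Exclusion.  The smallest eigenvalue is simple by Perron's argument, and so is the largest one for a bipartite
  graph.  Zero forcing bounds the multiplicities for the sparse graphs.  An eigenvalue of multiplicity 3
  turns \<open>A - c\<close> into a Gram matrix of vectors in the Euclidean or in the Lorentzian plane, where the zero
  pattern becomes a condition on orthogonal vectors.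
\<close>

section \<open>Spectra of symmetric matrices\<close>

text \<open>Only orthogonal conjugates of a matrix occur in the perturbation, so its spectrum is
  kept exactly; the open mapping theorem solves for the nonedge entries alone, making the new edges
  slightly negative and leaving the other nonedges at zero. The sparse graphs must therefore realize
  arbitrary prescribed eigenvalues, not merely one example. An isolated vertex contributes one
  eigenvalue of free choice. But a direct sum whose blocks share an eigenvalue never has the SSP:
  eigenvectors \<open>a\<close>, \<open>b\<close> from two blocks yield a commuting matrix with
  blocks \<open>a b^T\<close> and \<open>b a^T\<close>. A multiple eigenvalue must hence live on a
  single component. This is why \<open>C5\<close> needs a construction of its own: the components of
  its proper subgraphs are paths, which have simple spectra. The signs of the entries matter as well
  as the zero pattern. They make a list and its reversal inequivalent, and the exclusions of 122 for
  \<open>Kite\<close>, of 1121 for \<open>C5\<close> and of 113 in the presence of an induced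
  4-cycle all end in a sign contradiction.\<close>

lemma symmetric_matrix_inner:
  fixes A :: "real^'n^'n"
  assumes "transpose A = A"
  shows "(A *v x) \<bullet> y = x \<bullet> (A *v y)"
  by (metis assms dot_lmul_matrix transpose_matrix_vector)

lemma quadratic_nonneg_imp_linear_coeff_0:
  fixes a b :: real
  assumes "\<And>t. 0 \<le> 2 * t * a + t\<^sup>2 * b"
  shows "a = 0"
proof (rule ccontr)
  assume "a \<noteq> 0"
  define s where "s = 1 + \<bar>b\<bar>"
  have s: "s > 0" "b < s" by (auto simp: s_def)
  have "0 \<le> 2 * (- a / s) * a + (- a / s)\<^sup>2 * b" using assms .
  also have "\<dots> = (a\<^sup>2 / s\<^sup>2) * (b - 2 * s)"
    using s by (simp add: field_simps power2_eq_square)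
  also have "\<dots> < 0"
    using s \<open>a \<noteq> 0\<close> by (intro mult_pos_neg) auto
  finally show False by simp
qed

text \<open>First variation: \<open>x\<close> minimizes the form of \<open>A - m\<close> on
  \<open>S\<close>, so its derivative in the direction of the residual \<open>y = A x - m x\<close>
  vanishes. Invariance puts \<open>y\<close> into \<open>S\<close>, and that derivative is a
  multiple of \<open>y \<bullet> y\<close>.\<close>

lemma psd_form_null_vector:
  fixes A :: "real^'n^'n"
  assumes sym: "transpose A = A" and S: "subspace S" and inv: "\<And>x. x \<in> S \<Longrightarrow> A *v x \<in> S"
    and psd: "\<And>z. z \<in> S \<Longrightarrow> m * (z \<bullet> z) \<le> z \<bullet> (A *v z)"
    and x: "x \<in> S" "x \<bullet> (A *v x) = m * (x \<bullet> x)"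
  shows "A *v x = m *\<^sub>R x"
proof -
  define y where "y = A *v x - m *\<^sub>R x"
  have yS: "y \<in> S" unfolding y_def using S inv x by (simp add: subspace_diff subspace_scale)
  have "y \<bullet> y = 0"
  proof (rule quadratic_nonneg_imp_linear_coeff_0)
    fix t
    have "x + t *\<^sub>R y \<in> S" using S x yS by (simp add: subspace_add subspace_scale)
    from psd[OF this] have "m * ((x + t *\<^sub>R y) \<bullet> (x + t *\<^sub>R y)) \<le>
        (x + t *\<^sub>R y) \<bullet> (A *v (x + t *\<^sub>R y))" .
    moreover have "x \<bullet> (A *v y) = y \<bullet> (A *v x)"
      by (metis inner_commute sym symmetric_matrix_inner)
    ultimately have "0 \<le> 2 * t * (y \<bullet> (A *v x) - m * (y \<bullet> x)) +
        t\<^sup>2 * (y \<bullet> (A *v y) - m * (y \<bullet> y))"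
      using x(2) by (simp add: inner_simps matrix_vector_right_distrib matrix_vector_mult_scaleR
          algebra_simps power2_eq_square inner_commute)
    moreover have "y \<bullet> y = y \<bullet> (A *v x) - m * (y \<bullet> x)"
      by (simp add: y_def inner_simps)
    ultimately show "0 \<le> 2 * t * (y \<bullet> y) + t\<^sup>2 * (y \<bullet> (A *v y) - m * (y \<bullet> y))" by simp
  qed
  then show ?thesis by (simp add: y_def)
qed

text \<open>The Rayleigh quotient attains its minimum on the compact unit sphere of
  \<open>S\<close>. The bound in the last conjunct is kept for Perron's argument, where
  \<open>S\<close> is the whole space.\<close>

lemma minimal_eigenvector:
  fixes A :: "real^'n^'n"
  assumes sym: "transpose A = A" and S: "subspace S" and inv: "\<And>x. x \<in> S \<Longrightarrow> A *v x \<in> S"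
    and nz: "S \<noteq> {0}"
  shows "\<exists>x\<in>S. \<exists>m. norm x = 1 \<and> A *v x = m *\<^sub>R x \<and> (\<forall>z\<in>S. m * (z \<bullet> z) \<le> z \<bullet> (A *v z))"
proof -
  have "compact (sphere 0 1 \<inter> S)"
    by (simp add: S closed_subspace compact_Int_closed)
  moreover obtain s where s: "s \<in> S" "s \<noteq> 0"
    using nz S subspace_0 by blast
  then have "(1 / norm s) *\<^sub>R s \<in> sphere 0 1 \<inter> S"
    using S by (simp add: subspace_scale)
  then have "sphere 0 1 \<inter> S \<noteq> {}" by blast
  moreover have "continuous_on (sphere 0 1 \<inter> S) (\<lambda>x. x \<bullet> (A *v x))"
    by (intro continuous_on_inner continuous_on_id linear_continuous_on matrix_vector_mul_bounded_linear)
  ultimately have "\<exists>x\<in>sphere 0 1 \<inter> S. \<forall>y\<in>sphere 0 1 \<inter> S. x \<bullet> (A *v x) \<le> y \<bullet> (A *v y)"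
    by (rule continuous_attains_inf)
  then obtain x where x: "x \<in> sphere 0 1 \<inter> S"
    and min: "\<And>y. y \<in> sphere 0 1 \<inter> S \<Longrightarrow> x \<bullet> (A *v x) \<le> y \<bullet> (A *v y)"
    by blast
  define m where "m = x \<bullet> (A *v x)"
  have psd: "m * (z \<bullet> z) \<le> z \<bullet> (A *v z)" if "z \<in> S" for z
  proof (cases "z = 0")
    case False
    have "m \<le> ((1 / norm z) *\<^sub>R z) \<bullet> (A *v ((1 / norm z) *\<^sub>R z))"
      unfolding m_def using False that S by (intro min) (simp add: subspace_scale)
    also have "\<dots> = (z \<bullet> (A *v z)) / (z \<bullet> z)"
      by (simp add: matrix_vector_mult_scaleR dot_square_norm power2_eq_square)
    finally show ?thesis using False by (simp add: pos_le_divide_eq)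
  qed simp
  have "x \<bullet> x = 1" using x by (simp add: dot_square_norm)
  then have "A *v x = m *\<^sub>R x"
    using psd_form_null_vector[OF sym S inv psd, of x] x by (simp add: m_def)
  with x psd show ?thesis by auto
qed

text \<open>Induction on the dimension: split off one eigenvector; symmetry of \<open>A\<close>
  keeps its orthogonal complement in \<open>S\<close> invariant.\<close>

lemma invariant_subspace_eigenbasis:
  fixes A :: "real^'n^'n"
  assumes sym: "transpose A = A" and "subspace S" and "\<And>x. x \<in> S \<Longrightarrow> A *v x \<in> S"
  shows "\<exists>B\<subseteq>S. finite B \<and> card B = dim S \<and> pairwise orthogonal B \<and>
    (\<forall>x\<in>B. norm x = 1 \<and> (\<exists>c. A *v x = c *\<^sub>R x))"
  using assms(2,3)
proof (induction "dim S" arbitrary: S)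
  case 0
  then show ?case by (intro exI[of _ "{}"]) (auto simp: pairwise_def)
next
  case (Suc k)
  then have "S \<noteq> {0}" by auto
  then obtain x m where x: "x \<in> S" "norm x = 1" "A *v x = m *\<^sub>R x"
    using minimal_eigenvector[OF sym, of S] Suc.prems by metis
  define T where "T = {y \<in> S. orthogonal x y}"
  have T: "subspace T"
    unfolding T_def using Suc.prems(1)
    by (auto simp: subspace_def orthogonal_clauses)
  have dimS: "dim S = dim T + 1"
  proof -
    have "dim {y \<in> S. \<forall>z\<in>span {x}. orthogonal z y} + dim (span {x}) = dim S"
      by (rule dim_subspace_orthogonal_to_vectors)
        (use Suc.prems x in \<open>auto simp: span_minimal\<close>)
    moreover have "{y \<in> S. \<forall>z\<in>span {x}. orthogonal z y} = T"
      unfolding T_def by (auto simp: span_singleton orthogonal_def)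
    moreover have "dim (span {x}) = 1"
      using x by (auto simp: dim_insert dim_span)
    ultimately show ?thesis by simp
  qed
  have inv: "A *v y \<in> T" if "y \<in> T" for y
    using that Suc.prems x symmetric_matrix_inner[OF sym, of x y]
    by (simp add: T_def orthogonal_def)
  have "k = dim T" using dimS Suc.hyps(2) by simp
  from Suc.hyps(1)[OF this T inv] obtain B where B: "B \<subseteq> T" "finite B" "card B = dim T"
    "pairwise orthogonal B" "\<forall>x\<in>B. norm x = 1 \<and> (\<exists>c. A *v x = c *\<^sub>R x)" by blast
  have "x \<notin> B" using B(1) x by (auto simp: T_def orthogonal_def dot_square_norm)
  then show ?case
    using B x dimS
    by (intro exI[of _ "insert x B"])
      (auto simp: T_def pairwise_insert orthogonal_commute subset_iff)
qed

lemma spectral_theorem_real: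
  fixes A :: "real^'n^'n"
  assumes "transpose A = A"
  obtains b :: "'n \<Rightarrow> real^'n" and c :: "'n \<Rightarrow> real"
  where "\<And>k l. b k \<bullet> b l = (if k = l then 1 else 0)" "\<And>k. A *v b k = c k *\<^sub>R b k"
proof -
  obtain B :: "(real^'n) set" where B: "finite B" "card B = dim (UNIV :: (real^'n) set)"
    "pairwise orthogonal B" "\<forall>x\<in>B. norm x = 1 \<and> (\<exists>c. A *v x = c *\<^sub>R x)"
    using invariant_subspace_eigenbasis[OF assms subspace_UNIV] by auto
  then have "card (UNIV :: 'n set) = card B" by simp
  with B(1) obtain b where b: "bij_betw b (UNIV :: 'n set) B"
    using finite_same_card_bij by (metis finite)
  have bB: "b k \<in> B" for k using b by (auto simp: bij_betw_def)
  then have "\<forall>k. \<exists>c. A *v b k = c *\<^sub>R b k" using B(4) by blast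
  then obtain c where c: "\<And>k. A *v b k = c k *\<^sub>R b k" by metis
  have "b k \<bullet> b l = (if k = l then 1 else 0)" for k l
  proof (cases "k = l")
    case True
    then show ?thesis using bB B(4) by (simp add: dot_square_norm)
  next
    case False
    then have "b k \<noteq> b l" using b by (simp add: bij_betw_def inj_eq)
    then have "orthogonal (b k) (b l)" using B(3) bB by (simp add: pairwise_def)
    then show ?thesis using False by (simp add: orthogonal_def)
  qed
  from this c show ?thesis by (rule that)
qed

text \<open>Reads the spectrum off explicit eigenvectors. Orthogonality has to be checked only
  inside an eigenspace, since eigenvectors to different eigenvalues of a symmetric matrix are
  orthogonal anyway; indexing by \<open>'n\<close> then makes the family a basis.\<close>

lemma spectrum_of_eigenvectors:
  fixes A :: "real^'n^'n" and b :: "'n \<Rightarrow> real^'n"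
  assumes sym: "transpose A = A" and nz: "\<And>k. b k \<noteq> 0" and ev: "\<And>k. A *v b k = c k *\<^sub>R b k"
    and orth: "\<And>k l. k \<noteq> l \<Longrightarrow> c k = c l \<Longrightarrow> b k \<bullet> b l = 0"
  shows "eigenvalues A = range c" and "multiplicity_of A \<mu> = card {k. c k = \<mu>}"
proof -
  have orth': "b k \<bullet> b l = 0" if "k \<noteq> l" for k l
  proof (cases "c k = c l")
    case False
    have "c k * (b k \<bullet> b l) = c l * (b k \<bullet> b l)"
      using symmetric_matrix_inner[OF sym, of "b k" "b l"] ev by simp
    then show ?thesis using False by simp
  qed (use orth that in blast)
  have inj: "inj b"
    using orth' nz by (metis injI inner_eq_zero_iff)
  have ind: "independent (range b)"
    using nz by (intro pairwise_orthogonal_independent)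
      (auto simp: pairwise_def orthogonal_def intro!: orth')
  have "span (range b) = UNIV"
    using card_ge_dim_independent[of "range b" UNIV] ind by (auto simp: card_image[OF inj])
  then have zero: "w = 0" if "\<And>k. w \<bullet> b k = 0" for w
    by (metis UNIV_I orthogonal_def orthogonal_self orthogonal_to_span rangeE that)
  have E: "{v. A *v v = \<mu> *\<^sub>R v} = span (b ` {k. c k = \<mu>})" for \<mu>
  proof
    show "{v. A *v v = \<mu> *\<^sub>R v} \<subseteq> span (b ` {k. c k = \<mu>})"
    proof
      fix v assume "v \<in> {v. A *v v = \<mu> *\<^sub>R v}"
      then have v: "A *v v = \<mu> *\<^sub>R v" by simp
      define u where "u = (\<Sum>k\<in>{k. c k = \<mu>}. ((v \<bullet> b k) / (b k \<bullet> b k)) *\<^sub>R b k)"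
      have "v - u = 0"
      proof (rule zero)
        fix l
        have ul: "u \<bullet> b l = (\<Sum>k\<in>{k. c k = \<mu>}. if k = l then v \<bullet> b l else 0)"
          unfolding u_def inner_sum_left using orth' nz
          by (intro sum.cong) auto
        show "(v - u) \<bullet> b l = 0"
        proof (cases "c l = \<mu>")
          case True
          then show ?thesis by (simp add: inner_simps ul)
        next
          case False
          have "c l * (v \<bullet> b l) = \<mu> * (v \<bullet> b l)"
            using symmetric_matrix_inner[OF sym, of v "b l"] ev v by auto
          then have "v \<bullet> b l = 0" using False by auto
          then show ?thesis using False by (simp add: inner_simps ul)
        qed
      qed
      moreover have "u \<in> span (b ` {k. c k = \<mu>})"
        unfolding u_def by (intro span_sum span_scale span_base) auto
      ultimately show "v \<in> span (b ` {k. c k = \<mu>})" by simp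
    qed
    show "span (b ` {k. c k = \<mu>}) \<subseteq> {v. A *v v = \<mu> *\<^sub>R v}"
      by (rule span_minimal)
        (auto simp: subspace_def ev matrix_vector_right_distrib matrix_vector_mult_scaleR
          algebra_simps)
  qed
  have dim: "dim {v. A *v v = \<mu> *\<^sub>R v} = card {k. c k = \<mu>}" for \<mu>
  proof -
    have "independent (b ` {k. c k = \<mu>})"
      using ind by (rule independent_mono) auto
    then show ?thesis
      unfolding E dim_span
      by (simp add: dim_eq_card_independent card_image inj_on_subset[OF inj])
  qed
  then show "multiplicity_of A \<mu> = card {k. c k = \<mu>}" by (simp add: multiplicity_of_def)
  show "eigenvalues A = range c"
  proof
    show "range c \<subseteq> eigenvalues A" using ev nz by (auto simp: eigenvalues_def)
    show "eigenvalues A \<subseteq> range c"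
    proof
      fix \<mu> assume "\<mu> \<in> eigenvalues A"
      then obtain v where "v \<noteq> 0" "v \<in> {v. A *v v = \<mu> *\<^sub>R v}" by (auto simp: eigenvalues_def)
      then have "{k. c k = \<mu>} \<noteq> {}" unfolding E by (metis image_empty singletonD span_empty)
      then show "\<mu> \<in> range c" by auto
    qed
  qed
qed

lemma multiplicity_of_pos:
  assumes "c \<in> eigenvalues A"
  shows "multiplicity_of A c > 0"
proof -
  obtain v where "v \<noteq> 0" "A *v v = c *\<^sub>R v" using assms by (auto simp: eigenvalues_def)
  then have "\<not> {v. A *v v = c *\<^sub>R v} \<subseteq> {0}" by auto
  then show ?thesis unfolding multiplicity_of_def by (metis dim_eq_0 gr0I)
qed

text \<open>Subtracting \<open>\<mu>\<close> removes the eigenvectors of \<open>\<mu>\<close> from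
  the expansion, so an eigenvalue of high multiplicity leaves a sum of few rank-one terms. The
  exclusions of large multiplicities rest on this.\<close>

lemma spectral_expansion:
  fixes A :: "real^'n^'n"
  assumes sym: "transpose A = A"
  shows "\<exists>(c :: 'n \<Rightarrow> real) b. eigenvalues A = range c \<and> (\<forall>\<mu>. multiplicity_of A \<mu> = card {k. c k = \<mu>}) \<and>
    (\<forall>\<mu> i j. A $ i $ j - (if i = j then \<mu> else 0) =
       (\<Sum>k\<in>{k. c k \<noteq> \<mu>}. (c k - \<mu>) * b k $ i * b k $ j))"
proof -
  obtain b :: "'n \<Rightarrow> real^'n" and c where b: "\<And>k l. b k \<bullet> b l = (if k = l then 1 else 0)"
    and ev: "\<And>k. A *v b k = c k *\<^sub>R b k" using spectral_theorem_real[OF sym] by metis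
  have nz: "b k \<noteq> 0" for k using b[of k k] by auto
  have orth: "b k \<bullet> b l = 0" if "k \<noteq> l" "c k = c l" for k l using b that by simp
  have spec: "eigenvalues A = range c" "multiplicity_of A \<mu> = card {k. c k = \<mu>}" for \<mu>
    by (rule spectrum_of_eigenvectors[OF sym nz ev orth]; assumption)+
  define P :: "real^'n^'n" where "P = (\<chi> i k. b k $ i)"
  have "(\<Sum>i\<in>UNIV. b k $ i * b l $ i) = (if k = l then 1 else 0)" for k l
    using b[of k l] by (simp add: inner_vec_def)
  then have "transpose P ** P = mat 1"
    by (simp add: P_def vec_eq_iff transpose_def matrix_matrix_mult_def mat_def)
  \<comment> \<open>Orthonormality of the vectors turns into completeness, because a left inverse of
    a square matrix is a right inverse.\<close>
  then have PP: "P ** transpose P = mat 1" by (rule matrix_left_right_inverse[THEN iffD1])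
  have one: "(\<Sum>k\<in>UNIV. b k $ i * b k $ j) = (if i = j then 1 else 0)" for i j
    using PP by (simp add: P_def vec_eq_iff transpose_def matrix_matrix_mult_def mat_def)
  have "A ** P = (\<chi> i k. c k * b k $ i)"
    using ev by (simp add: P_def vec_eq_iff matrix_matrix_mult_def matrix_vector_mult_def)
  then have "A = (\<chi> i k. c k * b k $ i) ** transpose P"
    by (metis PP matrix_mul_assoc matrix_mul_rid)
  then have A: "A $ i $ j = (\<Sum>k\<in>UNIV. c k * b k $ i * b k $ j)" for i j
    by (simp add: P_def vec_eq_iff transpose_def matrix_matrix_mult_def)
  have "A $ i $ j - (if i = j then \<mu> else 0) =
       (\<Sum>k\<in>{k. c k \<noteq> \<mu>}. (c k - \<mu>) * b k $ i * b k $ j)" for \<mu> i j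
  proof -
    have "A $ i $ j - (if i = j then \<mu> else 0) = (\<Sum>k\<in>UNIV. (c k - \<mu>) * b k $ i * b k $ j)"
    proof -
      have "(\<Sum>k\<in>UNIV. (c k - \<mu>) * b k $ i * b k $ j) =
          (\<Sum>k\<in>UNIV. c k * b k $ i * b k $ j) - \<mu> * (\<Sum>k\<in>UNIV. b k $ i * b k $ j)"
        unfolding sum_distrib_left sum_subtractf[symmetric]
        by (rule sum.cong) (simp_all add: algebra_simps)
      then show ?thesis by (simp add: A[of i j] one)
    qed
    also have "\<dots> = (\<Sum>k\<in>{k. c k \<noteq> \<mu>}. (c k - \<mu>) * b k $ i * b k $ j)"
      by (rule sum.mono_neutral_right) auto
    finally show ?thesis .
  qed
  with spec show ?thesis by blast
qed

lemma has_spectrum_sum_list: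
  fixes A :: "real^'n^'n"
  assumes "transpose A = A" "has_spectrum A ls ms"
  shows "sum_list ms = CARD('n)" and "\<And>m. m \<in> set ms \<Longrightarrow> m > 0"
proof -
  obtain c :: "'n \<Rightarrow> real" where c: "eigenvalues A = range c"
    "\<And>\<mu>. multiplicity_of A \<mu> = card {k. c k = \<mu>}"
    using spectral_expansion[OF assms(1)] by blast
  have ls: "distinct ls" "set ls = range c" "ms = map (multiplicity_of A) ls"
    using assms(2) c(1) unfolding has_spectrum_def by (auto simp: strict_sorted_iff)
  have "sum_list ms = (\<Sum>\<mu>\<in>range c. card {k. c k = \<mu>})"
    using ls by (simp add: sum_list_distinct_conv_sum_set c(2))
  also have "\<dots> = card (\<Union>\<mu>\<in>range c. {k. c k = \<mu>})"
    by (rule card_UN_disjoint[symmetric]) auto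
  also have "(\<Union>\<mu>\<in>range c. {k. c k = \<mu>}) = UNIV" by auto
  finally show "sum_list ms = CARD('n)" .
  show "m > 0" if "m \<in> set ms" for m
    using that assms(2) multiplicity_of_pos[of _ A] unfolding has_spectrum_def by auto
qed

text \<open>Common transport principle for orthogonal similarity, for relabelling of vertices and
  for the sign change on a bipartite graph: an intertwining isomorphism carries eigenspaces onto
  eigenspaces.\<close>

lemma has_spectrum_linear_iso:
  fixes A A' :: "real^'n^'n"
  assumes "has_spectrum A ls ms" and f: "linear f" "bij f" and com: "\<And>v. A' *v (f v) = f (A *v v)"
  shows "has_spectrum A' ls ms"
proof -
  have inj: "inj f" and surj: "surj f" using f by (auto simp: bij_def)
  have E: "{v. A' *v v = c *\<^sub>R v} = f ` {v. A *v v = c *\<^sub>R v}" for c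
  proof -
    have "A' *v (f v) = c *\<^sub>R f v \<longleftrightarrow> A *v v = c *\<^sub>R v" for v
      using inj by (simp add: com inj_eq linear_cmul[OF f(1), symmetric])
    note * = this
    show ?thesis
    proof (intro set_eqI iffI)
      fix w assume w: "w \<in> {v. A' *v v = c *\<^sub>R v}"
      obtain v where "w = f v" using surj by (metis surjD)
      with w * show "w \<in> f ` {v. A *v v = c *\<^sub>R v}" by auto
    qed (use * in auto)
  qed
  have "multiplicity_of A' c = multiplicity_of A c" for c
    unfolding multiplicity_of_def E
    by (rule dim_image_eq) (use f inj in \<open>auto intro: inj_on_subset\<close>)
  moreover have "eigenvalues A' = eigenvalues A"
  proof -
    have ev: "c \<in> eigenvalues M \<longleftrightarrow> {v. M *v v = c *\<^sub>R v} \<noteq> {0}" for c and M :: "real^'n^'n"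
      by (auto simp: eigenvalues_def)
    have "f ` V = {0} \<longleftrightarrow> V = {0}" for V
      using inj linear_0[OF f(1)] by (metis image_empty image_insert inj_image_eq_iff)
    then show ?thesis by (intro set_eqI) (simp only: ev E)
  qed
  ultimately show ?thesis using assms(1) unfolding has_spectrum_def by (metis (no_types, lifting) ext)
qed

section \<open>The strong spectral property and supergraphs\<close>

lemma bounded_bilinear_matrix_mult:
  "bounded_bilinear ((**) :: real^'n^'n \<Rightarrow> real^'n^'n \<Rightarrow> real^'n^'n)"
  unfolding bilinear_conv_bounded_bilinear[symmetric] bilinear_def
  by (auto intro!: linearI simp: vec_eq_iff matrix_matrix_mult_def sum.distrib sum_distrib_left
      algebra_simps)

lemma matrix_mult_norm_bound:
  "\<exists>K>0. \<forall>(X :: real^'n^'n) (Y :: real^'n^'n). norm (X ** Y) \<le> norm X * norm Y * K"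
  by (rule bounded_bilinear.pos_bounded[OF bounded_bilinear_matrix_mult])

lemmas matrix_mult_diff = bounded_bilinear.diff_left[OF bounded_bilinear_matrix_mult]
  bounded_bilinear.diff_right[OF bounded_bilinear_matrix_mult]
lemmas matrix_mult_add = bounded_bilinear.add_left[OF bounded_bilinear_matrix_mult]
  bounded_bilinear.add_right[OF bounded_bilinear_matrix_mult]

lemma bounded_linear_transpose: "bounded_linear (transpose :: real^'n^'n \<Rightarrow> real^'n^'n)"
  unfolding linear_conv_bounded_linear[symmetric]
  by (auto intro!: linearI simp: vec_eq_iff transpose_def)

lemma transpose_diff: "transpose (X - Y) = transpose X - transpose (Y :: real^'n^'n)"
  by (rule linear_diff[OF bounded_linear.linear[OF bounded_linear_transpose]])

text \<open>On matrices \<open>\<bullet>\<close> is the Frobenius inner product; multiplication by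
  \<open>A\<close> has multiplication by \<open>transpose A\<close> as its adjoint.\<close>

lemma inner_matrix_mult_left:
  fixes A Z S :: "real^'n^'n"
  shows "Z \<bullet> (A ** S) = (transpose A ** Z) \<bullet> S"
proof -
  have "Z \<bullet> (A ** S) = (\<Sum>i\<in>UNIV. \<Sum>j\<in>UNIV. \<Sum>k\<in>UNIV. A $ i $ k * Z $ i $ j * S $ k $ j)"
    by (simp add: inner_vec_def matrix_matrix_mult_def sum_distrib_left ac_simps)
  also have "\<dots> = (\<Sum>i\<in>UNIV. \<Sum>k\<in>UNIV. \<Sum>j\<in>UNIV. A $ i $ k * Z $ i $ j * S $ k $ j)"
    by (intro sum.cong refl sum.swap)
  also have "\<dots> = (\<Sum>k\<in>UNIV. \<Sum>i\<in>UNIV. \<Sum>j\<in>UNIV. A $ i $ k * Z $ i $ j * S $ k $ j)"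
    by (rule sum.swap)
  also have "\<dots> = (\<Sum>k\<in>UNIV. \<Sum>j\<in>UNIV. \<Sum>i\<in>UNIV. A $ i $ k * Z $ i $ j * S $ k $ j)"
    by (intro sum.cong refl sum.swap)
  also have "\<dots> = (transpose A ** Z) \<bullet> S"
    by (simp add: inner_vec_def matrix_matrix_mult_def transpose_def sum_distrib_right)
  finally show ?thesis .
qed

lemma inner_transpose: "transpose X \<bullet> transpose Y = X \<bullet> (Y :: real^'n^'n)"
  unfolding inner_vec_def transpose_def by (simp, rule sum.swap)

lemma inner_matrix_mult_right:
  fixes A Z S :: "real^'n^'n"
  shows "Z \<bullet> (S ** A) = (Z ** transpose A) \<bullet> S"
proof -
  have "Z \<bullet> (S ** A) = transpose Z \<bullet> (transpose A ** transpose S)"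
    by (simp add: inner_transpose flip: matrix_transpose_mul)
  also have "\<dots> = transpose (Z ** transpose A) \<bullet> transpose S"
    by (simp add: inner_matrix_mult_left matrix_transpose_mul)
  finally show ?thesis by (simp add: inner_transpose)
qed

text \<open>The orthogonal projection onto the space of test matrices of the SSP: symmetric, with
  zero diagonal, supported on the nonedges. Symmetrizing inside the definition makes it a projection
  of the whole matrix space.\<close>

definition nonedge_part :: "'n::finite set set \<Rightarrow> real^'n^'n \<Rightarrow> real^'n^'n" where
  "nonedge_part G Z = (\<chi> i j. if i \<noteq> j \<and> {i, j} \<notin> G then (Z $ i $ j + Z $ j $ i) / 2 else 0)"

lemma bounded_linear_nonedge_part: "bounded_linear (nonedge_part G)"
  unfolding linear_conv_bounded_linear[symmetric]
  by (auto intro!: linearI simp: vec_eq_iff nonedge_part_def field_simps)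

lemma nonedge_part_idem: "nonedge_part G (nonedge_part G Z) = nonedge_part G Z"
  by (auto simp: vec_eq_iff nonedge_part_def insert_commute field_simps)

lemma nonedge_part_selfadjoint: "nonedge_part G Y \<bullet> Z = Y \<bullet> nonedge_part G Z"
proof -
  define e where "e i j = (if i \<noteq> j \<and> {i, j} \<notin> G then 1 / 2 else 0 :: real)" for i j
  have e: "e i j = e j i" for i j by (auto simp: e_def insert_commute)
  have n: "nonedge_part G Z $ i $ j = e i j * Z $ i $ j + e i j * Z $ j $ i" for Z i j
    by (simp add: nonedge_part_def e_def field_simps)
  have "(\<Sum>i\<in>UNIV. \<Sum>j\<in>UNIV. e i j * Y $ j $ i * Z $ i $ j) =
      (\<Sum>i\<in>UNIV. \<Sum>j\<in>UNIV. e i j * Y $ i $ j * Z $ j $ i)"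
    by (subst sum.swap) (simp add: e)
  then show ?thesis
    by (simp add: inner_vec_def n algebra_simps sum.distrib)
qed

lemma schroedinger_symmetric: "A \<in> schroedinger G \<Longrightarrow> transpose A = A"
  by (simp add: schroedinger_def)

lemma symmetric_entry: "transpose A = A \<Longrightarrow> A $ i $ j = A $ j $ i"
  by (metis (no_types) transpose_def vec_lambda_beta)

text \<open>Off the diagonal, \<open>A\<close> is nonzero precisely on the edges, so the entrywise
  conditions on \<open>X\<close> say that the projection fixes \<open>X\<close>.\<close>

lemma SSP_iff_nonedge_part:
  fixes A :: "real^'n^'n"
  assumes A: "A \<in> schroedinger G"
  shows "SSP A \<longleftrightarrow> (\<forall>X. nonedge_part G X = X \<and> A ** X = X ** A \<longrightarrow> X = 0)"
proof -
  have "transpose X = X \<and> A * X = 0 \<and> mat 1 * X = 0 \<longleftrightarrow> nonedge_part G X = X" for X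
  proof
    assume X: "transpose X = X \<and> A * X = 0 \<and> mat 1 * X = 0"
    show "nonedge_part G X = X"
    proof (unfold vec_eq_iff, intro allI)
      fix i j
      have *: "A $ i $ j * X $ i $ j = 0" "(mat 1 :: real^'n^'n) $ i $ j * X $ i $ j = 0"
        using X by (metis vector_mult_component zero_index)+
      show "nonedge_part G X $ i $ j = X $ i $ j"
      proof (cases "i \<noteq> j \<and> {i, j} \<notin> G")
        case True
        then show ?thesis using symmetric_entry[of X j i] X by (simp add: nonedge_part_def)
      next
        case False
        then have "i = j \<or> A $ i $ j \<noteq> 0" using A by (fastforce simp: schroedinger_def)
        then have "X $ i $ j = 0" using * by (auto simp: mat_def)
        then show ?thesis using False by (auto simp: nonedge_part_def)
      qed
    qed
  next
    assume X: "nonedge_part G X = X"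
    have "transpose (nonedge_part G X) = nonedge_part G X"
      by (auto simp: nonedge_part_def vec_eq_iff transpose_def insert_commute add.commute)
    moreover have "A * nonedge_part G X = 0" "mat 1 * nonedge_part G X = 0"
      using A by (auto simp: nonedge_part_def vec_eq_iff schroedinger_def mat_def)
    ultimately show "transpose X = X \<and> A * X = 0 \<and> mat 1 * X = 0" using X by simp
  qed
  then show ?thesis using A schroedinger_symmetric unfolding SSP_def by (metis eq_iff_diff_eq_0)
qed

text \<open>The commutator with \<open>A\<close> is injective on the finite-dimensional space
  \<open>V\<close> of test matrices, hence bounded below there by \<open>e * norm X\<close>;
  replacing \<open>A\<close> by \<open>A'\<close> changes it by at most
  \<open>2 * K * norm (A' - A) * norm X\<close>. Test matrices for the larger graph \<open>H\<close>
  also lie in \<open>V\<close>.\<close>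

lemma SSP_open:
  fixes A :: "real^'n^'n"
  assumes A: "A \<in> schroedinger G" "SSP A" and "G \<subseteq> H"
  shows "\<exists>d>0. \<forall>A'\<in>schroedinger H. norm (A' - A) < d \<longrightarrow> SSP A'"
proof -
  define V where "V = {X. nonedge_part G X = X}"
  interpret p: bounded_linear "nonedge_part G" by (rule bounded_linear_nonedge_part)
  have V: "subspace V" unfolding V_def by (auto simp: subspace_def p.add p.scaleR p.zero)
  define f where "f X = A ** X - X ** A" for X :: "real^'n^'n"
  have f: "bounded_linear f" unfolding f_def
    by (intro bounded_linear_sub bounded_bilinear.bounded_linear_left
        bounded_bilinear.bounded_linear_right bounded_bilinear_matrix_mult)
  have "\<forall>X\<in>V. f X = 0 \<longrightarrow> X = 0"
    using A SSP_iff_nonedge_part[OF A(1)] by (simp add: V_def f_def)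
  from injective_imp_isometric[OF closed_subspace[OF V] V f this]
  obtain e where e: "e > 0" "\<And>X. X \<in> V \<Longrightarrow> e * norm X \<le> norm (f X)" by blast
  obtain K where K: "K > 0" "\<And>(X :: real^'n^'n) (Y :: real^'n^'n). norm (X ** Y) \<le> norm X * norm Y * K"
    using matrix_mult_norm_bound by blast
  have "SSP A'" if A': "A' \<in> schroedinger H" "norm (A' - A) < e / (2 * K)" for A'
  proof -
    have "X = 0" if X: "nonedge_part H X = X" "A' ** X = X ** A'" for X
    proof (rule ccontr)
      assume "X \<noteq> 0"
      have "nonedge_part G (nonedge_part H X) = nonedge_part H X"
        using \<open>G \<subseteq> H\<close> by (auto simp: nonedge_part_def vec_eq_iff insert_commute field_simps)
      then have "X \<in> V" using X by (simp add: V_def)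
      have "f X = X ** (A' - A) - (A' - A) ** X"
        using X by (simp add: f_def matrix_mult_diff)
      then have "norm (f X) \<le> norm (X ** (A' - A)) + norm ((A' - A) ** X)"
        by (simp add: norm_triangle_ineq4)
      also have "\<dots> \<le> 2 * K * norm (A' - A) * norm X"
        using K(2)[of X "A' - A"] K(2)[of "A' - A" X] by (simp add: ac_simps)
      also have "\<dots> < e * norm X"
        using A'(2) K(1) \<open>X \<noteq> 0\<close> by (simp add: field_simps)
      finally show False using e(2)[OF \<open>X \<in> V\<close>] by simp
    qed
    then show ?thesis using SSP_iff_nonedge_part[OF A'(1)] by blast
  qed
  then show ?thesis using e(1) K(1) by (intro exI[of _ "e / (2 * K)"]) auto
qed

section \<open>Orthogonal matrices from the Cayley transform\<close>

definition skew_part :: "real^'n^'n \<Rightarrow> real^'n^'n" where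
  "skew_part X = X - transpose X"

lemma bounded_linear_skew_part: "bounded_linear skew_part"
  unfolding skew_part_def[abs_def]
  by (intro bounded_linear_sub bounded_linear_ident bounded_linear_transpose)

lemma transpose_skew_part: "transpose (skew_part X) = - skew_part X"
  by (simp add: skew_part_def transpose_diff)

text \<open>The inverse of \<open>1 - K\<close> for the skew matrix \<open>K = skew_part X\<close>.
  It exists for every \<open>X\<close>, so the Cayley transform below is defined on the full matrix
  space.\<close>

definition skew_resolvent :: "real^'n^'n \<Rightarrow> real^'n^'n" where
  "skew_resolvent X = (SOME R. R ** (mat 1 - skew_part X) = mat 1)"

lemma skew_part_inner_0: "v \<bullet> (skew_part X *v v) = 0"
proof -
  have "v \<bullet> (transpose X *v v) = (X *v v) \<bullet> v"
    by (metis dot_lmul_matrix transpose_matrix_vector transpose_transpose)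
  then show ?thesis
    by (simp add: skew_part_def matrix_vector_mult_diff_rdistrib inner_simps inner_commute)
qed

text \<open>For skew \<open>K\<close> the vectors \<open>v\<close> and \<open>K v\<close> are
  orthogonal, so this is Pythagoras. It gives both invertibility of \<open>1 - K\<close> and a bound
  on the inverse.\<close>

lemma norm_le_one_minus_skew:
  "norm v \<le> norm ((mat 1 - skew_part X) *v v)"
proof -
  have "(norm ((mat 1 - skew_part X) *v v))\<^sup>2 = (norm v)\<^sup>2 + (norm (skew_part X *v v))\<^sup>2"
    using skew_part_inner_0[of v X]
    by (simp add: matrix_vector_mult_diff_rdistrib power2_norm_eq_inner inner_simps inner_commute)
  then show ?thesis by (metis le_add_same_cancel1 norm_ge_zero power2_le_imp_le zero_le_power2)
qed

lemma skew_resolvent_inverse: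
  "skew_resolvent X ** (mat 1 - skew_part X) = mat 1"
  "(mat 1 - skew_part X) ** skew_resolvent X = mat 1"
proof -
  have "\<exists>R. R ** (mat 1 - skew_part X) = mat 1"
    unfolding matrix_left_invertible_ker
    by (metis norm_le_one_minus_skew norm_le_zero_iff norm_zero)
  then show *: "skew_resolvent X ** (mat 1 - skew_part X) = mat 1"
    unfolding skew_resolvent_def by (rule someI_ex)
  then show "(mat 1 - skew_part X) ** skew_resolvent X = mat 1"
    by (rule matrix_left_right_inverse[THEN iffD1])
qed

text \<open>Each column is the image of a unit vector under a contraction, so every entry is at most
  1 in absolute value. The bound does not depend on \<open>X\<close>, which makes the Lipschitz
  estimate global.\<close>

lemma skew_resolvent_bounded:
  "norm (skew_resolvent X :: real^'n^'n) \<le> real CARD('n) * real CARD('n)"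
proof -
  have entry: "\<bar>skew_resolvent X $ i $ j\<bar> \<le> 1" for i j :: 'n
  proof -
    have "\<bar>skew_resolvent X $ i $ j\<bar> = \<bar>(skew_resolvent X *v axis j 1) $ i\<bar>"
      by (simp add: matrix_vector_mult_basis column_def)
    also have "\<dots> \<le> norm (skew_resolvent X *v axis j 1)" by (rule component_le_norm_cart)
    also have "\<dots> \<le> norm ((mat 1 - skew_part X) *v (skew_resolvent X *v axis j 1))"
      by (rule norm_le_one_minus_skew)
    also have "\<dots> = 1"
      by (simp add: matrix_vector_mul_assoc skew_resolvent_inverse norm_axis_1)
    finally show ?thesis .
  qed
  have "norm (skew_resolvent X) \<le> (\<Sum>i\<in>UNIV. norm (skew_resolvent X $ i))"
    unfolding norm_vec_def by (rule L2_set_le_sum) simp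
  also have "\<dots> \<le> (\<Sum>i\<in>(UNIV :: 'n set). \<Sum>j\<in>(UNIV :: 'n set). 1)"
    using entry by (intro sum_mono order_trans[OF norm_le_l1_cart]) auto
  finally show ?thesis by simp
qed

text \<open>The resolvent identity.\<close>

lemma skew_resolvent_diff:
  "skew_resolvent X - skew_resolvent Y =
    skew_resolvent X ** (skew_part X - skew_part Y) ** skew_resolvent Y"
proof -
  have "skew_resolvent X ** (skew_part X - skew_part Y) ** skew_resolvent Y =
    skew_resolvent X ** ((mat 1 - skew_part Y) - (mat 1 - skew_part X)) ** skew_resolvent Y"
    by simp
  also have "\<dots> = skew_resolvent X ** ((mat 1 - skew_part Y) ** skew_resolvent Y) -
      (skew_resolvent X ** (mat 1 - skew_part X)) ** skew_resolvent Y"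
    by (simp only: matrix_mult_diff matrix_mul_assoc)
  also have "\<dots> = skew_resolvent X - skew_resolvent Y"
    by (simp add: skew_resolvent_inverse)
  finally show ?thesis by simp
qed

lemma skew_resolvent_lipschitz:
  obtains C where "C > 0"
    "\<And>(X :: real^'n^'n) (Y :: real^'n^'n). norm (skew_resolvent X - skew_resolvent Y) \<le> C * norm (X - Y)"
proof -
  obtain K where K: "K > 0" "\<And>(X :: real^'n^'n) (Y :: real^'n^'n). norm (X ** Y) \<le> norm X * norm Y * K"
    using matrix_mult_norm_bound by blast
  obtain L where L: "L > 0" "\<And>X :: real^'n^'n. norm (skew_part X) \<le> norm X * L"
    using bounded_linear.pos_bounded[OF bounded_linear_skew_part] by blast
  define M where "M = real CARD('n) * real CARD('n)"
  have M: "M > 0" "\<And>X :: real^'n^'n. norm (skew_resolvent X) \<le> M"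
    using skew_resolvent_bounded by (auto simp: M_def)
  have "norm (skew_resolvent X - skew_resolvent Y) \<le> (M * (L * K) * (M * K)) * norm (X - Y)"
    for X Y :: "real^'n^'n"
  proof -
    have "norm (skew_resolvent X - skew_resolvent Y) \<le>
        norm (skew_resolvent X ** skew_part (X - Y)) * norm (skew_resolvent Y) * K"
      unfolding skew_resolvent_diff linear_diff[OF bounded_linear.linear[OF bounded_linear_skew_part], symmetric]
      by (rule K(2))
    also have "\<dots> \<le> (norm (skew_resolvent X) * norm (skew_part (X - Y)) * K) * M * K"
      using K M by (intro mult_right_mono mult_mono) (auto intro: order_trans[OF norm_ge_zero K(2)])
    also have "\<dots> \<le> (M * (norm (X - Y) * L) * K) * M * K"
      using K M L by (intro mult_right_mono mult_mono) auto
    finally show ?thesis by (simp add: ac_simps)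
  qed
  moreover have "M * (L * K) * (M * K) > 0" using K L M by simp
  ultimately show ?thesis using that by blast
qed

lemma skew_part_0 [simp]: "skew_part 0 = 0"
  by (simp add: skew_part_def vec_eq_iff transpose_def)

lemma skew_resolvent_0 [simp]: "skew_resolvent 0 = mat 1"
  using skew_resolvent_inverse(1)[of 0] by simp

lemma continuous_on_skew_resolvent: "continuous_on UNIV (skew_resolvent :: real^'n^'n \<Rightarrow> _)"
proof -
  obtain C where "C > 0"
    "\<And>(X :: real^'n^'n) (Y :: real^'n^'n). norm (skew_resolvent X - skew_resolvent Y) \<le> C * norm (X - Y)"
    using skew_resolvent_lipschitz by blast
  then have "C-lipschitz_on UNIV (skew_resolvent :: real^'n^'n \<Rightarrow> _)"
    by (intro lipschitz_onI) (auto simp: dist_norm)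
  then show ?thesis by (rule lipschitz_on_continuous_on)
qed

text \<open>With \<open>R\<close> the resolvent and \<open>K = skew_part h\<close>, the equation
  \<open>R h (1 - K) = 1\<close> gives \<open>R h - 1 - K = (R h - R 0) K\<close>, which is of
  second order in \<open>h\<close> by the Lipschitz bound.\<close>

lemma has_derivative_skew_resolvent:
  "((skew_resolvent :: real^'n^'n \<Rightarrow> _) has_derivative skew_part) (at 0)"
proof -
  obtain C where C: "C > 0"
    "\<And>(X :: real^'n^'n) (Y :: real^'n^'n). norm (skew_resolvent X - skew_resolvent Y) \<le> C * norm (X - Y)"
    using skew_resolvent_lipschitz by blast
  obtain K where K: "K > 0" "\<And>(X :: real^'n^'n) (Y :: real^'n^'n). norm (X ** Y) \<le> norm X * norm Y * K"
    using matrix_mult_norm_bound by blast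
  obtain L where L: "L > 0" "\<And>X :: real^'n^'n. norm (skew_part X) \<le> norm X * L"
    using bounded_linear.pos_bounded[OF bounded_linear_skew_part] by blast
  define r where "r h = norm (skew_resolvent h - mat 1 - skew_part h) / norm h" for h :: "real^'n^'n"
  have bound: "r h \<le> (C * L * K) * norm h" for h :: "real^'n^'n"
  proof (cases "h = 0")
    case False
    have "skew_resolvent h = mat 1 + skew_resolvent h ** skew_part h"
      using skew_resolvent_inverse(1)[of h] by (simp add: matrix_mult_diff algebra_simps)
    then have "skew_resolvent h - mat 1 - skew_part h = (skew_resolvent h - skew_resolvent 0) ** skew_part h"
      by (simp add: matrix_mult_diff) (metis add_diff_cancel_left')
    then have "norm (skew_resolvent h - mat 1 - skew_part h) \<le>
        norm (skew_resolvent h - skew_resolvent 0) * norm (skew_part h) * K"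
      using K(2) by metis
    also have "\<dots> \<le> (C * norm h) * (norm h * L) * K"
      using C(1) C(2)[of h 0] K L by (intro mult_right_mono mult_mono) auto
    finally show ?thesis using False by (simp add: r_def field_simps)
  qed (simp add: r_def)
  have "r \<midarrow>0\<rightarrow> 0"
  proof (rule tendsto_sandwich[of "\<lambda>_. 0" _ _ "\<lambda>h. (C * L * K) * norm h"])
    show "((\<lambda>h::real^'n^'n. (C * L * K) * norm h) \<longlongrightarrow> 0) (at 0)"
      by (rule tendsto_eq_intros | simp)+
  qed (use bound in \<open>auto simp: r_def\<close>)
  then show ?thesis
    unfolding has_derivative_at using bounded_linear_skew_part by (simp add: r_def[abs_def])
qed

text \<open>Takes the role of the matrix exponential: a map into the orthogonal matrices, equal to
  the identity at 0, whose derivative there reaches every skew matrix. Unlike for the exponential,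
  orthogonality is plain algebra.\<close>

definition cayley :: "real^'n^'n \<Rightarrow> real^'n^'n" where
  "cayley X = skew_resolvent X ** (mat 1 + skew_part X)"

text \<open>For skew \<open>K\<close>, the factors \<open>1 - K\<close> and \<open>1 + K\<close>
  commute and are transposes of each other.\<close>

lemma cayley_orthogonal: "cayley X ** transpose (cayley X) = mat 1"
proof -
  define P where "P = mat 1 - skew_part X"
  define Q where "Q = mat 1 + skew_part X"
  define R where "R = skew_resolvent X"
  have t: "transpose P = Q"
    by (simp add: P_def Q_def transpose_diff transpose_skew_part transpose_mat)
  have com: "Q ** P = P ** Q" by (simp add: P_def Q_def matrix_mult_diff matrix_mult_add)
  have RP: "R ** P = mat 1" using skew_resolvent_inverse by (simp add: P_def R_def)
  then have QR: "Q ** transpose R = mat 1"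
    by (metis matrix_left_right_inverse matrix_transpose_mul t transpose_mat)
  have "transpose Q = P" by (metis t transpose_transpose)
  then have "cayley X ** transpose (cayley X) = R ** (Q ** P) ** transpose R"
    by (simp add: cayley_def Q_def[symmetric] R_def[symmetric] matrix_transpose_mul matrix_mul_assoc)
  also have "\<dots> = (R ** P) ** (Q ** transpose R)"
    by (simp add: com matrix_mul_assoc)
  finally show ?thesis by (simp add: RP QR)
qed

lemma has_spectrum_orthogonal_similar:
  fixes A Q :: "real^'n^'n"
  assumes "has_spectrum A ls ms" and Q: "Q ** transpose Q = mat 1"
  shows "has_spectrum (Q ** A ** transpose Q) ls ms"
proof (rule has_spectrum_linear_iso[where f = "(*v) Q", OF assms(1)])
  have Q': "transpose Q ** Q = mat 1" using Q by (rule matrix_left_right_inverse[THEN iffD1])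
  show "linear ((*v) Q)" by simp
  show "bij ((*v) Q)"
    by (rule o_bij[of "(*v) (transpose Q)"])
      (auto simp: fun_eq_iff matrix_vector_mul_assoc Q Q' simp del: transpose_matrix_vector)
  show "(Q ** A ** transpose Q) *v (Q *v v) = Q *v (A *v v)" for v
    by (metis (no_types) Q' matrix_mul_assoc matrix_vector_mul_assoc matrix_vector_mul_lid)
qed

lemma cayley_0 [simp]: "cayley 0 = mat 1"
  by (simp add: cayley_def)

lemma continuous_on_cayley: "continuous_on UNIV cayley"
  unfolding cayley_def[abs_def]
  by (intro bounded_bilinear.continuous_on[OF bounded_bilinear_matrix_mult]
      continuous_on_skew_resolvent continuous_on_add continuous_on_const
      linear_continuous_on bounded_linear_skew_part)

lemma has_derivative_cayley: "(cayley has_derivative (\<lambda>h. 2 *\<^sub>R skew_part h)) (at 0)"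
  unfolding cayley_def[abs_def]
  by (rule has_derivative_eq_rhs, rule bounded_bilinear.FDERIV[OF bounded_bilinear_matrix_mult])
    (rule has_derivative_skew_resolvent has_derivative_add has_derivative_const
      bounded_linear_imp_has_derivative bounded_linear_skew_part | simp add: scaleR_2)+

text \<open>
  The SSP makes the derivative of \<open>X \<mapsto> nonedge_part G (B X)\<close> at 0 surjective onto the matrices supported on the
  nonedges of \<open>G\<close>; the second component of \<open>F\<close> is only there to obtain a derivative that is surjective onto
  all matrices.
\<close>

lemma supergraph_SSP:
  fixes A :: "real^'n^'n"
  assumes A: "A \<in> schroedinger G" "SSP A" and spec: "has_spectrum A ls ms" and GH: "G \<subseteq> H"
  shows "\<exists>A'\<in>schroedinger H. SSP A' \<and> has_spectrum A' ls ms"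
proof -
  define B where "B X = cayley X ** A ** transpose (cayley X)" for X
  have symA: "transpose A = A" using A(1) by (rule schroedinger_symmetric)
  have symB: "transpose (B X) = B X" for X
    by (simp add: B_def matrix_transpose_mul symA matrix_mul_assoc)
  have B0: "B 0 = A" by (simp add: B_def transpose_mat)
  have contB: "continuous_on UNIV B"
    unfolding B_def[abs_def]
    by (intro bounded_bilinear.continuous_on[OF bounded_bilinear_matrix_mult]
        continuous_on_cayley continuous_on_const
        linear_continuous_on_compose[OF continuous_on_cayley]
        bounded_linear.linear bounded_linear_transpose)
  have derB: "(B has_derivative (\<lambda>h. 2 *\<^sub>R (skew_part h ** A - A ** skew_part h))) (at 0)"
    unfolding B_def[abs_def]
    apply (rule has_derivative_eq_rhs)
     apply (rule bounded_bilinear.FDERIV[OF bounded_bilinear_matrix_mult]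
        has_derivative_cayley has_derivative_const
        bounded_linear.has_derivative[OF bounded_linear_transpose])+
    apply (rule ext)
    apply (simp add: transpose_mat linear_scale[OF bounded_linear.linear[OF bounded_linear_transpose]] transpose_skew_part
        bounded_bilinear.scaleR_left[OF bounded_bilinear_matrix_mult]
        bounded_bilinear.scaleR_right[OF bounded_bilinear_matrix_mult]
        bounded_bilinear.minus_right[OF bounded_bilinear_matrix_mult]
        bounded_bilinear.zero_right[OF bounded_bilinear_matrix_mult] scaleR_diff_right)
    done
  interpret p: bounded_linear "nonedge_part G" by (rule bounded_linear_nonedge_part)
  define F where "F z = nonedge_part G (B (fst z)) + (snd z - nonedge_part G (snd z))"
    for z :: "(real^'n^'n) \<times> (real^'n^'n)"
  define F' where "F' z = nonedge_part G (2 *\<^sub>R (skew_part (fst z) ** A - A ** skew_part (fst z))) +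
      (snd z - nonedge_part G (snd z))"
    for z :: "(real^'n^'n) \<times> (real^'n^'n)"
  have contF: "continuous_on UNIV F"
    unfolding F_def[abs_def]
    by (intro continuous_intros p.continuous_on continuous_on_compose2[OF contB]) auto
  have "(B has_derivative (\<lambda>h. 2 *\<^sub>R (skew_part h ** A - A ** skew_part h)))
      (at (fst (0 :: (real^'n^'n) \<times> (real^'n^'n))))"
    using derB by simp
  note derB' = has_derivative_compose[OF has_derivative_fst[OF has_derivative_ident] this]
  have derF: "(F has_derivative F') (at 0)"
    unfolding F_def[abs_def] F'_def[abs_def]
    by (intro has_derivative_add has_derivative_diff p.has_derivative
        derB' has_derivative_snd has_derivative_ident)
  have linF': "linear F'" using derF by (simp add: has_derivative_linear)
  have "surj F'"
  proof (rule ccontr)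
    assume "\<not> surj F'"
    then have "dim (range F') < DIM(real^'n^'n)"
      using linear_subspace_image[OF linF' subspace_UNIV]
      by (metis dim_eq_full dim_subset_UNIV le_neq_implies_less span_eq_iff)
    then obtain Z where Z: "Z \<noteq> 0" "\<And>y. y \<in> span (range F') \<Longrightarrow> orthogonal Z y"
      using orthogonal_to_subspace_exists by blast
    then have orth: "Z \<bullet> F' z = 0" for z
      by (meson orthogonal_def rangeI span_base)
    have "Z \<bullet> (Y - nonedge_part G Y) = 0" for Y
      using orth[of "(0, Y)"] by (simp add: F'_def p.zero
          bounded_bilinear.zero_left[OF bounded_bilinear_matrix_mult]
          bounded_bilinear.zero_right[OF bounded_bilinear_matrix_mult])
    then have "(Z - nonedge_part G Z) \<bullet> Y = 0" for Y
      by (simp add: inner_diff_left inner_diff_right nonedge_part_selfadjoint)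
    then have Zn: "nonedge_part G Z = Z"
      by (metis eq_iff_diff_eq_0 inner_eq_zero_iff)
    \<comment> \<open>\<open>Z\<close> is a test matrix of the SSP that is orthogonal to the range
      of the derivative. Moving in the skew direction \<open>W\<close>, the commutator of
      \<open>Z\<close> and \<open>A\<close>, pairs with \<open>Z\<close> to
      \<open>4 * (W \<bullet> W)\<close>; so \<open>W = 0\<close>, and the SSP forces
      \<open>Z = 0\<close>.\<close>
    define W where "W = Z ** A - A ** Z"
    have symZ: "transpose Z = Z"
      by (subst (1 2) Zn[symmetric])
        (auto simp: nonedge_part_def vec_eq_iff transpose_def insert_commute add.commute)
    have skewW: "skew_part W = 2 *\<^sub>R W"
      by (simp add: skew_part_def W_def transpose_diff matrix_transpose_mul symA symZ scaleR_2)
    have "0 = Z \<bullet> F' (W, 0)" using orth by simp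
    also have "\<dots> = Z \<bullet> (2 *\<^sub>R (skew_part W ** A - A ** skew_part W))"
      by (simp add: F'_def p.zero nonedge_part_selfadjoint[symmetric] Zn del: inner_scaleR_right)
    also have "\<dots> = 4 * (Z \<bullet> (W ** A) - Z \<bullet> (A ** W))"
      by (simp add: skewW inner_diff_right
          bounded_bilinear.scaleR_left[OF bounded_bilinear_matrix_mult]
          bounded_bilinear.scaleR_right[OF bounded_bilinear_matrix_mult])
    also have "\<dots> = 4 * (W \<bullet> W)"
      using inner_matrix_mult_left[of Z A W] inner_matrix_mult_right[of Z W A]
      by (simp add: symA W_def inner_diff_left)
    finally have "W = 0" by simp
    then show False
      using Z(1) Zn A(2) SSP_iff_nonedge_part[OF A(1)] by (simp add: W_def)
  qed
  then obtain g where g: "linear g" "F' \<circ> g = id"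
    using linear_surjective_right_inverse[OF linF'] by blast
  obtain d where d: "d > 0" "\<And>A'. A' \<in> schroedinger H \<Longrightarrow> norm (A' - A) < d \<Longrightarrow> SSP A'"
    using SSP_open[OF A GH] by blast
  have "open {X. norm (B X - A) < d \<and> (\<forall>i j. A $ i $ j < 0 \<longrightarrow> B X $ i $ j < 0)}"
  proof -
    have "open {X. norm (B X - A) < d}"
      by (intro open_Collect_less continuous_intros contB)
    moreover have "open {X. A $ i $ j < 0 \<longrightarrow> B X $ i $ j < 0}" for i j
      by (cases "A $ i $ j < 0") (auto intro!: open_Collect_less continuous_intros contB)
    ultimately have "open ({X. norm (B X - A) < d} \<inter>
        (\<Inter>i. \<Inter>j. {X. A $ i $ j < 0 \<longrightarrow> B X $ i $ j < 0}))"
      by (intro open_Int open_INT ballI finite) auto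
    also have "{X. norm (B X - A) < d} \<inter> (\<Inter>i. \<Inter>j. {X. A $ i $ j < 0 \<longrightarrow> B X $ i $ j < 0}) =
        {X. norm (B X - A) < d \<and> (\<forall>i j. A $ i $ j < 0 \<longrightarrow> B X $ i $ j < 0)}" by auto
    finally show ?thesis .
  qed
  then have "open (fst -` {X. norm (B X - A) < d \<and> (\<forall>i j. A $ i $ j < 0 \<longrightarrow> B X $ i $ j < 0)} ::
      ((real^'n^'n) \<times> (real^'n^'n)) set)" (is "open ?T")
    by (intro open_vimage_fst)
  moreover have "0 \<in> ?T" using d B0 by simp
  \<comment> \<open>Sussmann's theorem asks for continuity and for a surjective derivative at the
    single point 0. The neighbourhood \<open>?T\<close> keeps the conjugate near \<open>A\<close>
    and the old edges negative.\<close>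
  ultimately have "F 0 \<in> interior (F ` ?T)"
    using g by (intro sussmann_open_mapping[OF open_UNIV contF _ derF])
      (auto simp: linear_conv_bounded_linear[symmetric] interior_open)
  moreover have "nonedge_part G A = 0"
    using A by (auto simp: nonedge_part_def vec_eq_iff schroedinger_def insert_commute)
  then have "F 0 = 0" by (simp add: F_def B0 p.zero)
  ultimately have "0 \<in> interior (F ` ?T)" by (simp only:)
  then obtain r where r: "r > 0" "ball 0 r \<subseteq> F ` ?T"
    unfolding mem_interior by blast
  \<comment> \<open>The target: equal small negative entries on the new edges, zero on the nonedges
    of \<open>H\<close>. The summand 1 in \<open>s\<close> covers the case
    \<open>J = 0\<close>.\<close>
  define J :: "real^'n^'n" where "J = (\<chi> i j. if i \<noteq> j \<and> {i, j} \<in> H \<and> {i, j} \<notin> G then - 1 else 0)"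
  define s where "s = r / (norm J + 1)"
  have s: "s > 0" using r by (simp add: s_def add_nonneg_pos)
  have pos: "norm J + 1 > 0" by (simp add: add_nonneg_pos)
  have "norm (s *\<^sub>R J) = s * norm J" using s by simp
  also have "\<dots> < s * (norm J + 1)" using s by simp
  also have "\<dots> = r" using pos by (simp add: s_def)
  finally have "norm (s *\<^sub>R J) < r" .
  then have "s *\<^sub>R J \<in> F ` ?T" using r by auto
  then obtain z where z: "s *\<^sub>R J = F z" "z \<in> ?T" by (rule imageE)
  define A' where "A' = B (fst z)"
  have A'T: "norm (A' - A) < d" "\<And>i j. A $ i $ j < 0 \<Longrightarrow> A' $ i $ j < 0"
    using z by (auto simp: A'_def)
  \<comment> \<open>Projecting the equation \<open>F z = s *\<^sub>R J\<close> kills the auxiliary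
    second component of \<open>F\<close>.\<close>
  have "nonedge_part G J = J"
    by (auto simp: J_def nonedge_part_def vec_eq_iff insert_commute)
  then have "s *\<^sub>R J = nonedge_part G (F z)" by (simp add: z(1)[symmetric] p.scaleR)
  also have "\<dots> = nonedge_part G A'"
    by (simp add: F_def A'_def p.add p.diff nonedge_part_idem)
  finally have nA': "nonedge_part G A' $ i $ j = s * J $ i $ j" for i j
    by (metis vector_scaleR_component real_scaleR_def)
  have sym: "transpose A' = A'" by (simp add: A'_def symB)
  have "A' $ i $ j = s * J $ i $ j" if "i \<noteq> j" "{i, j} \<notin> G" for i j
    using nA'[of i j] that symmetric_entry[OF sym, of i j] by (simp add: nonedge_part_def)
  then have "A' \<in> schroedinger H"
    using sym A'T(2) A(1) s GH by (fastforce simp: schroedinger_def J_def)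
  moreover have "SSP A'" using d A'T(1) calculation by blast
  moreover have "has_spectrum A' ls ms"
    unfolding A'_def B_def by (intro has_spectrum_orthogonal_similar spec cayley_orthogonal)
  ultimately show ?thesis by blast
qed

section \<open>Matrices of order five\<close>

lemma exhaust_5: "x = 1 \<or> x = 2 \<or> x = 3 \<or> x = 4 \<or> x = 5" for x :: 5
proof (induct x)
  case (of_int z)
  then have "z = 0 \<or> z = 1 \<or> z = 2 \<or> z = 3 \<or> z = 4" by fastforce
  then show ?case by auto
qed

lemma forall_5: "(\<forall>i::5. P i) \<longleftrightarrow> P 1 \<and> P 2 \<and> P 3 \<and> P 4 \<and> P 5"
  by (metis exhaust_5)

lemma UNIV_5: "UNIV = {1, 2, 3, 4, 5::5}"
  using exhaust_5 by auto

lemma sum_5: "sum f (UNIV::5 set) = f 1 + f 2 + f 3 + f 4 + f 5"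
  unfolding UNIV_5 by (simp add: ac_simps)

lemma card_5: "card {k::5. P k} = of_bool (P 1) + of_bool (P 2) + of_bool (P 3) + of_bool (P 4) + of_bool (P 5)"
proof -
  have "card {k::5. P k} = (\<Sum>k\<in>UNIV. of_bool (P k))"
    by (simp add: of_bool_def sum.If_cases)
  then show ?thesis by (simp add: sum_5)
qed

lemma vector_5 [simp]:
  "(vector [a, b, c, d, e] :: 'a::zero^5) $ 1 = a"
  "(vector [a, b, c, d, e] :: 'a::zero^5) $ 2 = b"
  "(vector [a, b, c, d, e] :: 'a::zero^5) $ 3 = c"
  "(vector [a, b, c, d, e] :: 'a::zero^5) $ 4 = d"
  "(vector [a, b, c, d, e] :: 'a::zero^5) $ 5 = e"
  by (simp_all add: vector_def)

text \<open>The unknowns are the ten entries of \<open>X\<close> above the diagonal. The commutator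
  of two symmetric matrices is skew, so its ten entries above the diagonal carry all of
  \<open>A ** X = X ** A\<close>.\<close>

lemma SSP_5I:
  fixes A :: "real^5^5"
  assumes "transpose A = A"
    and "\<And>x12 x13 x14 x15 x23 x24 x25 x34 x35 x45.
      \<lbrakk>A $ 1 $ 2 * x12 = 0;
      A $ 1 $ 3 * x13 = 0;
      A $ 1 $ 4 * x14 = 0;
      A $ 1 $ 5 * x15 = 0;
      A $ 2 $ 3 * x23 = 0;
      A $ 2 $ 4 * x24 = 0;
      A $ 2 $ 5 * x25 = 0;
      A $ 3 $ 4 * x34 = 0;
      A $ 3 $ 5 * x35 = 0;
      A $ 4 $ 5 * x45 = 0;
      A $ 1 $ 1 * x12 + A $ 1 $ 3 * x23 + A $ 1 $ 4 * x24 + A $ 1 $ 5 * x25 = x12 * A $ 2 $ 2 + x13 * A $ 3 $ 2 + x14 * A $ 4 $ 2 + x15 * A $ 5 $ 2;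
      A $ 1 $ 1 * x13 + A $ 1 $ 2 * x23 + A $ 1 $ 4 * x34 + A $ 1 $ 5 * x35 = x12 * A $ 2 $ 3 + x13 * A $ 3 $ 3 + x14 * A $ 4 $ 3 + x15 * A $ 5 $ 3;
      A $ 1 $ 1 * x14 + A $ 1 $ 2 * x24 + A $ 1 $ 3 * x34 + A $ 1 $ 5 * x45 = x12 * A $ 2 $ 4 + x13 * A $ 3 $ 4 + x14 * A $ 4 $ 4 + x15 * A $ 5 $ 4;
      A $ 1 $ 1 * x15 + A $ 1 $ 2 * x25 + A $ 1 $ 3 * x35 + A $ 1 $ 4 * x45 = x12 * A $ 2 $ 5 + x13 * A $ 3 $ 5 + x14 * A $ 4 $ 5 + x15 * A $ 5 $ 5;
      A $ 2 $ 1 * x13 + A $ 2 $ 2 * x23 + A $ 2 $ 4 * x34 + A $ 2 $ 5 * x35 = x12 * A $ 1 $ 3 + x23 * A $ 3 $ 3 + x24 * A $ 4 $ 3 + x25 * A $ 5 $ 3;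
      A $ 2 $ 1 * x14 + A $ 2 $ 2 * x24 + A $ 2 $ 3 * x34 + A $ 2 $ 5 * x45 = x12 * A $ 1 $ 4 + x23 * A $ 3 $ 4 + x24 * A $ 4 $ 4 + x25 * A $ 5 $ 4;
      A $ 2 $ 1 * x15 + A $ 2 $ 2 * x25 + A $ 2 $ 3 * x35 + A $ 2 $ 4 * x45 = x12 * A $ 1 $ 5 + x23 * A $ 3 $ 5 + x24 * A $ 4 $ 5 + x25 * A $ 5 $ 5;
      A $ 3 $ 1 * x14 + A $ 3 $ 2 * x24 + A $ 3 $ 3 * x34 + A $ 3 $ 5 * x45 = x13 * A $ 1 $ 4 + x23 * A $ 2 $ 4 + x34 * A $ 4 $ 4 + x35 * A $ 5 $ 4;
      A $ 3 $ 1 * x15 + A $ 3 $ 2 * x25 + A $ 3 $ 3 * x35 + A $ 3 $ 4 * x45 = x13 * A $ 1 $ 5 + x23 * A $ 2 $ 5 + x34 * A $ 4 $ 5 + x35 * A $ 5 $ 5;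
      A $ 4 $ 1 * x15 + A $ 4 $ 2 * x25 + A $ 4 $ 3 * x35 + A $ 4 $ 4 * x45 = x14 * A $ 1 $ 5 + x24 * A $ 2 $ 5 + x34 * A $ 3 $ 5 + x45 * A $ 5 $ 5\<rbrakk>
      \<Longrightarrow> x12 = 0 \<and> x13 = 0 \<and> x14 = 0 \<and> x15 = 0 \<and> x23 = 0 \<and> x24 = 0 \<and> x25 = 0 \<and> x34 = 0 \<and> x35 = 0 \<and> x45 = 0"
  shows "SSP A"
  unfolding SSP_def
proof (intro conjI allI impI)
  fix X :: "real^5^5"
  assume X: "transpose X = X \<and> A * X = 0 \<and> mat 1 * X = 0 \<and> A ** X - X ** A = 0"
  have sym: "X $ i $ j = X $ j $ i" for i j using X symmetric_entry by blast
  have edge: "A $ i $ j * X $ i $ j = 0" for i j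
    using X by (metis vector_mult_component zero_index)
  have "(mat 1 :: real^5^5) $ i $ i * X $ i $ i = 0" for i
    using X by (metis vector_mult_component zero_index)
  then have diag: "X $ i $ i = 0" for i by (simp add: mat_def)
  have "A ** X = X ** A" using X by simp
  then have "(\<Sum>k\<in>UNIV. A $ i $ k * X $ k $ j) = (\<Sum>k\<in>UNIV. X $ i $ k * A $ k $ j)" for i j
    by (simp add: vec_eq_iff matrix_matrix_mult_def)
  note com5 = this[unfolded sum_5]
  note syms = sym[of 2 1] sym[of 3 1] sym[of 4 1] sym[of 5 1] sym[of 3 2] sym[of 4 2] sym[of 5 2] sym[of 4 3] sym[of 5 3] sym[of 5 4]
  have "X $ 1 $ 2 = 0 \<and> X $ 1 $ 3 = 0 \<and> X $ 1 $ 4 = 0 \<and> X $ 1 $ 5 = 0 \<and> X $ 2 $ 3 = 0 \<and> X $ 2 $ 4 = 0 \<and> X $ 2 $ 5 = 0 \<and> X $ 3 $ 4 = 0 \<and> X $ 3 $ 5 = 0 \<and> X $ 4 $ 5 = 0"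
    apply (rule assms(2))
    apply (rule edge)+
    subgoal using com5[of 1 2] by (simp add: diag syms)
    subgoal using com5[of 1 3] by (simp add: diag syms)
    subgoal using com5[of 1 4] by (simp add: diag syms)
    subgoal using com5[of 1 5] by (simp add: diag syms)
    subgoal using com5[of 2 3] by (simp add: diag syms)
    subgoal using com5[of 2 4] by (simp add: diag syms)
    subgoal using com5[of 2 5] by (simp add: diag syms)
    subgoal using com5[of 3 4] by (simp add: diag syms)
    subgoal using com5[of 3 5] by (simp add: diag syms)
    subgoal using com5[of 4 5] by (simp add: diag syms)
    done
  then show "X = 0" by (simp add: vec_eq_iff forall_5 diag syms)
qed (rule assms(1))

lemma has_spectrum_5I:
  fixes A :: "real^5^5" and c1 c2 c3 c4 c5 :: real and v1 v2 v3 v4 v5 :: "real^5"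
  assumes "transpose A = A"
    and "v1 \<noteq> 0" "v2 \<noteq> 0" "v3 \<noteq> 0" "v4 \<noteq> 0" "v5 \<noteq> 0"
    and "A *v v1 = c1 *\<^sub>R v1" "A *v v2 = c2 *\<^sub>R v2" "A *v v3 = c3 *\<^sub>R v3"
      "A *v v4 = c4 *\<^sub>R v4" "A *v v5 = c5 *\<^sub>R v5"
    and "c1 = c2 \<Longrightarrow> v1 \<bullet> v2 = 0" "c1 = c3 \<Longrightarrow> v1 \<bullet> v3 = 0" "c1 = c4 \<Longrightarrow> v1 \<bullet> v4 = 0"
      "c1 = c5 \<Longrightarrow> v1 \<bullet> v5 = 0" "c2 = c3 \<Longrightarrow> v2 \<bullet> v3 = 0" "c2 = c4 \<Longrightarrow> v2 \<bullet> v4 = 0"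
      "c2 = c5 \<Longrightarrow> v2 \<bullet> v5 = 0" "c3 = c4 \<Longrightarrow> v3 \<bullet> v4 = 0" "c3 = c5 \<Longrightarrow> v3 \<bullet> v5 = 0"
      "c4 = c5 \<Longrightarrow> v4 \<bullet> v5 = 0"
    and ls: "sorted_wrt (<) ls" "set ls = set [c1, c2, c3, c4, c5]"
  shows "has_spectrum A ls (map (count_list [c1, c2, c3, c4, c5]) ls)"
proof -
  define c :: "5 \<Rightarrow> real" where "c k = vector [c1, c2, c3, c4, c5] $ k" for k
  define v :: "5 \<Rightarrow> real^5" where "v k = vector [v1, v2, v3, v4, v5] $ k" for k
  have v: "\<forall>k. v k \<noteq> 0" "\<forall>k. A *v v k = c k *\<^sub>R v k"
    using assms(2-11) by (simp_all add: forall_5 v_def c_def)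
  have orth: "\<forall>k l. k \<noteq> l \<longrightarrow> c k = c l \<longrightarrow> v k \<bullet> v l = 0"
    using assms(12-21) by (simp add: forall_5 v_def c_def inner_commute)
  have "eigenvalues A = range c"
    by (rule spectrum_of_eigenvectors(1)[OF assms(1), of v c]) (use v orth in blast)+
  moreover have "multiplicity_of A \<mu> = card {k. c k = \<mu>}" for \<mu>
    by (rule spectrum_of_eigenvectors(2)[OF assms(1), of v c]) (use v orth in blast)+
  then have "multiplicity_of A = count_list [c1, c2, c3, c4, c5]"
    by (simp add: fun_eq_iff card_5 c_def)
  moreover have "range c = {c1, c2, c3, c4, c5}" by (simp add: UNIV_5 c_def)
  ultimately show ?thesis
    using ls by (simp add: has_spectrum_def)
qed

lemma schroedinger_5I:
  fixes A :: "real^5^5"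
  assumes "transpose A = A"
    and "if {1, 2} \<in> G then A $ 1 $ 2 < 0 else A $ 1 $ 2 = 0"
    and "if {1, 3} \<in> G then A $ 1 $ 3 < 0 else A $ 1 $ 3 = 0"
    and "if {1, 4} \<in> G then A $ 1 $ 4 < 0 else A $ 1 $ 4 = 0"
    and "if {1, 5} \<in> G then A $ 1 $ 5 < 0 else A $ 1 $ 5 = 0"
    and "if {2, 3} \<in> G then A $ 2 $ 3 < 0 else A $ 2 $ 3 = 0"
    and "if {2, 4} \<in> G then A $ 2 $ 4 < 0 else A $ 2 $ 4 = 0"
    and "if {2, 5} \<in> G then A $ 2 $ 5 < 0 else A $ 2 $ 5 = 0"
    and "if {3, 4} \<in> G then A $ 3 $ 4 < 0 else A $ 3 $ 4 = 0"
    and "if {3, 5} \<in> G then A $ 3 $ 5 < 0 else A $ 3 $ 5 = 0"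
    and "if {4, 5} \<in> G then A $ 4 $ 5 < 0 else A $ 4 $ 5 = 0"
  shows "A \<in> schroedinger G"
proof -
  have s: "A $ j $ i = A $ i $ j" for i j using assms(1) symmetric_entry by blast
  have "\<forall>i j. i \<noteq> j \<longrightarrow> (if {i, j} \<in> G then A $ i $ j < 0 else A $ i $ j = 0)"
    unfolding forall_5 using assms(2-)
    by (simp add: insert_commute[of 2 1] insert_commute[of 3 1] insert_commute[of 4 1]
       insert_commute[of 5 1] insert_commute[of 3 2] insert_commute[of 4 2] insert_commute[of 5 2]
       insert_commute[of 4 3] insert_commute[of 5 3] insert_commute[of 5 4]
       s[of 2 1] s[of 3 1] s[of 4 1] s[of 5 1] s[of 3 2] s[of 4 2] s[of 5 2] s[of 4 3] s[of 5 3] s[of 5 4])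
  with assms(1) show ?thesis by (simp add: schroedinger_def)
qed

lemmas entries_5 = vec_eq_iff forall_5 transpose_def matrix_vector_mult_def inner_vec_def sum_5

section \<open>Realizations for sparse graphs\<close>

text \<open>A matrix that commutes with a diagonal matrix with distinct entries is diagonal.\<close>

lemma diagonal_SSP:
  fixes d1 d2 d3 d4 d5 :: real
  assumes "distinct [d1, d2, d3, d4, d5]" "sorted_wrt (<) ls" "set ls = set [d1, d2, d3, d4, d5]"
  shows "\<exists>A\<in>schroedinger ({} :: graph5). SSP A \<and> has_spectrum A ls (map (count_list [d1, d2, d3, d4, d5]) ls)"
proof -
  define A :: "real^5^5" where "A = vector [vector [d1,0,0,0,0], vector [0,d2,0,0,0],
    vector [0,0,d3,0,0], vector [0,0,0,d4,0], vector [0,0,0,0,d5]]"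
  have sym: "transpose A = A" by (simp add: A_def entries_5)
  have "A \<in> schroedinger ({} :: graph5)"
    by (rule schroedinger_5I[OF sym]) (simp_all add: A_def)
  moreover have "SSP A"
    by (rule SSP_5I[OF sym]) (use assms(1) in \<open>simp add: A_def\<close>)
  moreover have "has_spectrum A ls (map (count_list [d1, d2, d3, d4, d5]) ls)"
    by (rule has_spectrum_5I[OF sym, where ?c1.0=d1 and ?c2.0=d2 and ?c3.0=d3 and ?c4.0=d4 and ?c5.0=d5
          and ?v1.0="axis 1 1" and ?v2.0="axis 2 1" and ?v3.0="axis 3 1" and ?v4.0="axis 4 1" and ?v5.0="axis 5 1"])
      (use assms in \<open>simp_all add: A_def entries_5 axis_def algebra_simps\<close>)
  ultimately show ?thesis by blast
qed

text \<open>On the triangle the block is \<open>t I - c J\<close> with \<open>J\<close> the all-ones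
  matrix: eigenvalue \<open>t - 3 * c = s\<close> on constants and \<open>t\<close> on their
  complement. The sign condition is \<open>s < t\<close>; \<open>x\<close> and \<open>y\<close> sit
  on the isolated vertices. \<open>K4_SSP\<close> and \<open>K5_SSP\<close> have the same
  form.\<close>

lemma K3_SSP:
  fixes s t x y :: real
  assumes "s < t" "distinct [s, t, x, y]" "sorted_wrt (<) ls" "set ls = set [s, t, t, x, y]"
  shows "\<exists>A\<in>schroedinger ({{1,2},{1,3},{2,3}} :: graph5). SSP A \<and> has_spectrum A ls (map (count_list [s, t, t, x, y]) ls)"
proof -
  define c where "c = (t - s) / 3"
  have c: "c > 0" "s = t - 3 * c" using assms(1) by (auto simp: c_def field_simps)
  define A :: "real^5^5" where "A = vector [vector [t - c,-c,-c,0,0], vector [-c,t-c,-c,0,0],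
    vector [-c,-c,t-c,0,0], vector [0,0,0,x,0], vector [0,0,0,0,y]]"
  have sym: "transpose A = A" by (simp add: A_def entries_5)
  have "A \<in> schroedinger ({{1,2},{1,3},{2,3}} :: graph5)"
    by (rule schroedinger_5I[OF sym]) (use c in \<open>simp_all add: A_def doubleton_eq_iff\<close>)
  moreover have "SSP A"
  proof (rule SSP_5I[OF sym], goal_cases)
    case (1 x12 x13 x14 x15 x23 x24 x25 x34 x35 x45)
    \<comment> \<open>The part of \<open>X\<close> joining the triangle to an isolated vertex with
      entry \<open>u\<close> would be an eigenvector of the triangle block to the eigenvalue
      \<open>u\<close>.\<close>
    have *: "p = 0 \<and> q = 0 \<and> r = 0" if "u \<noteq> t" "u \<noteq> s" and
       e: "(t - c) * p - c * q - c * r = p * u" "(t - c) * q - c * p - c * r = q * u"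
       "(t - c) * r - c * q - c * p = r * u" for p q r u
    proof -
      have "(t - 3 * c - u) * (p + q + r) = 0" using e by (simp add: algebra_simps)
      then have S: "p + q + r = 0" using that c(2) by simp
      have "(t - u) * p = c * (p + q + r)" "(t - u) * q = c * (p + q + r)" "(t - u) * r = c * (p + q + r)"
        using e by (simp_all add: algebra_simps)
      then show ?thesis using S \<open>u \<noteq> t\<close> by simp
    qed
    have z: "x12 = 0" "x13 = 0" "x23 = 0"
      using 1(1,2,5) c by (simp_all add: A_def)
    have "x14 = 0 \<and> x24 = 0 \<and> x34 = 0"
      by (rule *[of x]) (use 1(13,16,18) z assms(2) in \<open>simp_all add: A_def\<close>)
    moreover have "x15 = 0 \<and> x25 = 0 \<and> x35 = 0"
      by (rule *[of y]) (use 1(14,17,19) z assms(2) in \<open>simp_all add: A_def\<close>)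
    moreover have "x * x45 = x45 * y"
      using 1(20) z by (simp add: A_def)
    ultimately show ?case using z assms(2) by simp
  qed
  moreover have "has_spectrum A ls (map (count_list [s, t, t, x, y]) ls)"
    by (rule has_spectrum_5I[OF sym, where ?c1.0=s and ?c2.0=t and ?c3.0=t and ?c4.0=x and ?c5.0=y
          and ?v1.0="vector [1,1,1,0,0]" and ?v2.0="vector [1,-1,0,0,0]" and ?v3.0="vector [1,1,-2,0,0]"
          and ?v4.0="axis 4 1" and ?v5.0="axis 5 1"])
      (use assms(2-4) in \<open>simp_all add: A_def entries_5 axis_def c(2) algebra_simps\<close>)
  ultimately show ?thesis by blast
qed

lemma K4_SSP:
  fixes s t x :: real
  assumes "s < t" "distinct [s, t, x]" "sorted_wrt (<) ls" "set ls = set [s, t, t, t, x]"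
  shows "\<exists>A\<in>schroedinger ({{1,2},{1,3},{1,4},{2,3},{2,4},{3,4}} :: graph5). SSP A \<and> has_spectrum A ls (map (count_list [s, t, t, t, x]) ls)"
proof -
  define c where "c = (t - s) / 4"
  have c: "c > 0" "s = t - 4 * c" using assms(1) by (auto simp: c_def field_simps)
  define A :: "real^5^5" where "A = vector [vector [t - c,-c,-c,-c,0], vector [-c,t-c,-c,-c,0],
    vector [-c,-c,t-c,-c,0], vector [-c,-c,-c,t-c,0], vector [0,0,0,0,x]]"
  have sym: "transpose A = A" by (simp add: A_def entries_5)
  have "A \<in> schroedinger ({{1,2},{1,3},{1,4},{2,3},{2,4},{3,4}} :: graph5)"
    by (rule schroedinger_5I[OF sym]) (use c in \<open>simp_all add: A_def doubleton_eq_iff\<close>)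
  moreover have "SSP A"
  proof (rule SSP_5I[OF sym], goal_cases)
    case (1 x12 x13 x14 x15 x23 x24 x25 x34 x35 x45)
    have z: "x12 = 0" "x13 = 0" "x14 = 0" "x23 = 0" "x24 = 0" "x34 = 0"
      using 1(1-10) c by (simp_all add: A_def)
    note e = 1(14,17,19,20)
    have "(t - 4 * c - x) * (x15 + x25 + x35 + x45) = 0"
      using e z by (simp add: A_def algebra_simps)
    then have S: "x15 + x25 + x35 + x45 = 0" using assms(2) c(2) by simp
    have "(t - x) * p = c * (x15 + x25 + x35 + x45)" if "p \<in> {x15, x25, x35, x45}" for p
      using e z that by (auto simp: A_def algebra_simps)
    then have "(t - x) * p = 0" if "p \<in> {x15, x25, x35, x45}" for p
      using that S by simp
    then show ?case using z assms(2) by simp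
  qed
  moreover have "has_spectrum A ls (map (count_list [s, t, t, t, x]) ls)"
    by (rule has_spectrum_5I[OF sym, where ?c1.0=s and ?c2.0=t and ?c3.0=t and ?c4.0=t and ?c5.0=x
          and ?v1.0="vector [1,1,1,1,0]" and ?v2.0="vector [1,-1,0,0,0]" and ?v3.0="vector [1,1,-2,0,0]"
          and ?v4.0="vector [1,1,1,-3,0]" and ?v5.0="axis 5 1"])
      (use assms(2-4) in \<open>simp_all add: A_def entries_5 axis_def c(2) algebra_simps\<close>)
  ultimately show ?thesis by blast
qed

lemma K5_SSP:
  fixes s t :: real
  assumes "s < t"
  shows "\<exists>A\<in>schroedinger K5. SSP A \<and> has_spectrum A [s, t] (map (count_list [s, t, t, t, t]) [s, t])"
proof -
  define c where "c = (t - s) / 5"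
  have c: "c > 0" "s = t - 5 * c" using assms(1) by (auto simp: c_def field_simps)
  define A :: "real^5^5" where "A = vector [vector [t - c,-c,-c,-c,-c], vector [-c,t-c,-c,-c,-c],
    vector [-c,-c,t-c,-c,-c], vector [-c,-c,-c,t-c,-c], vector [-c,-c,-c,-c,t-c]]"
  have sym: "transpose A = A" by (simp add: A_def entries_5)
  have "{i, j} \<in> K5 \<longleftrightarrow> i \<noteq> j" for i j by (auto simp: K5_def doubleton_eq_iff)
  then have "A \<in> schroedinger K5"
    by (intro schroedinger_5I[OF sym]) (use c in \<open>simp_all add: A_def\<close>)
  moreover have "SSP A"
    by (rule SSP_5I[OF sym]) (use c in \<open>simp add: A_def\<close>)
  moreover have "has_spectrum A [s, t] (map (count_list [s, t, t, t, t]) [s, t])"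
    by (rule has_spectrum_5I[OF sym, where ?c1.0=s and ?c2.0=t and ?c3.0=t and ?c4.0=t and ?c5.0=t
          and ?v1.0="vector [1,1,1,1,1]" and ?v2.0="vector [1,-1,0,0,0]" and ?v3.0="vector [1,1,-2,0,0]"
          and ?v4.0="vector [1,1,1,-3,0]" and ?v5.0="vector [1,1,1,1,-4]"])
      (use assms c in \<open>auto simp: A_def entries_5 axis_def algebra_simps\<close>)
  ultimately show ?thesis by blast
qed

text \<open>A star whose leaves all have diagonal entry \<open>t\<close>: vectors on the leaves with
  sum zero give \<open>t\<close> twice. On the vectors constant on the leaves the trace is
  \<open>a + b\<close>, and determinant \<open>a * b\<close> means
  \<open>3 * \<beta> * \<beta> = (t - a) * (b - t)\<close>.\<close>

lemma K13_SSP: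
  fixes a t b y :: real
  assumes "a < t" "t < b" "distinct [a, t, b, y]" "sorted_wrt (<) ls" "set ls = set [a, b, t, t, y]"
  shows "\<exists>A\<in>schroedinger ({{1,2},{1,3},{1,4}} :: graph5). SSP A \<and> has_spectrum A ls (map (count_list [a, b, t, t, y]) ls)"
proof -
  define \<beta> where "\<beta> = sqrt ((t - a) * (b - t) / 3)"
  have \<beta>: "\<beta> > 0" "\<beta> * \<beta> = (t - a) * (b - t) / 3" using assms(1,2) by (auto simp: \<beta>_def)
  define A :: "real^5^5" where "A = vector [vector [a + b - t,-\<beta>,-\<beta>,-\<beta>,0], vector [-\<beta>,t,0,0,0],
    vector [-\<beta>,0,t,0,0], vector [-\<beta>,0,0,t,0], vector [0,0,0,0,y]]"
  have sym: "transpose A = A" by (simp add: A_def entries_5)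
  have "A \<in> schroedinger ({{1,2},{1,3},{1,4}} :: graph5)"
    by (rule schroedinger_5I[OF sym]) (use \<beta> in \<open>simp_all add: A_def doubleton_eq_iff\<close>)
  moreover have "SSP A"
  proof (rule SSP_5I[OF sym], goal_cases)
    case (1 x12 x13 x14 x15 x23 x24 x25 x34 x35 x45)
    have z: "x12 = 0" "x13 = 0" "x14 = 0"
      using 1(1-10) \<beta> by (simp_all add: A_def)
    have r: "x23 + x24 = 0" "x23 + x34 = 0" "x24 + x34 = 0"
      using 1(11-13) z \<beta>(1) by (simp_all add: A_def flip: distrib_left)
    have e: "(t - y) * x25 = \<beta> * x15" "(t - y) * x35 = \<beta> * x15" "(t - y) * x45 = \<beta> * x15"
      "(a + b - t - y) * x15 = \<beta> * (x25 + x35 + x45)"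
      using 1(14,17,19,20) z by (simp_all add: A_def algebra_simps)
    have "(t - y) * ((a + b - t - y) * x15) = 3 * (\<beta> * \<beta>) * x15"
      using e by (simp add: algebra_simps)
    then have "(y - a) * (y - b) * x15 = 0" unfolding \<beta>(2) by (simp add: algebra_simps)
    then have "x15 = 0" using assms(3) by auto
    then show ?case using z r e assms(3) by auto
  qed
  moreover have "has_spectrum A ls (map (count_list [a, b, t, t, y]) ls)"
    by (rule has_spectrum_5I[OF sym, where ?c1.0=a and ?c2.0=b and ?c3.0=t and ?c4.0=t and ?c5.0=y
          and ?v1.0="vector [t - a,\<beta>,\<beta>,\<beta>,0]" and ?v2.0="vector [t-b,\<beta>,\<beta>,\<beta>,0]" and ?v3.0="vector [0,1,-1,0,0]"
          and ?v4.0="vector [0,1,1,-2,0]" and ?v5.0="axis 5 1"])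
      (use assms \<beta> in \<open>simp_all add: A_def entries_5 axis_def algebra_simps\<close>)
  ultimately show ?thesis by blast
qed

text \<open>A star with four equal leaves would have eigenvalues \<open>a, b, b, b, c\<close>. The
  edge 23 is added so that the row sums over the leaves stay equal to \<open>b\<close>; this moves
  only the eigenvector \<open>(0,1,-1,0,0)\<close>, from \<open>b\<close> to
  \<open>b + 2 * f\<close>, and \<open>f\<close> is chosen to make that \<open>c\<close>.\<close>

lemma Camp_SSP:
  fixes a b c :: real
  assumes "a < b" "b < c"
  shows "\<exists>A\<in>schroedinger Camp. SSP A \<and> has_spectrum A [a, b, c] (map (count_list [a, b, b, c, c]) [a, b, c])"
proof -
  define \<beta> where "\<beta> = sqrt ((b - a) * (c - b) / 4)"
  have \<beta>: "\<beta> > 0" "\<beta> * \<beta> = (b - a) * (c - b) / 4" using assms(1,2) by (auto simp: \<beta>_def)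
  define f where "f = (c - b) / 2"
  have f: "f > 0" "c = b + 2 * f" using assms by (auto simp: f_def field_simps)
  define A :: "real^5^5" where "A = vector [vector [a + c - b,-\<beta>,-\<beta>,-\<beta>,-\<beta>], vector [-\<beta>,b+f,-f,0,0],
    vector [-\<beta>,-f,b+f,0,0], vector [-\<beta>,0,0,b,0], vector [-\<beta>,0,0,0,b]]"
  have sym: "transpose A = A" by (simp add: A_def entries_5)
  have "A \<in> schroedinger Camp"
    by (rule schroedinger_5I[OF sym]) (use \<beta> f in \<open>simp_all add: A_def Camp_def doubleton_eq_iff\<close>)
  moreover have "SSP A"
  proof (rule SSP_5I[OF sym], goal_cases)
    case (1 x12 x13 x14 x15 x23 x24 x25 x34 x35 x45)
    have z: "x12 = 0" "x13 = 0" "x14 = 0" "x15 = 0" "x23 = 0"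
      using 1(1-10) \<beta> f by (simp_all add: A_def)
    have "\<beta> * (x24 + x25) = 0" "\<beta> * (x34 + x35) = 0" "\<beta> * (x24 + x34 + x45) = 0"
      "\<beta> * (x25 + x35 + x45) = 0"
      using 1(11-14) z by (simp_all add: A_def algebra_simps)
    then have r: "x24 + x25 = 0" "x34 + x35 = 0" "x24 + x34 + x45 = 0" "x25 + x35 + x45 = 0"
      using \<beta>(1) by simp_all
    have "f * x24 = f * x34" "f * x25 = f * x35"
      using 1(16,17) z by (simp_all add: A_def algebra_simps)
    then show ?case using z r f by simp
  qed
  moreover have "has_spectrum A [a, b, c] (map (count_list [a, b, b, c, c]) [a, b, c])"
    by (rule has_spectrum_5I[OF sym, where ?c1.0=a and ?c2.0=b and ?c3.0=b and ?c4.0=c and ?c5.0=c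
          and ?v1.0="vector [b - a,\<beta>,\<beta>,\<beta>,\<beta>]" and ?v2.0="vector [0,0,0,1,-1]" and ?v3.0="vector [0,1,1,-1,-1]"
          and ?v4.0="vector [b-c,\<beta>,\<beta>,\<beta>,\<beta>]" and ?v5.0="vector [0,1,-1,0,0]"])
      (use assms \<beta> f in \<open>auto simp: A_def entries_5 axis_def algebra_simps\<close>)
  ultimately show ?thesis by blast
qed

text \<open>
  An eigenvalue \<open>b\<close> of multiplicity 3 makes \<open>A - b\<close> a Gram matrix in the Lorentzian plane.  The three pairwise
  nonadjacent vertices 3, 4, 5 are represented by one null vector, and the vertices 1, 2 by orthogonal
  vectors.
\<close>

lemma K23_SSP:
  fixes a b c :: real
  assumes "a < b" "b < c"
  shows "\<exists>A\<in>schroedinger K23. SSP A \<and> has_spectrum A [a, b, c] (map (count_list [a, c, b, b, b]) [a, b, c])"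
proof -
  define p where "p = b - a"
  define q where "q = c - b"
  have pq: "p > 0" "q > 0" "a = b - p" "c = b + q" using assms by (auto simp: p_def q_def)
  define D where "D = p * p + p * q + q * q"
  have D: "D > 0" using pq by (simp add: D_def add_pos_pos)
  \<comment> \<open>The 2 by 2 principal minors of \<open>A - b\<close> must add up to
    \<open>- p * q\<close>, the product of its two nonzero eigenvalues. With the \<open>d1\<close>
    and \<open>d2\<close> below this determines \<open>w\<close>.\<close>
  define w where "w = sqrt (p * q * D / (3 * (p * p + q * q))) / (p + q)"
  have n: "p * p + q * q > 0" "p + q > 0" using pq by (auto simp: add_pos_pos)
  have w: "w > 0" using pq D n by (simp add: w_def)
  have "w * w * (p + q) * (p + q) = p * q * D / (3 * (p * p + q * q))"
    using pq D n by (simp add: w_def)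
  then have ww: "3 * w * w * (p * p + q * q) * (p + q) * (p + q) = p * q * D"
    using n by (simp add: field_simps)
  \<comment> \<open>The common vector of 3, 4, 5 is null exactly if
    \<open>q * q / d1 = p * p / d2\<close>, and the trace of \<open>A - b\<close> requires
    \<open>d1 - d2 = q - p\<close>.\<close>
  define d1 where "d1 = q * q / (p + q)"
  define d2 where "d2 = p * p / (p + q)"
  have d: "d1 > 0" "d2 > 0" "d1 * (p + q) = q * q" "d2 * (p + q) = p * p"
    using pq n by (auto simp: d1_def d2_def)
  define A :: "real^5^5" where "A = vector [vector [b + d1,0,-q*w,-q*w,-q*w], vector [0,b - d2,-p*w,-p*w,-p*w],
    vector [-q*w,-p*w,b,0,0], vector [-q*w,-p*w,0,b,0], vector [-q*w,-p*w,0,0,b]]"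
  have sym: "transpose A = A" by (simp add: A_def entries_5)
  have "{i, j} \<in> K23 \<longleftrightarrow> i \<in> {1,2} \<and> j \<in> {3,4,5} \<or> j \<in> {1,2} \<and> i \<in> {3,4,5}" for i j
    unfolding K23_def by (auto simp: doubleton_eq_iff)
  then have "A \<in> schroedinger K23"
    by (intro schroedinger_5I[OF sym]) (use w pq in \<open>simp_all add: A_def\<close>)
  moreover have "SSP A"
  proof (rule SSP_5I[OF sym], goal_cases)
    case (1 x12 x13 x14 x15 x23 x24 x25 x34 x35 x45)
    have z: "x13 = 0" "x14 = 0" "x15 = 0" "x23 = 0" "x24 = 0" "x25 = 0"
      using 1(1-10) w pq by (simp_all add: A_def)
    have "(d1 + d2) * x12 = 0" using 1(11) z by (simp add: A_def algebra_simps)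
    then have x12: "x12 = 0" using d by simp
    have "q * w * (x34 + x35) = 0" using 1(12) z x12 by (simp add: A_def algebra_simps)
    moreover have "q * w * (x34 + x45) = 0" using 1(13) z x12 by (simp add: A_def algebra_simps)
    moreover have "q * w * (x35 + x45) = 0" using 1(14) z x12 by (simp add: A_def algebra_simps)
    ultimately show ?case using z x12 w pq by simp
  qed
  moreover have "has_spectrum A [a, b, c] (map (count_list [a, c, b, b, b]) [a, b, c])"
  proof -
    \<comment> \<open>Scales the eigenvectors so that the denominators \<open>p + q\<close> of
      \<open>d1\<close> and \<open>d2\<close> disappear.\<close>
    define k where "k = 3 * w * (p + q)"
    have "k \<noteq> 0" using w n(2) by (simp add: k_def)
    moreover have "w * k * (p * p + q * q) * (p + q) = p * q * D" using ww by (simp add: k_def algebra_simps)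
    ultimately have k: "k \<noteq> 0" "w * k * (p * p + q * q) * (p + q) = p * q * D" by auto
    have "k * d1 = 3 * w * (d1 * (p + q))" "k * d2 = 3 * w * (d2 * (p + q))" by (simp_all add: k_def)
    then have k2: "k * d1 = 3 * w * q * q" "k * d2 = 3 * w * p * p" unfolding d(3,4) by simp_all
    have cube: "(p * p + q * q) * (p + q) = q * q * q + p * D" "(p * p + q * q) * (p + q) = q * D + p * p * p"
      by (simp_all add: D_def algebra_simps)
    have e1: "w * k * (q * q * q + p * D) = p * q * D" "w * k * (q * D + p * p * p) = p * q * D"
      unfolding cube[symmetric] using k(2) by (simp_all only: mult.assoc)
    have kd: "k * (d1 + p) = 3 * w * D" "k * (p - d2) = 3 * w * (p * q)"
      "k * (q - d1) = 3 * w * (p * q)" "k * (d2 + q) = 3 * w * D"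
      using k2 by (simp_all add: k_def D_def algebra_simps)
    have E: "k * (d1 + p) * (q * q) = 3 * w * D * (q * q)" "k * (p - d2) * D = 3 * w * (p * q) * D"
      "k * (q - d1) * D = 3 * w * (p * q) * D" "k * (d2 + q) * (p * p) = 3 * w * D * (p * p)"
      "k * d1 * p = 3 * w * q * q * p" "k * d2 * q = 3 * w * p * p * q"
      by (simp_all only: kd k2)
    show ?thesis
      by (rule has_spectrum_5I[OF sym, where ?c1.0=a and ?c2.0=c and ?c3.0=b and ?c4.0=b and ?c5.0=b
          and ?v1.0="vector [k * q * q,k * D,D * q,D*q,D*q]" and ?v2.0="vector [k * D,k*p*p,-p*D,-p*D,-p*D]"
          and ?v3.0="vector [0,0,1,-1,0]"
          and ?v4.0="vector [0,0,1,1,-2]" and ?v5.0="vector [k*p, -k*q,p*q,p*q,p*q]"])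
        (use E e1 pq(1,2) D in \<open>simp_all add: A_def entries_5 pq(3,4) insert_commute algebra_simps\<close>)
  qed
  ultimately show ?thesis by blast
qed

text \<open>The quintic vanishes at \<open>l1\<close> and \<open>l4\<close> and is positive just
  right of \<open>l1\<close> and just left of \<open>l4\<close>. By the intermediate value theorem a
  small positive level is attained in both places, and \<open>t2\<close> can be kept above any
  \<open>c < l4\<close>.\<close>

lemma double_root_quintic_points:
  fixes l1 l2 l3 l4 l5 c :: real
  assumes l: "l1 < l2" "l2 \<le> l3" "l3 < l4" "l4 \<le> l5" and c: "c < l4"
  defines "p \<equiv> \<lambda>t. (t - l1) * (t - l2) * (t - l3) * (t - l4) * (t - l5)"
  obtains t1 t2 where "l1 < t1" "t1 \<le> (l1 + l2) / 2" "l3 < t2" "c < t2" "t2 < l4" "p t1 = p t2"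
proof -
  define m where "m = (l1 + l2) / 2"
  define d where "d = (max c l3 + l4) / 2"
  have m: "l1 < m" "m < l2" and d: "l3 < d" "c < d" "d < l4" using l c by (auto simp: m_def d_def)
  have pm: "p m > 0" unfolding p_def using m l
    by (auto intro!: mult_neg_neg mult_pos_neg mult_neg_pos simp: mult_less_0_iff zero_less_mult_iff)
  have pd: "p d > 0" unfolding p_def using d l
    by (auto simp: mult_less_0_iff zero_less_mult_iff)
  have cont: "continuous_on S p" for S unfolding p_def by (intro continuous_intros)
  define e where "e = min (p m) (p d)"
  have e: "0 < e" "e \<le> p m" "e \<le> p d" using pm pd by (auto simp: e_def)
  obtain t1 where t1: "l1 \<le> t1" "t1 \<le> m" "p t1 = e"
    using IVT'[of p l1 e m] e m cont by (auto simp: p_def)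
  obtain t2 where t2: "d \<le> t2" "t2 \<le> l4" "p t2 = e"
    using IVT2'[of p l4 e d] e d cont by (auto simp: p_def)
  have "t1 \<noteq> l1" "t2 \<noteq> l4" using t1 t2 e by (auto simp: p_def)
  then show ?thesis using t1 t2 d m by (intro that[of t1 t2]) (auto simp: m_def)
qed

text \<open>
  The matrix is invariant under the reflection of the cycle that fixes the vertex 1.  Its antisymmetric part
  has order 2 and eigenvalues \<open>l2\<close>, \<open>l4\<close>, its symmetric part has order 3 and eigenvalues \<open>l1\<close>, \<open>l3\<close>, \<open>l5\<close>, and
  \<open>t1\<close>, \<open>t2\<close> are the eigenvalues of the symmetric part after deleting the vertex 1.  Prescribing all of these is
  consistent exactly if the characteristic polynomial takes the same value at \<open>t1\<close> and \<open>t2\<close>.  Taking \<open>t2\<close>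
  close to \<open>l4\<close> makes \<open>2 * a2 \<ge> l2 + l4\<close>, which yields the SSP.
\<close>

lemma C5_SSP:
  fixes l1 l2 l3 l4 l5 :: real
  assumes l: "l1 < l2" "l2 \<le> l3" "l3 < l4" "l4 \<le> l5"
    and ls: "sorted_wrt (<) ls" "set ls = set [l1, l2, l3, l4, l5]"
  shows "\<exists>A\<in>schroedinger C5. SSP A \<and> has_spectrum A ls (map (count_list [l1, l2, l3, l4, l5]) ls)"
proof -
  define h where "h = (l1 + l2) / 2"
  \<comment> \<open>The value of \<open>t2\<close> at which \<open>2 * a2 = l2 + l4\<close> when
    \<open>t1 = h\<close>. Above it the inequality needed for the SSP holds, and since
    \<open>2 * c > l2 + l4\<close> it also holds for every smaller \<open>t1\<close>.\<close>
  define c where "c = (l2 * l2 + l4 * l4 - (l2 + l4) * h) / (l2 + l4 - 2 * h)"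
  have h: "l1 < h" "h < l2" using l by (auto simp: h_def)
  have hp: "l2 + l4 - 2 * h > 0" using h l by simp
  have "(l4 - l2) * (l2 - h) > 0" using h l by simp
  then have "c < l4" unfolding c_def using hp by (simp add: pos_divide_less_eq algebra_simps)
  have "(l4 - l2) * (l4 - l2) > 0" using l by simp
  then have cm: "2 * c > l2 + l4" unfolding c_def using hp by (simp add: field_simps)
  obtain t1 t2 where t: "l1 < t1" "t1 \<le> h" "l3 < t2" "c < t2" "t2 < l4"
    and eq: "(t1 - l1) * (t1 - l2) * (t1 - l3) * (t1 - l4) * (t1 - l5) =
      (t2 - l1) * (t2 - l2) * (t2 - l3) * (t2 - l4) * (t2 - l5)"
    using double_root_quintic_points[OF l \<open>c < l4\<close>] unfolding h_def by blast
  have ch: "c * (l2 + l4 - 2 * h) = l2 * l2 + l4 * l4 - (l2 + l4) * h"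
    unfolding c_def using hp by simp
  have "(t2 - c) * (l2 + l4 - 2 * h) \<ge> 0" using t hp by simp
  moreover have "(h - t1) * (2 * t2 - (l2 + l4)) \<ge> 0" using t cm by (intro mult_nonneg_nonneg) auto
  ultimately have g: "t1 * (l2 + l4 - 2 * t2) + (l2 + l4) * t2 \<ge> l2 * l2 + l4 * l4"
    using ch by (simp add: algebra_simps)
  \<comment> \<open>The antisymmetric block has rows \<open>a2, -x\<close> and
    \<open>-x, a3 + y\<close>; the symmetric part without vertex 1 has \<open>a3 - y\<close>
    instead. Their traces differ by \<open>2 * y = s\<close> and their determinants by
    \<open>s * a2\<close>.\<close>
  define s where "s = l2 + l4 - t1 - t2"
  have s: "s > 0" using t l h by (simp add: s_def)
  define a2 where "a2 = (l2 * l4 - t1 * t2) / s"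
  have sa: "s * a2 = l2 * l4 - t1 * t2" using s by (simp add: a2_def)
  define y where "y = s / 2"
  define a3 where "a3 = l2 + l4 - a2 - y"
  have u1: "s * (a2 - t1) = (l2 - t1) * (l4 - t1)" using sa by (simp add: s_def algebra_simps)
  have u2: "s * (t2 - a2) = (t2 - l2) * (l4 - t2)" using sa by (simp add: s_def algebra_simps)
  have a2: "a2 - t1 > 0" "t2 - a2 > 0"
  proof -
    have "s * (a2 - t1) > 0" unfolding u1 using t h l by simp
    then show "a2 - t1 > 0" using s by (simp add: zero_less_mult_iff)
    have "s * (t2 - a2) > 0" unfolding u2 using t h l by simp
    then show "t2 - a2 > 0" using s by (simp add: zero_less_mult_iff)
  qed
  define x where "x = sqrt ((a2 - t1) * (t2 - a2))"
  have x: "x > 0" "x * x = (a2 - t1) * (t2 - a2)" using a2 by (auto simp: x_def)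
  \<comment> \<open>Evaluating the required characteristic polynomial of the symmetric part at
    \<open>t1\<close> gives \<open>2 * (w * w) * (t2 - a2) = P\<close>. Evaluation at
    \<open>t2\<close> gives a second formula for \<open>w\<close>, compatible with the first by
    \<open>eq\<close>.\<close>
  define P where "P = (t1 - l1) * (l3 - t1) * (l5 - t1)"
  have P: "P > 0" using t h l by (simp add: P_def)
  define w where "w = sqrt (P / (2 * (t2 - a2)))"
  have "w > 0" "w * w = P / (2 * (t2 - a2))" using a2 P by (auto simp: w_def)
  then have w: "w > 0" "2 * (w * w) * (t2 - a2) = P" using a2 by (auto simp: field_simps)
  define a1 where "a1 = l1 + l3 + l5 - t1 - t2"
  have "2 * (w * w) * (a2 - t1) = (t2 - l1) * (t2 - l3) * (l5 - t2)"
  proof -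
    have "(2 * (w * w) * (a2 - t1)) * (s * (t2 - a2)) = (2 * (w * w) * (t2 - a2)) * (s * (a2 - t1))" by simp
    also have "\<dots> = P * ((l2 - t1) * (l4 - t1))" by (simp add: w u1)
    also have "\<dots> = ((t2 - l1) * (t2 - l3) * (l5 - t2)) * (s * (t2 - a2))"
      unfolding u2 P_def using eq by (simp add: algebra_simps)
    finally show ?thesis using s a2 by simp
  qed
  note w2 = this
  have ge: "2 * a2 \<ge> l2 + l4"
  proof -
    have "s * (2 * a2 - (l2 + l4)) \<ge> 0"
      using sa g by (simp add: s_def algebra_simps)
    then show ?thesis using s by (simp add: zero_le_mult_iff)
  qed
  have quad: "(a2 - \<mu>) * (a3 + y - \<mu>) - x * x = (\<mu> - l2) * (\<mu> - l4)" for \<mu>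
    using sa unfolding x(2) by (simp add: a3_def s_def algebra_simps)
  have quad': "(a2 - \<mu>) * (a3 - y - \<mu>) - x * x = (\<mu> - t1) * (\<mu> - t2)" for \<mu>
  proof -
    have a3: "a3 - y - \<mu> = t1 + t2 - a2 - \<mu>" by (simp add: a3_def y_def s_def)
    show ?thesis unfolding x(2) a3 by (simp add: algebra_simps)
  qed
  have cubic: "(a1 - \<mu>) * ((\<mu> - t1) * (\<mu> - t2)) - 2 * (w * w) * (a3 - y - \<mu>) =
      (l1 - \<mu>) * (l3 - \<mu>) * (l5 - \<mu>)" for \<mu>
  proof -
    have a3: "a3 - y - \<mu> = t1 + t2 - a2 - \<mu>" by (simp add: a3_def y_def s_def)
    \<comment> \<open>By the choice of \<open>a1\<close> the difference of the two cubics has degree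
      at most one in \<open>\<mu>\<close>, so it is interpolated from its values at
      \<open>t1\<close> and \<open>t2\<close>.\<close>
    have "(t2 - t1) * ((a1 - \<mu>) * ((\<mu> - t1) * (\<mu> - t2)) - 2 * W * (t1 + t2 - a2 - \<mu>) -
        (l1 - \<mu>) * (l3 - \<mu>) * (l5 - \<mu>)) =
      (t2 - \<mu>) * (P - 2 * W * (t2 - a2)) +
      (\<mu> - t1) * (2 * W * (a2 - t1) - (t2 - l1) * (t2 - l3) * (l5 - t2))" for W
      by (simp add: a1_def P_def algebra_simps)
    from this[of "w * w"] show ?thesis using w w2 t l h unfolding a3 by simp
  qed
  define A :: "real^5^5" where "A = vector [vector [a1,-w,0,0,-w], vector [-w,a2,-x,0,0],
    vector [0,-x,a3,-y,0], vector [0,0,-y,a3,-x], vector [-w,0,0,-x,a2]]"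
  have sym: "transpose A = A" by (simp add: A_def entries_5)
  have y: "y > 0" using s by (simp add: y_def)
  have "A \<in> schroedinger C5"
    by (rule schroedinger_5I[OF sym]) (use w x y in \<open>simp_all add: A_def C5_def doubleton_eq_iff\<close>)
  moreover have "SSP A"
  proof (rule SSP_5I[OF sym], goal_cases)
    case (1 x12 x13 x14 x15 x23 x24 x25 x34 x35 x45)
    have z: "x12 = 0" "x15 = 0" "x23 = 0" "x34 = 0" "x45 = 0"
      using 1(1-10) w x y by (simp_all add: A_def)
    have e: "w * x25 = x * x13" "w * x13 = y * x24" "x24 = x35" "y * x35 = w * x14"
      using 1(11,15,18,20) z w x y by (simp_all add: A_def algebra_simps)
    have e24: "a2 * x24 - w * x14 = x24 * a3 - x * x25"
      using 1(16) z by (simp add: A_def algebra_simps)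
    have "w * w * x25 = x * y * x24" using e by (metis mult.assoc mult.left_commute)
    have "w * w * ((a2 - a3 - y) * x24) + x * (w * w * x25) = 0"
    proof -
      have "w * x14 = y * x24" using e(3,4) by simp
      with e24 have "a2 * x24 - y * x24 = x24 * a3 - x * x25" by simp
      then have "w * w * (a2 * x24 - y * x24) = w * w * (x24 * a3 - x * x25)" by simp
      then show ?thesis by (simp add: algebra_simps)
    qed
    then have "(w * w * (a2 - a3 - y) + x * x * y) * x24 = 0"
      unfolding \<open>w * w * x25 = x * y * x24\<close> by (simp add: algebra_simps)
    \<comment> \<open>By the definition of \<open>a3\<close>, the factor \<open>a2 - a3 - y\<close>
      equals \<open>2 * a2 - (l2 + l4)\<close>, which \<open>ge\<close> makes nonnegative.\<close>
    moreover have "w * w * (a2 - a3 - y) + x * x * y > 0"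
    proof (rule add_nonneg_pos)
      show "0 \<le> w * w * (a2 - a3 - y)" using ge w(1) by (simp add: a3_def)
      show "0 < x * x * y" using x(1) y by (simp del: x(2))
    qed
    ultimately have "x24 = 0" by simp
    then show ?case using z e w x y by simp
  qed
  moreover have "has_spectrum A ls (map (count_list [l1, l2, l3, l4, l5]) ls)"
  proof -
    define V where "V \<nu> = (vector [(\<nu> - t1) * (\<nu> - t2), w * (a3 - y - \<nu>), w * x, w * x, w * (a3 - y - \<nu>)] :: real^5)"
      for \<nu>
    define W where "W \<mu> = (vector [0, x, a2 - \<mu>, \<mu> - a2, - x] :: real^5)" for \<mu>
    have V: "A *v V \<nu> = \<nu> *\<^sub>R V \<nu>" if "\<nu> \<in> {l1, l3, l5}" for \<nu>
    proof -
      have "(a1 - \<nu>) * ((\<nu> - t1) * (\<nu> - t2)) - 2 * (w * w) * (a3 - y - \<nu>) = 0"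
        unfolding cubic using that by auto
      moreover have "w * ((a2 - \<nu>) * (a3 - y - \<nu>) - x * x) = w * ((\<nu> - t1) * (\<nu> - t2))"
        by (simp only: quad')
      ultimately show ?thesis by (simp add: A_def V_def entries_5 algebra_simps)
    qed
    have W: "A *v W \<mu> = \<mu> *\<^sub>R W \<mu>" if "\<mu> \<in> {l2, l4}" for \<mu>
    proof -
      have "(a2 - \<mu>) * (a3 + y - \<mu>) - x * x = 0"
        unfolding quad using that by auto
      then show ?thesis by (simp add: A_def W_def entries_5 algebra_simps)
    qed
    have "V \<nu> \<noteq> 0" "W \<mu> \<noteq> 0" "V \<nu> \<bullet> W \<mu> = 0" "W \<mu> \<bullet> V \<nu> = 0" for \<mu> \<nu>
      using w x by (simp_all add: V_def W_def entries_5 algebra_simps)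
    then show ?thesis
      by (intro has_spectrum_5I[OF sym, where ?v1.0="V l1" and ?v2.0="W l2" and ?v3.0="V l3"
            and ?v4.0="W l4" and ?v5.0="V l5"]) (use V W ls l in auto)
  qed
  ultimately show ?thesis by blast
qed

section \<open>Bounds on multiplicities\<close>

lemma subspace_eigenspace: "subspace {v. A *v v = c *\<^sub>R v}" for A :: "real^'n^'n"
  by (auto simp: subspace_def matrix_vector_right_distrib matrix_vector_mult_scaleR algebra_simps)

text \<open>Restriction to the coordinates in \<open>S\<close> is injective on
  \<open>E\<close>.\<close>

lemma dim_le_card_determining:
  fixes E :: "(real^'n) set"
  assumes "subspace E" "\<And>v. v \<in> E \<Longrightarrow> (\<And>a. a \<in> S \<Longrightarrow> v $ a = 0) \<Longrightarrow> v = 0"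
  shows "dim E \<le> card S"
proof -
  define f where "f v = (\<chi> i. if i \<in> S then v $ i else 0)" for v :: "real^'n"
  have lin: "linear f" by (auto intro!: linearI simp: f_def vec_eq_iff)
  have "inj_on f E"
  proof (rule inj_onI)
    fix v w assume "v \<in> E" "w \<in> E" "f v = f w"
    moreover from this have "(v - w) $ a = 0" if "a \<in> S" for a
    proof -
      have "f v $ a = f w $ a" using \<open>f v = f w\<close> by simp
      then show ?thesis using that by (simp add: f_def)
    qed
    ultimately show "v = w"
      using assms(2)[of "v - w"] subspace_diff[OF assms(1)] by simp
  qed
  then have "dim E = dim (f ` E)"
    using dim_image_eq[OF lin, of E] span_eq_iff[THEN iffD2, OF assms(1)] by simp
  also have "\<dots> \<le> card ((\<lambda>a. axis a 1 :: real^'n) ` S)"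
  proof (rule dim_le_card)
    have "f v = (\<Sum>a\<in>S. v $ a *\<^sub>R axis a 1)" for v
      by (simp add: f_def vec_eq_iff axis_def if_distrib cong: if_cong)
    then show "f ` E \<subseteq> span ((\<lambda>a. axis a 1) ` S)"
      by (auto intro!: span_sum span_scale intro: span_base)
  qed simp
  also have "\<dots> \<le> card S" by (rule card_image_le) simp
  finally show ?thesis .
qed

lemma multiplicity_le_card_determining:
  assumes "\<And>v. A *v v = c *\<^sub>R v \<Longrightarrow> (\<And>a. a \<in> S \<Longrightarrow> v $ a = 0) \<Longrightarrow> v = 0"
  shows "multiplicity_of A c \<le> card S"
  unfolding multiplicity_of_def using assms
  by (intro dim_le_card_determining subspace_eigenspace) auto

lemma eigenvector_vanishing_at:
  assumes "multiplicity_of A c \<ge> 2"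
  shows "\<exists>v. v \<noteq> 0 \<and> A *v v = c *\<^sub>R v \<and> v $ a = 0"
  using assms multiplicity_le_card_determining[of A c "{a}"] by force

text \<open>Connectedness as the absence of a nonempty proper vertex set closed under adjacency, the
  form in which zeros of an eigenvector spread.\<close>

definition connected_edges :: "'n::finite set set \<Rightarrow> bool" where
  "connected_edges G \<longleftrightarrow> (\<forall>S. S \<noteq> {} \<longrightarrow> (\<forall>i\<in>S. \<forall>j. {i, j} \<in> G \<longrightarrow> j \<in> S) \<longrightarrow> S = UNIV)"

text \<open>Since off-diagonal entries are nonpositive, passing to absolute values does not increase
  the form, so \<open>z\<close> is again an eigenvector for the minimum. At a zero of
  \<open>z\<close> the eigenvector equation is a vanishing sum of nonnegative terms, so zeros spread
  to all neighbours. Hence eigenvectors for \<open>l\<close> have no zero entry.\<close>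

lemma smallest_eigenvalue_simple:
  fixes A :: "real^'n^'n"
  assumes A: "A \<in> schroedinger G" and G: "connected_edges G" and spec: "has_spectrum A ls ms"
  shows "\<exists>ms'. ms = 1 # ms'"
proof -
  have sym: "transpose A = A" using A by (rule schroedinger_symmetric)
  have "ls \<noteq> []" using has_spectrum_sum_list(1)[OF sym spec] spec by (auto simp: has_spectrum_def)
  then obtain l ls' where ls: "ls = l # ls'" by (cases ls) auto
  have min: "l \<le> c" if "c \<in> eigenvalues A" for c
  proof -
    have "c \<in> set ls" using that spec by (simp add: has_spectrum_def)
    then show ?thesis using spec by (auto simp: has_spectrum_def ls)
  qed
  have nonpos: "A $ i $ j \<le> 0" if "i \<noteq> j" for i j
    using A that by (force simp: schroedinger_def split: if_splits)
  have "(UNIV :: (real^'n) set) \<noteq> {0}" by (metis UNIV_I singletonD zero_neq_one)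
  then obtain x m where x: "norm x = 1" "A *v x = m *\<^sub>R x"
    and m: "\<And>z. m * (z \<bullet> z) \<le> z \<bullet> (A *v z)"
    using minimal_eigenvector[OF sym subspace_UNIV] by auto
  have "x \<noteq> 0" using x(1) by auto
  then have "l \<le> m" using min x(2) by (auto simp: eigenvalues_def)
  then have psd: "l * (z \<bullet> z) \<le> z \<bullet> (A *v z)" for z
    using m[of z] by (meson inner_ge_zero mult_right_mono order_trans)
  have nz: "v $ i \<noteq> 0" if v: "A *v v = l *\<^sub>R v" "v \<noteq> 0" for v i
  proof
    assume "v $ i = 0"
    define z where "z = (\<chi> k. \<bar>v $ k\<bar>)"
    have form: "y \<bullet> (A *v y) = (\<Sum>i\<in>UNIV. \<Sum>j\<in>UNIV. A $ i $ j * (y $ i * y $ j))" for y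
      by (simp add: inner_vec_def matrix_vector_mult_def sum_distrib_left algebra_simps)
    have "A $ i $ j * (z $ i * z $ j) \<le> A $ i $ j * (v $ i * v $ j)" for i j
    proof (cases "i = j")
      case False
      then show ?thesis
        by (intro mult_left_mono_neg nonpos) (simp_all add: z_def flip: abs_mult)
    qed (simp add: z_def)
    then have "z \<bullet> (A *v z) \<le> v \<bullet> (A *v v)"
      unfolding form by (intro sum_mono)
    also have "\<dots> = l * (z \<bullet> z)"
      by (simp add: v z_def inner_vec_def sum_distrib_left mult.left_commute)
    finally have "z \<bullet> (A *v z) = l * (z \<bullet> z)" using psd[of z] by simp
    then have Az: "A *v z = l *\<^sub>R z"
      by (intro psd_form_null_vector[OF sym subspace_UNIV _ psd]) auto
    have "{k. v $ k = 0} = UNIV"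
    proof (rule G[unfolded connected_edges_def, rule_format])
      show "{k. v $ k = 0} \<noteq> {}" using \<open>v $ i = 0\<close> by blast
      fix i j assume i: "i \<in> {k. v $ k = 0}" and e: "{i, j} \<in> G"
      show "j \<in> {k. v $ k = 0}"
      proof (cases "i = j")
        case False
        have "(\<Sum>k\<in>UNIV. - (A $ i $ k * z $ k)) = 0"
          using arg_cong[OF Az, of "\<lambda>v. v $ i"] i
          by (simp add: matrix_vector_mult_def z_def sum_negf)
        moreover have "0 \<le> - (A $ i $ k * z $ k)" for k
          using i nonpos[of i k] by (cases "i = k") (auto simp: z_def mult_nonpos_nonneg)
        ultimately have "A $ i $ j * z $ j = 0"
          by (subst (asm) sum_nonneg_eq_0_iff) auto
        moreover have "A $ i $ j < 0" using A e False by (auto simp: schroedinger_def)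
        ultimately show ?thesis by (simp add: z_def)
      qed (use i in simp)
    qed
    then have "v = 0" by (auto simp: vec_eq_iff)
    with v show False by simp
  qed
  \<comment> \<open>\<open>undefined\<close> is just some vertex: any single coordinate determines
    the eigenvector.\<close>
  have "multiplicity_of A l \<le> card {undefined :: 'n}"
    using nz by (intro multiplicity_le_card_determining) blast
  moreover have "multiplicity_of A l > 0"
    using spec by (intro multiplicity_of_pos) (auto simp: has_spectrum_def ls)
  ultimately have "multiplicity_of A l = 1" by simp
  then show ?thesis using spec by (auto simp: has_spectrum_def ls)
qed

lemma has_spectrum_uminus:
  fixes A :: "real^'n^'n"
  assumes "has_spectrum A ls ms"
  shows "has_spectrum (- A) (rev (map uminus ls)) (rev ms)"
proof -
  have neg: "(- A) *v v = - (A *v v)" for v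
    by (simp add: vec_eq_iff matrix_vector_mult_def sum_negf)
  then have E: "(- A) *v v = (- c) *\<^sub>R v \<longleftrightarrow> A *v v = c *\<^sub>R v" for c v by simp
  have "multiplicity_of (- A) (- c) = multiplicity_of A c" for c
    by (simp only: multiplicity_of_def E)
  moreover have "eigenvalues (- A) = uminus ` eigenvalues A"
  proof -
    have "c \<in> eigenvalues (- A) \<longleftrightarrow> - c \<in> eigenvalues A" for c
      using E[of _ "- c"] by (simp add: eigenvalues_def)
    then show ?thesis by force
  qed
  moreover have "sorted_wrt (<) (rev (map uminus ls))"
    using assms by (auto simp: has_spectrum_def sorted_wrt_rev sorted_wrt_map)
  ultimately show ?thesis using assms
    by (auto simp: has_spectrum_def rev_map)
qed

text \<open>Conjugation by the diagonal sign matrix of the two colour classes makes all edge entries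
  positive; negating gives a matrix of the same graph with the reversed list, to which Perron's
  argument applies.\<close>

lemma largest_eigenvalue_simple_bipartite:
  fixes A :: "real^'n^'n" and s :: "'n \<Rightarrow> bool"
  assumes A: "A \<in> schroedinger G" and G: "connected_edges G" and spec: "has_spectrum A ls ms"
    and s: "\<And>i j. {i, j} \<in> G \<Longrightarrow> s i \<noteq> s j"
  shows "\<exists>ms'. ms = ms' @ [1]"
proof -
  define \<sigma> where "\<sigma> i = (if s i then 1 else - 1 :: real)" for i
  have \<sigma>: "\<sigma> i * \<sigma> i = 1" for i by (simp add: \<sigma>_def)
  define D where "D v = (\<chi> i. \<sigma> i * v $ i)" for v :: "real^'n"
  define B :: "real^'n^'n" where "B = (\<chi> i j. \<sigma> i * \<sigma> j * A $ i $ j)"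
  have "D (D v) = v" for v by (simp add: D_def vec_eq_iff \<sigma> flip: mult.assoc)
  then have "bij D" by (intro o_bij[of D]) (auto simp: fun_eq_iff)
  moreover have "linear D" by (auto intro!: linearI simp: D_def vec_eq_iff algebra_simps)
  moreover have "B *v (D v) = D (A *v v)" for v
  proof -
    have "\<sigma> i * \<sigma> j * A $ i $ j * (\<sigma> j * v $ j) = \<sigma> i * (A $ i $ j * v $ j)" for i j
    proof -
      have "\<sigma> i * \<sigma> j * A $ i $ j * (\<sigma> j * v $ j) = (\<sigma> j * \<sigma> j) * (\<sigma> i * (A $ i $ j * v $ j))"
        by (simp only: ac_simps)
      then show ?thesis by (simp only: \<sigma> mult_1)
    qed
    note * = this
    show ?thesis
      by (simp add: B_def D_def vec_eq_iff matrix_vector_mult_def sum_distrib_left)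
        (intro allI sum.cong refl *)
  qed
  ultimately have "has_spectrum B ls ms" using has_spectrum_linear_iso[OF spec] by blast
  from has_spectrum_uminus[OF this]
  have "has_spectrum (- B) (rev (map uminus ls)) (rev ms)" .
  moreover have "- B \<in> schroedinger G"
  proof -
    have sym: "A $ i $ j = A $ j $ i" for i j using A schroedinger_symmetric symmetric_entry by blast
    have "transpose (- B) = - B" by (simp add: B_def vec_eq_iff transpose_def sym mult.commute)
    moreover have "if {i, j} \<in> G then (- B) $ i $ j < 0 else (- B) $ i $ j = 0" if "i \<noteq> j" for i j
    proof (cases "{i, j} \<in> G")
      case True
      then have "\<sigma> i * \<sigma> j = - 1" using s[OF True] by (auto simp: \<sigma>_def)
      then show ?thesis using True that A by (auto simp: B_def schroedinger_def)
    next
      case False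
      then show ?thesis using that A by (auto simp: B_def schroedinger_def)
    qed
    ultimately show ?thesis unfolding schroedinger_def by blast
  qed
  ultimately obtain ms' where "rev ms = 1 # ms'" using smallest_eigenvalue_simple[OF _ G] by blast
  then have "ms = rev ms' @ [1]" by (metis rev_rev_ident rev.simps(2))
  then show ?thesis by blast
qed

section \<open>The eight candidate lists of a connected graph on five vertices\<close>

lemma compositions_of_5:
  fixes ms :: "nat list"
  assumes "sum_list ms = 5" "\<And>m. m \<in> set ms \<Longrightarrow> m > 0" "\<exists>ms'. ms = 1 # ms'"
  shows "ms \<in> {[1,1,1,1,1], [1,2,1,1], [1,1,2,1], [1,1,1,2], [1,2,2], [1,3,1], [1,1,3], [1,4]}"
proof -
  have 0: "ms = []" if "sum_list ms = 0" "\<forall>m\<in>set ms. m > 0" for ms :: "nat list"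
    using that by (cases ms) auto
  have 1: "ms = [1]" if "sum_list ms = 1" "\<forall>m\<in>set ms. m > 0" for ms :: "nat list"
  proof (cases ms)
    case (Cons x xs)
    then have "x + sum_list xs = 1" "x > 0" using that by simp_all
    then have "x = 1 \<and> sum_list xs = 0" by linarith
    then show ?thesis using 0[of xs] that Cons by auto
  qed (use that in auto)
  have 2: "ms \<in> {[1,1],[2]}" if "sum_list ms = 2" "\<forall>m\<in>set ms. m > 0" for ms :: "nat list"
  proof (cases ms)
    case (Cons x xs)
    then have "x + sum_list xs = 2" "x > 0" using that by simp_all
    then have "x = 1 \<and> sum_list xs = 1 \<or> x = 2 \<and> sum_list xs = 0" by linarith
    then show ?thesis using 0[of xs] 1[of xs] that Cons by auto
  qed (use that in auto)
  have 3: "ms \<in> {[1,1,1],[1,2],[2,1],[3]}" if "sum_list ms = 3" "\<forall>m\<in>set ms. m > 0" for ms :: "nat list"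
  proof (cases ms)
    case (Cons x xs)
    then have "x + sum_list xs = 3" "x > 0" using that by simp_all
    then have "x = 1 \<and> sum_list xs = 2 \<or> x = 2 \<and> sum_list xs = 1 \<or> x = 3 \<and> sum_list xs = 0"
      by linarith
    then show ?thesis using 0[of xs] 1[of xs] 2[of xs] that Cons by auto
  qed (use that in auto)
  obtain ms' where ms: "ms = 1 # ms'" using assms by blast
  then have s: "sum_list ms' = 4" "\<forall>m\<in>set ms'. m > 0" using assms by auto
  show ?thesis
  proof (cases ms')
    case (Cons x xs)
    then have "x + sum_list xs = 4" "x > 0" using s by simp_all
    then have "x = 1 \<and> sum_list xs = 3 \<or> x = 2 \<and> sum_list xs = 2 \<or> x = 3 \<and> sum_list xs = 1
      \<or> x = 4 \<and> sum_list xs = 0"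
      by linarith
    then show ?thesis using 0[of xs] 1[of xs] 2[of xs] 3[of xs] s Cons ms by auto
  qed (use s in auto)
qed

lemma has_spectrum_connected_5:
  fixes A :: "real^5^5"
  assumes "A \<in> schroedinger G" "connected_edges G" "has_spectrum A ls ms"
  shows "ms \<in> {[1,1,1,1,1], [1,2,1,1], [1,1,2,1], [1,1,1,2], [1,2,2], [1,3,1], [1,1,3], [1,4]}"
  using has_spectrum_sum_list[OF schroedinger_symmetric[OF assms(1)] assms(3)]
    smallest_eigenvalue_simple[OF assms]
  by (intro compositions_of_5) auto

text \<open>When all other eigenvalues are simple, the expansion can be indexed by the eigenvalues
  themselves, so that the sum over a given list becomes explicit.\<close>

lemma spectral_expansion_simple:
  fixes A :: "real^'n^'n"
  assumes sym: "transpose A = A" and spec: "has_spectrum A ls ms"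
    and simple: "\<And>l. l \<in> set ls \<Longrightarrow> l \<noteq> \<mu> \<Longrightarrow> multiplicity_of A l = 1"
  shows "\<exists>u :: real \<Rightarrow> real^'n. \<forall>i j. A $ i $ j - (if i = j then \<mu> else 0) =
    (\<Sum>l\<in>set ls - {\<mu>}. (l - \<mu>) * u l $ i * u l $ j)"
proof -
  obtain c :: "'n \<Rightarrow> real" and b where c: "eigenvalues A = range c"
    "\<And>\<mu>. multiplicity_of A \<mu> = card {k. c k = \<mu>}"
    and b: "\<And>\<mu> i j. A $ i $ j - (if i = j then \<mu> else 0) =
       (\<Sum>k\<in>{k. c k \<noteq> \<mu>}. (c k - \<mu>) * b k $ i * b k $ j)"
    using spectral_expansion[OF sym] by blast
  define K where "K = {k. c k \<noteq> \<mu>}"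
  have ls: "set ls = range c" using spec c by (simp add: has_spectrum_def)
  have inj: "inj_on c K"
  proof (rule inj_onI)
    fix k l assume "k \<in> K" "l \<in> K" "c k = c l"
    moreover have "card {j. c j = c k} = 1"
      using simple[of "c k"] \<open>k \<in> K\<close> ls c(2) by (auto simp: K_def)
    then obtain x where "{j. c j = c k} = {x}" by (rule card_1_singletonE)
    ultimately have "k \<in> {x}" "l \<in> {x}" by (metis mem_Collect_eq)+
    then show "k = l" by simp
  qed
  have img: "c ` K = set ls - {\<mu>}" by (auto simp: K_def ls)
  have "(\<Sum>k\<in>K. (c k - \<mu>) * b k $ i * b k $ j) =
      (\<Sum>l\<in>set ls - {\<mu>}. (l - \<mu>) * b (inv_into K c l) $ i * b (inv_into K c l) $ j)" for i j
    unfolding img[symmetric] sum.reindex[OF inj] using inj by (intro sum.cong) auto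
  then show ?thesis using b[of _ _ \<mu>] unfolding K_def by (intro exI[of _ "\<lambda>l. b (inv_into K c l)"]) (simp add: K_def)
qed

lemma schroedinger_edge: "A \<in> schroedinger G \<Longrightarrow> {i, j} \<in> G \<Longrightarrow> i \<noteq> j \<Longrightarrow> A $ i $ j < 0"
  by (auto simp: schroedinger_def)

lemma schroedinger_nonedge: "A \<in> schroedinger G \<Longrightarrow> {i, j} \<notin> G \<Longrightarrow> i \<noteq> j \<Longrightarrow> A $ i $ j = 0"
  by (auto simp: schroedinger_def)

text \<open>Here \<open>A - b\<close> has rank one, a multiple of \<open>u u^T\<close>. A nonedge
  \<open>{i, j}\<close> makes \<open>u\<close> vanish at \<open>i\<close> or \<open>j\<close>, and
  that vertex could then have no edge.\<close>

lemma not_1_4: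
  assumes A: "A \<in> schroedinger G" and "{i, j} \<notin> G" "i \<noteq> j"
    and "{i, k} \<in> G" "i \<noteq> k" "{j, l} \<in> G" "j \<noteq> l"
  shows "\<not> has_spectrum A ls [1, 4]"
proof
  assume spec: "has_spectrum A ls [1, 4]"
  then obtain a b where ls: "ls = [a, b]" and ab: "a < b" "multiplicity_of A a = 1"
    by (auto simp: has_spectrum_def map_eq_Cons_conv)
  have "\<exists>u. \<forall>i j. A $ i $ j - (if i = j then b else 0) = (\<Sum>l\<in>set ls - {b}. (l - b) * u l $ i * u l $ j)"
    using ab by (intro spectral_expansion_simple[OF schroedinger_symmetric[OF A] spec]) (auto simp: ls)
  moreover have "set ls - {b} = {a}" using ab ls by auto
  ultimately obtain u where u: "\<And>i j. i \<noteq> j \<Longrightarrow> A $ i $ j = (a - b) * u a $ i * u a $ j"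
    by (auto split: if_splits)
  have "A $ i $ j = 0" using schroedinger_nonedge[OF A] assms by blast
  then have "u a $ i = 0 \<or> u a $ j = 0" using u[of i j] ab assms by auto
  moreover have "A $ i $ k < 0" "A $ j $ l < 0" using schroedinger_edge[OF A] assms by auto
  ultimately show False using u[of i k] u[of j l] assms by auto
qed

text \<open>Both simple eigenvalues lie below \<open>c\<close>, so \<open>c - A\<close> is positive
  semidefinite of rank two: the Gram matrix of the Euclidean plane vectors
  \<open>(u i, v i)\<close>.\<close>

lemma gram_1_1_3:
  assumes A: "A \<in> schroedinger G" and spec: "has_spectrum A ls [1, 1, 3]"
  shows "\<exists>c u v. \<forall>i j. A $ i $ j = (if i = j then c else 0) - (u i * u j + v i * v j)"
proof -
  obtain a b c where ls: "ls = [a, b, c]" and o: "a < b" "b < c" "multiplicity_of A a = 1" "multiplicity_of A b = 1"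
    using spec by (auto simp: has_spectrum_def map_eq_Cons_conv)
  have "\<exists>u. \<forall>i j. A $ i $ j - (if i = j then c else 0) = (\<Sum>l\<in>set ls - {c}. (l - c) * u l $ i * u l $ j)"
    using o by (intro spectral_expansion_simple[OF schroedinger_symmetric[OF A] spec]) (auto simp: ls)
  moreover have "set ls - {c} = {a, b}" using o ls by auto
  ultimately obtain u where u: "\<And>i j. A $ i $ j - (if i = j then c else 0) =
      (a - c) * u a $ i * u a $ j + (b - c) * u b $ i * u b $ j"
    using o by auto
  define s t where "s = sqrt (c - a)" and "t = sqrt (c - b)"
  have st: "s * s = c - a" "t * t = c - b" using o by (auto simp: s_def t_def)
  have "A $ i $ j = (if i = j then c else 0) -
      ((s * u a $ i) * (s * u a $ j) + (t * u b $ i) * (t * u b $ j))" for i j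
  proof -
    have "(s * u a $ i) * (s * u a $ j) + (t * u b $ i) * (t * u b $ j) =
        (s * s) * u a $ i * u a $ j + (t * t) * u b $ i * u b $ j" by simp
    then show ?thesis unfolding st using u[of i j] by (simp add: algebra_simps)
  qed
  then show ?thesis by (intro exI[of _ c] exI[of _ "\<lambda>i. s * u a $ i"] exI[of _ "\<lambda>i. t * u b $ i"]) blast
qed

text \<open>The simple eigenvalues lie on both sides of \<open>c\<close>, so the form has signature
  (1,1).\<close>

lemma gram_1_3_1:
  assumes A: "A \<in> schroedinger G" and spec: "has_spectrum A ls [1, 3, 1]"
  shows "\<exists>c u v. \<forall>i j. A $ i $ j = (if i = j then c else 0) - u i * u j + v i * v j"
proof -
  obtain a c b where ls: "ls = [a, c, b]" and o: "a < c" "c < b" "multiplicity_of A a = 1" "multiplicity_of A b = 1"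
    using spec by (auto simp: has_spectrum_def map_eq_Cons_conv)
  have "\<exists>u. \<forall>i j. A $ i $ j - (if i = j then c else 0) = (\<Sum>l\<in>set ls - {c}. (l - c) * u l $ i * u l $ j)"
    using o by (intro spectral_expansion_simple[OF schroedinger_symmetric[OF A] spec]) (auto simp: ls)
  moreover have "set ls - {c} = {a, b}" using o ls by auto
  ultimately obtain u where u: "\<And>i j. A $ i $ j - (if i = j then c else 0) =
      (a - c) * u a $ i * u a $ j + (b - c) * u b $ i * u b $ j"
    using o by auto
  define s t where "s = sqrt (c - a)" and "t = sqrt (b - c)"
  have st: "s * s = c - a" "t * t = b - c" using o by (auto simp: s_def t_def)
  have "A $ i $ j = (if i = j then c else 0) -
      (s * u a $ i) * (s * u a $ j) + (t * u b $ i) * (t * u b $ j)" for i j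
  proof -
    have "(s * u a $ i) * (s * u a $ j) - (t * u b $ i) * (t * u b $ j) =
        (s * s) * u a $ i * u a $ j - (t * t) * u b $ i * u b $ j" by simp
    then show ?thesis unfolding st using u[of i j] by (simp add: algebra_simps)
  qed
  then show ?thesis by (intro exI[of _ c] exI[of _ "\<lambda>i. s * u a $ i"] exI[of _ "\<lambda>i. t * u b $ i"]) blast
qed

lemma eigenvector_rows_5:
  fixes A :: "real^5^5"
  assumes "A *v v = c *\<^sub>R v"
  shows "A $ i $ 1 * v $ 1 + A $ i $ 2 * v $ 2 + A $ i $ 3 * v $ 3 + A $ i $ 4 * v $ 4 + A $ i $ 5 * v $ 5
    = c * v $ i"
  using arg_cong[OF assms, of "\<lambda>w. w $ i"] by (simp add: matrix_vector_mult_def sum_5)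

lemma vec5_eq_0I:
  fixes v :: "real^5"
  assumes "v $ 1 = 0" "v $ 2 = 0" "v $ 3 = 0" "v $ 4 = 0" "v $ 5 = 0"
  shows "v = 0"
  using assms by (simp add: vec_eq_iff forall_5)

text \<open>
  Zero forcing: \<open>p\<close> and \<open>q\<close> are the initially blue vertices, and the vertices \<open>x\<^sub>1\<close>, \<open>x\<^sub>2\<close>, \<open>x\<^sub>3\<close> are forced
  in this order by the blue vertices \<open>r\<^sub>1\<close>, \<open>r\<^sub>2\<close>, \<open>r\<^sub>3\<close>.
\<close>

lemma zero_forcing_5:
  fixes A :: "real^5^5"
  assumes A: "A \<in> schroedinger G" and spec: "has_spectrum A ls ms"
    and V: "\<forall>x. x \<in> {p, q, x1, x2, x3}"
    and 1: "{r1, x1} \<in> G" "r1 \<in> {p, q}" "\<And>j. j \<notin> {p, q, x1} \<Longrightarrow> {r1, j} \<notin> G"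
    and 2: "{r2, x2} \<in> G" "r2 \<in> {p, q, x1}" "\<And>j. j \<notin> {p, q, x1, x2} \<Longrightarrow> {r2, j} \<notin> G"
    and 3: "{r3, x3} \<in> G" "r3 \<in> {p, q, x1, x2}"
    and m: "m \<in> set ms"
  shows "m \<le> card {p, q}"
proof -
  \<comment> \<open>Forcing rule: in row \<open>r\<close> of the eigenvector equation every term
    except the one at \<open>x\<close> vanishes.\<close>
  have force: "v $ x = 0"
    if v: "A *v v = c *\<^sub>R v" "{r, x} \<in> G" "r \<in> B" "\<And>b. b \<in> B \<Longrightarrow> v $ b = 0"
      "\<And>j. j \<notin> insert x B \<Longrightarrow> {r, j} \<notin> G" for v c r x B
  proof (cases "x \<in> B")
    case False
    have z: "A $ r $ j * v $ j = 0" if "j \<noteq> x" for j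
    proof (cases "j \<in> B")
      case False
      then have "A $ r $ j = 0" using that v by (intro schroedinger_nonedge[OF A]) auto
      then show ?thesis by simp
    qed (use v in simp)
    have "(\<Sum>j\<in>UNIV. A $ r $ j * v $ j) = c * v $ r"
      using arg_cong[OF v(1), of "\<lambda>w. w $ r"] by (simp add: matrix_vector_mult_def)
    moreover have "(\<Sum>j\<in>UNIV. A $ r $ j * v $ j) = A $ r $ x * v $ x"
      using z by (subst sum.mono_neutral_right[of UNIV "{x}"]) auto
    moreover have "A $ r $ x < 0" using v False by (intro schroedinger_edge[OF A]) auto
    ultimately show ?thesis using v by simp
  qed (use v in simp)
  have "multiplicity_of A c \<le> card {p, q}" for c
  proof (rule multiplicity_le_card_determining)
    fix v assume v: "A *v v = c *\<^sub>R v" and pq: "\<And>a. a \<in> {p, q} \<Longrightarrow> v $ a = 0"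
    have "v $ x1 = 0" by (rule force[OF v, of r1 x1 "{p, q}"]) (use 1 pq in auto)
    moreover from this have "v $ x2 = 0" by (intro force[OF v, of r2 x2 "{p, q, x1}"]) (use 2 pq in auto)
    moreover from calculation have "v $ x3 = 0"
      by (intro force[OF v, of r3 x3 "{p, q, x1, x2}"]) (use 3 pq V in auto)
    ultimately have "v $ i = 0" for i using V pq by blast
    then show "v = 0" by (simp add: vec_eq_iff)
  qed
  then show ?thesis using m spec by (auto simp: has_spectrum_def)
qed

section \<open>Excluded multiplicity lists\<close>

text \<open>Each of the two double eigenvalues has an eigenvector that vanishes at the vertex 1,
  which is pendant in the graphs treated next.\<close>

lemma not_1_2_2I:
  fixes A :: "real^5^5"
  assumes "\<And>c d v w. c < d \<Longrightarrow> v \<noteq> 0 \<Longrightarrow> w \<noteq> 0 \<Longrightarrow> v $ 1 = 0 \<Longrightarrow> w $ 1 = 0 \<Longrightarrow> A *v v = c *\<^sub>R v \<Longrightarrow>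
    A *v w = d *\<^sub>R w \<Longrightarrow> False"
  shows "\<not> has_spectrum A ls [1, 2, 2]"
proof
  assume "has_spectrum A ls [1, 2, 2]"
  then obtain b c d where "c < d" "multiplicity_of A c = 2" "multiplicity_of A d = 2"
    by (auto simp: has_spectrum_def map_eq_Cons_conv)
  then show False
    using eigenvector_vanishing_at[of A c 1] eigenvector_vanishing_at[of A d 1] assms by auto
qed

text \<open>A zero at 1 spreads along the pendant path to 2 and 3. Row 3 then fixes the ratio of the
  entries at 4 and 5, and row 4 determines the eigenvalue, so there cannot be two.\<close>

lemma L32_not_1_2_2:
  assumes A: "A \<in> schroedinger L32"
  shows "\<not> has_spectrum A ls [1, 2, 2]"
proof (rule not_1_2_2I)
  fix c d v w
  assume h: "c < d" "v \<noteq> 0" "w \<noteq> 0" "v $ 1 = 0" "w $ 1 = 0" "A *v v = c *\<^sub>R v" "A *v w = d *\<^sub>R w"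
  note e = schroedinger_edge[OF A] and n = schroedinger_nonedge[OF A]
  have a: "A $ 1 $ 2 < 0" "A $ 2 $ 3 < 0" "A $ 3 $ 4 < 0" "A $ 4 $ 5 < 0" "A $ 3 $ 5 < 0"
    "A $ 1 $ 3 = 0" "A $ 1 $ 4 = 0" "A $ 1 $ 5 = 0" "A $ 2 $ 4 = 0" "A $ 2 $ 5 = 0" "A $ 4 $ 1 = 0" "A $ 4 $ 2 = 0"
    by (simp_all add: e n L32_def doubleton_eq_iff)
  have eig: "c = A $ 4 $ 4 - A $ 4 $ 5 * A $ 3 $ 4 / A $ 3 $ 5" if v: "A *v v = c *\<^sub>R v" "v \<noteq> 0" "v $ 1 = 0" for v c
  proof -
    note r = eigenvector_rows_5[OF v(1)]
    have 2: "v $ 2 = 0" using r[of 1] v(3) a by simp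
    have 3: "v $ 3 = 0" using r[of 2] v(3) 2 a by simp
    have 5: "v $ 5 = - (A $ 3 $ 4 / A $ 3 $ 5) * v $ 4"
      using r[of 3] v(3) 2 3 a by (simp add: field_simps)
    have "v $ 4 \<noteq> 0" using v 2 3 5 vec5_eq_0I[of v] by auto
    moreover have "(A $ 4 $ 4 - A $ 4 $ 5 * A $ 3 $ 4 / A $ 3 $ 5) * v $ 4 = c * v $ 4"
      using r[of 4] v(3) 2 3 5 a by (simp add: algebra_simps)
    ultimately show ?thesis by simp
  qed
  show False using eig[of v c] eig[of w d] h by simp
qed

text \<open>A zero at 1 forces one at 2; row 2 ties the entry at 3 to that at 5, and row 5, which
  involves only 2, 3 and 5, determines the eigenvalue.\<close>

lemma Bull_not_1_2_2:
  assumes A: "A \<in> schroedinger Bull"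
  shows "\<not> has_spectrum A ls [1, 2, 2]"
proof (rule not_1_2_2I)
  fix c d v w
  assume h: "c < d" "v \<noteq> 0" "w \<noteq> 0" "v $ 1 = 0" "w $ 1 = 0" "A *v v = c *\<^sub>R v" "A *v w = d *\<^sub>R w"
  note e = schroedinger_edge[OF A] and n = schroedinger_nonedge[OF A]
  have a: "A $ 1 $ 2 < 0" "A $ 2 $ 3 < 0" "A $ 3 $ 4 < 0" "A $ 2 $ 5 < 0" "A $ 5 $ 3 < 0"
    "A $ 1 $ 3 = 0" "A $ 1 $ 4 = 0" "A $ 1 $ 5 = 0" "A $ 2 $ 4 = 0" "A $ 5 $ 4 = 0" "A $ 5 $ 1 = 0"
    by (simp_all add: e n Bull_def doubleton_eq_iff)
  have eig: "c = A $ 5 $ 5 - A $ 5 $ 3 * A $ 2 $ 5 / A $ 2 $ 3" if v: "A *v v = c *\<^sub>R v" "v \<noteq> 0" "v $ 1 = 0" for v c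
  proof -
    note r = eigenvector_rows_5[OF v(1)]
    have 2: "v $ 2 = 0" using r[of 1] v(3) a by simp
    have 3: "v $ 3 = - (A $ 2 $ 5 / A $ 2 $ 3) * v $ 5"
      using r[of 2] v(3) 2 a by (simp add: field_simps)
    have "v $ 5 \<noteq> 0"
    proof
      assume "v $ 5 = 0"
      then have "v $ 4 = 0" using r[of 3] v(3) 2 3 a by simp
      then show False using v 2 3 \<open>v $ 5 = 0\<close> vec5_eq_0I[of v] by auto
    qed
    moreover have "(A $ 5 $ 5 - A $ 5 $ 3 * A $ 2 $ 5 / A $ 2 $ 3) * v $ 5 = c * v $ 5"
      using r[of 5] v(3) 2 3 a by (simp add: algebra_simps)
    ultimately show ?thesis by simp
  qed
  show False using eig[of v c] eig[of w d] h by simp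
qed

text \<open>Row 2 fixes the ratio of the entries at 5 and 3 to \<open>- k\<close>. Comparing rows 3
  and 5 for the two eigenvectors, normalized at 3, shows that the negative entries at 34 and 54,
  times the same number, have opposite signs.\<close>

lemma Kite_not_1_2_2:
  assumes A: "A \<in> schroedinger Kite"
  shows "\<not> has_spectrum A ls [1, 2, 2]"
proof (rule not_1_2_2I)
  fix c d v w
  assume h: "c < d" "v \<noteq> 0" "w \<noteq> 0" "v $ 1 = 0" "w $ 1 = 0" "A *v v = c *\<^sub>R v" "A *v w = d *\<^sub>R w"
  note e = schroedinger_edge[OF A] and n = schroedinger_nonedge[OF A]
  have a: "A $ 1 $ 2 < 0" "A $ 2 $ 3 < 0" "A $ 3 $ 4 < 0" "A $ 4 $ 5 < 0" "A $ 2 $ 5 < 0" "A $ 3 $ 5 < 0"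
    "A $ 5 $ 4 < 0"
    "A $ 1 $ 3 = 0" "A $ 1 $ 4 = 0" "A $ 1 $ 5 = 0" "A $ 2 $ 4 = 0" "A $ 3 $ 1 = 0" "A $ 5 $ 1 = 0"
    by (simp_all add: e n Kite_def doubleton_eq_iff)
  have sym: "A $ 5 $ 3 = A $ 3 $ 5" using symmetric_entry schroedinger_symmetric[OF A] by blast
  have eig: "v $ 2 = 0 \<and> v $ 3 \<noteq> 0 \<and> A $ 2 $ 3 * v $ 3 + A $ 2 $ 5 * v $ 5 = 0 \<and>
    A $ 3 $ 3 * v $ 3 + A $ 3 $ 4 * v $ 4 + A $ 3 $ 5 * v $ 5 = c * v $ 3 \<and>
    A $ 3 $ 5 * v $ 3 + A $ 5 $ 4 * v $ 4 + A $ 5 $ 5 * v $ 5 = c * v $ 5"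
    if v: "A *v v = c *\<^sub>R v" "v \<noteq> 0" "v $ 1 = 0" for v c
  proof -
    note r = eigenvector_rows_5[OF v(1)]
    have 2: "v $ 2 = 0" using r[of 1] v(3) a by simp
    have 3: "A $ 2 $ 3 * v $ 3 + A $ 2 $ 5 * v $ 5 = 0"
      using r[of 2] v(3) 2 a by simp
    have "v $ 3 \<noteq> 0"
    proof
      assume "v $ 3 = 0"
      moreover from this have "v $ 5 = 0" using 3 a by simp
      moreover from calculation have "v $ 4 = 0" using r[of 3] v(3) 2 a by simp
      ultimately show False using v 2 vec5_eq_0I[of v] by auto
    qed
    then show ?thesis using 2 3 r[of 3] r[of 5] v(3) a sym by simp
  qed
  define k where "k = A $ 2 $ 3 / A $ 2 $ 5"
  have k: "k > 0" using a by (simp add: k_def divide_neg_neg)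
  have eig': "A $ 3 $ 3 + A $ 3 $ 4 * (v $ 4 / v $ 3) - A $ 3 $ 5 * k = c \<and>
    A $ 3 $ 5 + A $ 5 $ 4 * (v $ 4 / v $ 3) - A $ 5 $ 5 * k = - k * c"
    if v: "A *v v = c *\<^sub>R v" "v \<noteq> 0" "v $ 1 = 0" for v c
  proof -
    have r: "v $ 3 \<noteq> 0" "A $ 2 $ 3 * v $ 3 + A $ 2 $ 5 * v $ 5 = 0"
      "A $ 3 $ 3 * v $ 3 + A $ 3 $ 4 * v $ 4 + A $ 3 $ 5 * v $ 5 = c * v $ 3"
      "A $ 3 $ 5 * v $ 3 + A $ 5 $ 4 * v $ 4 + A $ 5 $ 5 * v $ 5 = c * v $ 5" using eig[OF v] by auto
    have 5: "v $ 5 = - k * v $ 3" using r(2) a by (simp add: k_def field_simps)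
    show ?thesis using r(1,3,4) unfolding 5 by (simp add: field_simps)
  qed
  define p q where "p = v $ 4 / v $ 3" and "q = w $ 4 / w $ 3"
  have "A $ 3 $ 4 * (p - q) = c - d" "A $ 5 $ 4 * (p - q) = k * (d - c)"
    using eig'[of v c] eig'[of w d] h unfolding p_def[symmetric] q_def[symmetric] by (auto simp: algebra_simps)
  moreover have "c - d < 0" "k * (d - c) > 0" using h k by auto
  ultimately have "A $ 3 $ 4 * (p - q) < 0" "A $ 5 $ 4 * (p - q) > 0" by auto
  then show False using a by (simp add: mult_less_0_iff zero_less_mult_iff)
qed

lemma induced_C4_not_1_1_3:
  assumes A: "A \<in> schroedinger G" and G: "{2,3} \<in> G" "{3,4} \<in> G" "{4,5} \<in> G" "{2,5} \<in> G"
    "{2,4} \<notin> G" "{3,5} \<notin> (G :: graph5)"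
  shows "\<not> has_spectrum A ls [1, 1, 3]"
proof
  assume "has_spectrum A ls [1, 1, 3]"
  from gram_1_1_3[OF A this] obtain c u v
    where uv: "\<And>i j. A $ i $ j = (if i = j then c else 0) - (u i * u j + v i * v j)" by blast
  note e = schroedinger_edge[OF A] and n = schroedinger_nonedge[OF A]
  have "u 2 * u 4 + v 2 * v 4 = 0" "u 3 * u 5 + v 3 * v 5 = 0"
    "u 2 * u 3 + v 2 * v 3 > 0" "u 3 * u 4 + v 3 * v 4 > 0" "u 4 * u 5 + v 4 * v 5 > 0" "u 2 * u 5 + v 2 * v 5 > 0"
    using n[of 2 4] n[of 3 5] e[of 2 3] e[of 3 4] e[of 4 5] e[of 2 5] G uv by simp_all
  note * = this
  have nz: "u 2 * u 2 + v 2 * v 2 > 0" "u 4 * u 4 + v 4 * v 4 > 0"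
    using * by (auto simp: sum_squares_gt_zero_iff)
  text \<open>In the orthogonal frame spanned by the vectors of 2 and 4, both 3 and 5 lie in the open first quadrant.\<close>
  have "(u 3 * u 5 + v 3 * v 5) * ((u 2 * u 2 + v 2 * v 2) * (u 4 * u 4 + v 4 * v 4)) =
    (u 2 * u 3 + v 2 * v 3) * (u 2 * u 5 + v 2 * v 5) * (u 4 * u 4 + v 4 * v 4) +
    (u 3 * u 4 + v 3 * v 4) * (u 4 * u 5 + v 4 * v 5) * (u 2 * u 2 + v 2 * v 2)"
    using *(1) by algebra
  moreover have "(u 2 * u 3 + v 2 * v 3) * (u 2 * u 5 + v 2 * v 5) * (u 4 * u 4 + v 4 * v 4) > 0"
    using * nz by (intro mult_pos_pos) auto
  moreover have "(u 3 * u 4 + v 3 * v 4) * (u 4 * u 5 + v 4 * v 5) * (u 2 * u 2 + v 2 * v 2) > 0"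
    using * nz by (intro mult_pos_pos) auto
  ultimately show False using * by simp
qed

text \<open>The independent vertices 3, 4, 5 would be three nonzero pairwise orthogonal vectors in
  the Euclidean plane.\<close>

lemma T5_not_1_1_3:
  assumes A: "A \<in> schroedinger T5"
  shows "\<not> has_spectrum A ls [1, 1, 3]"
proof
  assume "has_spectrum A ls [1, 1, 3]"
  from gram_1_1_3[OF A this] obtain c u v
    where uv: "\<And>i j. A $ i $ j = (if i = j then c else 0) - (u i * u j + v i * v j)" by blast
  note e = schroedinger_edge[OF A] and n = schroedinger_nonedge[OF A]
  have "A $ 3 $ 4 = 0" "A $ 3 $ 5 = 0" "A $ 4 $ 5 = 0" "A $ 1 $ 3 < 0" "A $ 1 $ 4 < 0" "A $ 1 $ 5 < 0"
    by (simp_all add: e n T5_def doubleton_eq_iff)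
  then have z: "u 3 * u 4 + v 3 * v 4 = 0" "u 3 * u 5 + v 3 * v 5 = 0" "u 4 * u 5 + v 4 * v 5 = 0"
    and nz: "u 3 \<noteq> 0 \<or> v 3 \<noteq> 0" "u 4 \<noteq> 0 \<or> v 4 \<noteq> 0" "u 5 \<noteq> 0 \<or> v 5 \<noteq> 0"
    using uv by auto
  have "u 3 * (u 4 * v 5 - u 5 * v 4) = 0" "v 3 * (u 4 * v 5 - u 5 * v 4) = 0"
    using z(1,2) by algebra+
  then have "u 4 * v 5 - u 5 * v 4 = 0" using nz(1) by auto
  then have "(u 4 * u 4 + v 4 * v 4) * (u 5 * u 5 + v 5 * v 5) = 0" using z(3) by algebra
  then show False using nz by (auto simp: sum_squares_eq_zero_iff)
qed

text \<open>The form is nondegenerate, so the orthogonal complement of a nonzero vector in the plane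
  is a line.\<close>

lemma lorentz_parallel:
  fixes u v :: "'i \<Rightarrow> real"
  assumes "u k \<noteq> 0 \<or> v k \<noteq> 0" "v i * v k - u i * u k = 0" "v j * v k - u j * u k = 0"
  shows "u i * v j - u j * v i = 0"
proof -
  have "u k * (u i * v j - u j * v i) = 0" "v k * (u i * v j - u j * v i) = 0"
    using assms(2,3) by algebra+
  then show ?thesis using assms(1) by auto
qed

text \<open>The vectors of 2 and 3 are both orthogonal to that of 4, hence parallel; the signs of
  the triangle 123 make them timelike (\<open>q\<close> negative). The same holds for 4 and 5, but
  two timelike vectors of a Lorentzian plane are never orthogonal.\<close>

lemma Bfly_not_1_3_1:
  assumes A: "A \<in> schroedinger Bfly"
  shows "\<not> has_spectrum A ls [1, 3, 1]"
proof
  assume "has_spectrum A ls [1, 3, 1]"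
  from gram_1_3_1[OF A this] obtain c u v
    where uv: "\<And>i j. A $ i $ j = (if i = j then c else 0) - u i * u j + v i * v j" by blast
  define q where "q i j = v i * v j - u i * u j" for i j
  have Aq: "A $ i $ j = q i j" if "i \<noteq> j" for i j using uv that by (simp add: q_def)
  note e = schroedinger_edge[OF A] and n = schroedinger_nonedge[OF A]
  have "A $ 2 $ 4 = 0" "A $ 2 $ 5 = 0" "A $ 3 $ 4 = 0" "A $ 3 $ 5 = 0"
    "A $ 1 $ 2 < 0" "A $ 1 $ 3 < 0" "A $ 1 $ 4 < 0" "A $ 1 $ 5 < 0" "A $ 2 $ 3 < 0" "A $ 4 $ 5 < 0"
    by (simp_all add: e n Bfly_def doubleton_eq_iff)
  then have z: "q 2 4 = 0" "q 2 5 = 0" "q 3 4 = 0" "q 3 5 = 0"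
    and neg: "q 1 2 < 0" "q 1 3 < 0" "q 1 4 < 0" "q 1 5 < 0" "q 2 3 < 0" "q 4 5 < 0"
    by (simp_all add: Aq)
  have timelike: "q i i < 0" if "q 1 i < 0" "q 1 j < 0" "q i j < 0" "u i * v j - u j * v i = 0" for i j
  proof -
    have "q i i * q 1 j = q i j * q 1 i" unfolding q_def using that(4) by algebra
    then have "q i i * q 1 j > 0" using that by (simp add: mult_neg_neg)
    then show ?thesis using that by (simp add: zero_less_mult_iff)
  qed
  have "q 2 2 < 0"
    by (rule timelike[of 2 3], fact, fact, fact, rule lorentz_parallel[of u 4 v])
      (use z neg in \<open>auto simp: q_def\<close>)
  moreover have "q 4 4 < 0"
    by (rule timelike[of 4 5], fact, fact, fact, rule lorentz_parallel[of u 2 v])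
      (use z neg in \<open>auto simp: q_def algebra_simps\<close>)
  ultimately have "q 2 2 * q 4 4 > 0" by (simp add: mult_neg_neg)
  moreover have "(q 2 4)\<^sup>2 - q 2 2 * q 4 4 = (u 2 * v 4 - u 4 * v 2)\<^sup>2"
    by (simp add: q_def power2_eq_square algebra_simps)
  ultimately show False using z(1) zero_le_power2[of "u 2 * v 4 - u 4 * v 2"] by simp
qed

text \<open>A matrix of rank three factors through three dimensions, so a 3 by 3 minor splits into a
  row factor and a column factor, the Pluecker coordinates of its index triples.\<close>

lemma det_minor_rank_3:
  fixes M :: "5 \<Rightarrow> 5 \<Rightarrow> real" and e :: "3 \<Rightarrow> real" and w :: "3 \<Rightarrow> 5 \<Rightarrow> real"
  assumes M: "\<And>i j. M i j = (\<Sum>k\<in>UNIV. e k * w k i * w k j)"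
  shows "det (\<chi> i j. M (\<alpha> i) (\<beta> j) :: real^3^3) =
    e 1 * e 2 * e 3 * det (\<chi> i k. w k (\<alpha> i) :: real^3^3) * det (\<chi> i k. w k (\<beta> i) :: real^3^3)"
proof -
  have "(\<chi> i j. M (\<alpha> i) (\<beta> j) :: real^3^3) =
      (\<chi> i k. w k (\<alpha> i)) ** (\<chi> k l. if k = l then e k else 0) ** transpose (\<chi> i k. w k (\<beta> i))"
    by (simp add: M vec_eq_iff matrix_matrix_mult_def transpose_def if_distrib algebra_simps cong: if_cong)
  moreover have "det (\<chi> k l. if k = l then e k else 0 :: real^3^3) = e 1 * e 2 * e 3"
    by (simp add: det_3)
  ultimately show ?thesis by (simp add: det_mul)
qed

text \<open>
  For a double eigenvalue \<open>c\<close> of \<open>A\<close>, the minors of \<open>A - c\<close> with rows \<open>i, i+1, i+2\<close> and columns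
  \<open>i+1, i+2, i+3\<close> are triangular and negative.  The Pluecker coordinates of consecutive triples would
  therefore alternate in sign around an odd cycle if the product of the other eigenvalues of \<open>A - c\<close> were
  positive.
\<close>

lemma C5_not_1_1_2_1:
  assumes A: "A \<in> schroedinger C5"
  shows "\<not> has_spectrum A ls [1, 1, 2, 1]"
proof
  assume spec: "has_spectrum A ls [1, 1, 2, 1]"
  then obtain a b c d where ls: "ls = [a, b, c, d]"
    and o: "a < b" "b < c" "c < d" "multiplicity_of A a = 1" "multiplicity_of A b = 1" "multiplicity_of A d = 1"
    by (auto simp: has_spectrum_def map_eq_Cons_conv)
  have "\<exists>u. \<forall>i j. A $ i $ j - (if i = j then c else 0) = (\<Sum>l\<in>set ls - {c}. (l - c) * u l $ i * u l $ j)"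
    using o by (intro spectral_expansion_simple[OF schroedinger_symmetric[OF A] spec]) (auto simp: ls)
  moreover have "set ls - {c} = {a, b, d}" using o ls by auto
  ultimately obtain u where u: "\<And>i j. A $ i $ j - (if i = j then c else 0) =
      (a - c) * u a $ i * u a $ j + (b - c) * u b $ i * u b $ j + (d - c) * u d $ i * u d $ j"
    using o by (auto simp: add.assoc)
  define M where "M i j = A $ i $ j - (if i = j then c else 0)" for i j
  define f :: "3 \<Rightarrow> real" where "f k = vector [a, b, d] $ k" for k
  define P where "P i j k = det (\<chi> r s. u (f s) $ (vector [i, j, k] $ (r :: 3)) :: real^3^3)" for i j k
  have minor: "det (\<chi> r s. M (vector [i,j,k] $ r) (vector [l,m,n] $ s) :: real^3^3) =
      (a - c) * (b - c) * (d - c) * P i j k * P l m n" for i j k l m n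
  proof -
    have "det (\<chi> r s. M (vector [i,j,k] $ r) (vector [l,m,n] $ s) :: real^3^3) =
      (f 1 - c) * (f 2 - c) * (f 3 - c) * P i j k * P l m n"
      unfolding P_def
      by (rule det_minor_rank_3[where e = "\<lambda>k. f k - c" and w = "\<lambda>k i. u (f k) $ i"])
        (simp add: M_def u f_def sum_3 vector_3)
    then show ?thesis by (simp add: f_def vector_3)
  qed
  note e = schroedinger_edge[OF A] and n = schroedinger_nonedge[OF A]
  have edges: "M 1 2 < 0" "M 2 3 < 0" "M 3 4 < 0" "M 4 5 < 0" "M 5 1 < 0"
    and nonedges: "M 1 3 = 0" "M 1 4 = 0" "M 2 4 = 0" "M 2 5 = 0" "M 3 5 = 0" "M 3 1 = 0"
    "M 4 1 = 0" "M 4 2 = 0" "M 5 2 = 0" "M 5 3 = 0"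
    by (simp_all add: M_def e n C5_def doubleton_eq_iff)
  have pos: "(a - c) * (b - c) * (d - c) > 0" using o by (simp add: mult_neg_neg)
  \<comment> \<open>With rows \<open>i, j, k\<close> and columns \<open>j, k, l\<close> the three
    vanishing entries lie above the diagonal, so the minor is the product of three edge
    entries.\<close>
  have step: "P i j k * P j k l < 0" if "M i j < 0" "M j k < 0" "M k l < 0" "M i k = 0" "M i l = 0" "M j l = 0"
    for i j k l
  proof -
    have "(a - c) * (b - c) * (d - c) * P i j k * P j k l = M i j * M j k * M k l"
      unfolding minor[of i j k j k l, symmetric] using that by (simp add: det_3 vector_3)
    also have "\<dots> < 0" using that by (simp add: mult_neg_neg mult_pos_neg)
    finally have "((a - c) * (b - c) * (d - c)) * (P i j k * P j k l) < 0" by (simp only: mult.assoc)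
    then show ?thesis using pos by (metis less_asym mult_less_0_iff)
  qed
  have "P 1 2 3 * P 2 3 4 < 0" "P 2 3 4 * P 3 4 5 < 0" "P 3 4 5 * P 4 5 1 < 0" "P 4 5 1 * P 5 1 2 < 0"
    "P 5 1 2 * P 1 2 3 < 0"
    by (rule step; (rule edges nonedges))+
  then show False by (auto simp: mult_less_0_iff)
qed

section \<open>Lists without the SSP\<close>

text \<open>If the columns of the symmetric matrix \<open>X\<close> are eigenvectors to one
  eigenvalue, transposing \<open>A ** X = c *\<^sub>R X\<close> shows that \<open>X\<close> commutes
  with \<open>A\<close>.\<close>

lemma not_SSP_I:
  fixes A X :: "real^'n^'n"
  assumes A: "A \<in> schroedinger G" and X: "nonedge_part G X = X" "X \<noteq> 0" "A ** X = c *\<^sub>R X"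
  shows "\<not> SSP A"
proof -
  have "transpose (nonedge_part G X) = nonedge_part G X"
    by (auto simp: nonedge_part_def vec_eq_iff transpose_def insert_commute add.commute)
  then have sym: "transpose X = X" by (simp only: X(1))
  have "X ** A = transpose (A ** X)"
    by (simp only: matrix_transpose_mul sym schroedinger_symmetric[OF A])
  also have "\<dots> = c *\<^sub>R X" by (simp only: X(3) transpose_scalar sym)
  finally show ?thesis using X SSP_iff_nonedge_part[OF A] by metis
qed

lemma nonedge_part_fixed_5:
  fixes X :: "real^5^5"
  assumes "transpose X = X" "\<And>i. X $ i $ i = 0" "\<And>i j. {i, j} \<in> G \<Longrightarrow> X $ i $ j = 0"
  shows "nonedge_part G X = X"
  unfolding vec_eq_iff
proof (intro allI)
  fix i j
  have "X $ j $ i = X $ i $ j" using assms(1) symmetric_entry by blast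
  then show "nonedge_part G X $ i $ j = X $ i $ j"
    using assms(2)[of i] assms(3)[of i j] by (auto simp: nonedge_part_def)
qed

text \<open>The leaves are nonzero, pairwise orthogonal vectors in the Lorentzian plane. Two of them
  orthogonal to a third are parallel, hence null, so every leaf has diagonal entry \<open>c\<close>.
  Any vector on the leaves orthogonal to the edge weights is then an eigenvector to
  \<open>c\<close>.\<close>

lemma K14_1_3_1_not_SSP:
  assumes A: "A \<in> schroedinger K14" and spec: "has_spectrum A ls [1, 3, 1]"
  shows "\<not> SSP A"
proof -
  from gram_1_3_1[OF A spec] obtain c u v
    where uv: "\<And>i j. A $ i $ j = (if i = j then c else 0) - u i * u j + v i * v j" by blast
  have K: "{i, j} \<in> K14 \<longleftrightarrow> i = 1 \<and> j \<in> {2,3,4,5} \<or> j = 1 \<and> i \<in> {2,3,4,5}" for i j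
    unfolding K14_def by (auto simp: doubleton_eq_iff)
  have sym: "A $ i $ j = A $ j $ i" for i j using A schroedinger_symmetric symmetric_entry by blast
  have b: "A $ 1 $ 2 < 0" "A $ 1 $ 3 < 0" "A $ 1 $ 4 < 0" "A $ 1 $ 5 < 0"
    and n: "A $ 2 $ 3 = 0" "A $ 2 $ 4 = 0" "A $ 2 $ 5 = 0" "A $ 3 $ 4 = 0" "A $ 3 $ 5 = 0" "A $ 4 $ 5 = 0"
    using A by (simp_all add: schroedinger_edge[OF A] schroedinger_nonedge[OF A] K)
  have leaf: "A $ i $ i = c"
    if "A $ 1 $ j < 0" "A $ 1 $ k < 0" "j \<noteq> 1" "k \<noteq> 1" "i \<noteq> j" "i \<noteq> k" "j \<noteq> k"
      "A $ i $ j = 0" "A $ i $ k = 0" "A $ j $ k = 0" for i j k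
  proof -
    have nz: "u j \<noteq> 0 \<or> v j \<noteq> 0" "u k \<noteq> 0 \<or> v k \<noteq> 0" using that uv by auto
    have z: "v i * v j - u i * u j = 0" "v i * v k - u i * u k = 0" "v j * v k - u j * u k = 0"
      using that uv by (simp_all add: algebra_simps)
    have "u i * v j - u j * v i = 0" by (rule lorentz_parallel[OF nz(2) z(2,3)])
    then have "(v i * v i - u i * u i) * u j = 0" "(v i * v i - u i * u i) * v j = 0"
      using z(1) by algebra+
    then have "v i * v i - u i * u i = 0" using nz(1) by auto
    then show ?thesis using uv by simp
  qed
  have d: "A $ 2 $ 2 = c" "A $ 3 $ 3 = c" "A $ 4 $ 4 = c" "A $ 5 $ 5 = c"
    using leaf[of 3 4 2] leaf[of 4 5 3] leaf[of 5 2 4] leaf[of 2 3 5] b n sym[of 5 2] sym[of 4 2] sym[of 5 3]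
      sym[of 3 2] sym[of 4 3] sym[of 5 4] by simp_all
  define b2 b3 b4 b5 where "b2 = A $ 1 $ 2" and "b3 = A $ 1 $ 3" and "b4 = A $ 1 $ 4" and "b5 = A $ 1 $ 5"
  have bn: "b2 \<noteq> 0" "b3 \<noteq> 0" "b4 \<noteq> 0" "b5 \<noteq> 0" using b by (auto simp: b2_def b3_def b4_def b5_def)
  \<comment> \<open>Supported on the 4-cycle 2-3-5-4 of leaves, with alternating signs so that each
    row is orthogonal to \<open>(b2, b3, b4, b5)\<close>.\<close>
  define X :: "real^5^5" where "X = vector [vector [0,0,0,0,0],
    vector [0, 0, b4 * b5, - (b3 * b5), 0], vector [0, b4 * b5, 0, 0, - (b2 * b4)],
    vector [0, - (b3 * b5), 0, 0, b2 * b3], vector [0, 0, - (b2 * b4), b2 * b3, 0]]"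
  show ?thesis
  proof (rule not_SSP_I[OF A, of X c])
    show "nonedge_part K14 X = X"
    proof (rule nonedge_part_fixed_5)
      show "transpose X = X" by (simp add: X_def entries_5)
      have "\<forall>i. X $ i $ i = 0" by (simp add: X_def forall_5)
      then show "X $ i $ i = 0" for i by blast
      have "\<forall>i. X $ 1 $ i = 0 \<and> X $ i $ 1 = 0" by (simp add: X_def forall_5)
      then show "X $ i $ j = 0" if "{i, j} \<in> K14" for i j using that K by auto
    qed
    have "X $ 2 $ 3 \<noteq> 0" using bn by (simp add: X_def)
    then show "X \<noteq> 0" by auto
    show "A ** X = c *\<^sub>R X"
      using d n sym[of 5 2] sym[of 4 2] sym[of 5 3] sym[of 3 2] sym[of 4 3] sym[of 5 4]
      by (simp add: vec_eq_iff forall_5 matrix_matrix_mult_def sum_5 X_def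
          b2_def[symmetric] b3_def[symmetric] b4_def[symmetric] b5_def[symmetric])
  qed
qed

text \<open>The vectors of 2 and 3 are parallel, both being orthogonal to that of 4, so some
  \<open>y\<close> on \<open>{2, 3}\<close> is an eigenvector to \<open>c\<close>; likewise some
  \<open>z\<close> on \<open>{4, 5}\<close>. The matrix \<open>y z^T + z y^T\<close> lives on the
  nonedges between these pairs.\<close>

lemma Bfly_1_1_3_not_SSP:
  assumes A: "A \<in> schroedinger Bfly" and spec: "has_spectrum A ls [1, 1, 3]"
  shows "\<not> SSP A"
proof -
  from gram_1_1_3[OF A spec] obtain c u v
    where uv: "\<And>i j. A $ i $ j = (if i = j then c else 0) - (u i * u j + v i * v j)" by blast
  note e = schroedinger_edge[OF A] and n = schroedinger_nonedge[OF A]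
  have E: "A $ 2 $ 4 = 0" "A $ 2 $ 5 = 0" "A $ 3 $ 4 = 0" "A $ 3 $ 5 = 0"
    "A $ 1 $ 2 < 0" "A $ 1 $ 3 < 0" "A $ 1 $ 4 < 0" "A $ 1 $ 5 < 0"
    by (simp_all add: e n Bfly_def doubleton_eq_iff)
  define q where "q i j = u i * u j + v i * v j" for i j
  have z: "q 2 4 = 0" "q 2 5 = 0" "q 3 4 = 0" "q 3 5 = 0" and
    pos: "q 1 2 > 0" "q 1 3 > 0" "q 1 4 > 0" "q 1 5 > 0"
    using E uv by (simp_all add: q_def)
  have qsym: "q i j = q j i" for i j by (simp add: q_def)
  have Aq: "A $ i $ j = (if i = j then c else 0) - q i j" for i j by (simp add: uv q_def)
  have par: "q l i * q 1 j = q l j * q 1 i" if "q 1 i > 0" "q 1 k > 0" "q i k = 0" "q j k = 0" for i j k l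
  proof -
    have "u k \<noteq> 0 \<or> v k \<noteq> 0" using that by (auto simp: q_def)
    moreover have "u k * (u i * v j - u j * v i) = 0" "v k * (u i * v j - u j * v i) = 0"
      using that(3,4) unfolding q_def by algebra+
    ultimately have "u i * v j - u j * v i = 0" by auto
    then show ?thesis unfolding q_def by algebra
  qed
  have p23: "q l 2 * q 1 3 = q l 3 * q 1 2" for l by (rule par[of 2 4]) (use pos z in auto)
  have p45: "q l 4 * q 1 5 = q l 5 * q 1 4" for l
    by (rule par[of 4 2]) (use pos z qsym[of 4 2] qsym[of 5 2] in auto)
  define y2 y3 y4 y5 where "y2 = q 1 3" and "y3 = - q 1 2" and "y4 = q 1 5" and "y5 = - q 1 4"
  have P: "q l 2 * y2 + q l 3 * y3 = 0" "q l 4 * y4 + q l 5 * y5 = 0" for l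
    using p23[of l] p45[of l] by (simp_all add: y2_def y3_def y4_def y5_def)
  define X :: "real^5^5" where "X = vector [vector [0,0,0,0,0],
    vector [0, 0, 0, y2 * y4, y2 * y5], vector [0, 0, 0, y3 * y4, y3 * y5],
    vector [0, y2 * y4, y3 * y4, 0, 0], vector [0, y2 * y5, y3 * y5, 0, 0]]"
  show ?thesis
  proof (rule not_SSP_I[OF A, of X c])
    show "nonedge_part Bfly X = X"
    proof (rule nonedge_part_fixed_5)
      show "transpose X = X" by (simp add: X_def entries_5)
      have "\<forall>i. X $ i $ i = 0" by (simp add: X_def forall_5)
      then show "X $ i $ i = 0" for i by blast
      show "X $ i $ j = 0" if "{i, j} \<in> Bfly" for i j
        using that by (auto simp: Bfly_def doubleton_eq_iff X_def)
    qed
    have "X $ 2 $ 4 \<noteq> 0" using pos by (simp add: X_def y2_def y4_def)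
    then show "X \<noteq> 0" by auto
    have "A $ i $ 2 * y2 + A $ i $ 3 * y3 = c * (if i = 2 then y2 else if i = 3 then y3 else 0)"
      "A $ i $ 4 * y4 + A $ i $ 5 * y5 = c * (if i = 4 then y4 else if i = 5 then y5 else 0)" for i
      using P[of i] by (auto simp: Aq algebra_simps)
    note R = this
    have R1: "A $ i $ 2 * (y2 * t) + A $ i $ 3 * (y3 * t) = c * ((if i = 2 then y2 else if i = 3 then y3 else 0) * t)"
      "A $ i $ 4 * (y4 * t) + A $ i $ 5 * (y5 * t) = c * ((if i = 4 then y4 else if i = 5 then y5 else 0) * t)" for i t
      using arg_cong[OF R(1)[of i], of "\<lambda>x. x * t"] arg_cong[OF R(2)[of i], of "\<lambda>x. x * t"]
      by (simp_all add: algebra_simps)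
    have R2: "A $ i $ 4 * (t * y4) + A $ i $ 5 * (t * y5) = c * (t * (if i = 4 then y4 else if i = 5 then y5 else 0))" for i t
      using R1(2)[of i t] by (simp add: mult.commute[of t])
    show "A ** X = c *\<^sub>R X"
      by (simp add: vec_eq_iff forall_5 matrix_matrix_mult_def sum_5 X_def R1 R2)
  qed
qed

section \<open>Spectrally arbitrary lists\<close>

lemma spectrally_arbitrary_supergraph:
  "spectrally_arbitrary_SSP G ms \<Longrightarrow> G \<subseteq> H \<Longrightarrow> spectrally_arbitrary_SSP H ms"
  unfolding spectrally_arbitrary_SSP_def using supergraph_SSP by metis

section \<open>Graphs containing a relabelled copy of a sparse graph\<close>

lemma relabel_SSP:
  fixes A :: "real^'n^'n" and p :: "'n \<Rightarrow> 'n"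
  assumes A: "A \<in> schroedinger G" "SSP A" "has_spectrum A ls ms" and p: "bij p"
    and H: "\<And>i j. {i, j} \<in> H \<longleftrightarrow> {p i, p j} \<in> G"
  shows "\<exists>A'\<in>schroedinger H. SSP A' \<and> has_spectrum A' ls ms"
proof -
  define f where "f v = (\<chi> i. v $ p i)" for v :: "real^'n"
  define F where "F X = (\<chi> i j. X $ p i $ p j)" for X :: "real^'n^'n"
  define F' where "F' X = (\<chi> i j. X $ inv p i $ inv p j)" for X :: "real^'n^'n"
  have pp: "p (inv p i) = i" "inv p (p i) = i" "p i = p j \<longleftrightarrow> i = j" for i j
    using p by (simp_all add: bij_is_surj surj_f_inv_f bij_is_inj inv_f_f inj_eq)
  have reindex: "(\<Sum>k\<in>UNIV. g (p k)) = (\<Sum>k\<in>UNIV. g k)" for g :: "'n \<Rightarrow> real"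
    using p by (intro sum.reindex_bij_betw)
  have sym: "A $ i $ j = A $ j $ i" for i j
    using A schroedinger_symmetric symmetric_entry by blast
  have FA: "F A \<in> schroedinger H"
    using A(1) by (auto simp: schroedinger_def F_def vec_eq_iff transpose_def H pp sym)
  moreover have "SSP (F A)"
    unfolding SSP_iff_nonedge_part[OF FA]
  proof (intro allI impI)
    fix X assume X: "nonedge_part H X = X \<and> F A ** X = X ** F A"
    have "nonedge_part G (F' X) = F' (nonedge_part H X)"
      by (auto simp: nonedge_part_def F'_def vec_eq_iff H pp) (metis pp(1))+
    moreover have "A ** F' X = F' X ** A"
    proof -
      have "F (A ** F' X) = F A ** X" "F (F' X ** A) = X ** F A"
        unfolding F_def F'_def matrix_matrix_mult_def
        by (simp_all add: vec_eq_iff pp flip: reindex[of "\<lambda>k. A $ p _ $ k * X $ inv p k $ _"]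
            reindex[of "\<lambda>k. X $ _ $ inv p k * A $ k $ p _"])
      then have "F (A ** F' X) $ inv p i $ inv p j = F (F' X ** A) $ inv p i $ inv p j" for i j
        using X by simp
      then show ?thesis by (simp add: vec_eq_iff F_def pp)
    qed
    ultimately have "F' X = 0" using A(2) X SSP_iff_nonedge_part[OF A(1)] by metis
    then have "F' X $ p i $ p j = 0" for i j by simp
    then show "X = 0" by (simp add: F'_def pp vec_eq_iff)
  qed
  moreover have "has_spectrum (F A) ls ms"
  proof (rule has_spectrum_linear_iso[where f = f, OF A(3)])
    show "linear f" by (auto intro!: linearI simp: f_def vec_eq_iff)
    show "bij f"
      by (rule o_bij[of "\<lambda>v. \<chi> i. v $ inv p i"]) (auto simp: fun_eq_iff f_def vec_eq_iff pp)
    show "F A *v f v = f (A *v v)" for v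
      using reindex[of "\<lambda>k. A $ p _ $ k * v $ k"]
      by (simp add: vec_eq_iff F_def f_def matrix_vector_mult_def)
  qed
  ultimately show ?thesis by blast
qed

lemma spectrally_arbitrary_embed:
  fixes p :: "'n::finite \<Rightarrow> 'n"
  assumes G: "spectrally_arbitrary_SSP G ms" and p: "inj p" and H: "\<forall>e\<in>G. p ` e \<in> H"
  shows "spectrally_arbitrary_SSP H ms"
proof -
  have bij: "bij p" using p by (simp add: bij_def finite_UNIV_inj_surj)
  define q where "q = inv p"
  have q: "bij q" "p (q i) = i" for i
    using bij by (simp_all add: q_def bij_imp_bij_inv bij_is_surj surj_f_inv_f)
  define H' where "H' = {{i, j} | i j. {q i, q j} \<in> G}"
  have H': "{i, j} \<in> H' \<longleftrightarrow> {q i, q j} \<in> G" for i j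
    unfolding H'_def by (auto simp: doubleton_eq_iff insert_commute)
  have "spectrally_arbitrary_SSP H' ms"
    using G relabel_SSP[OF _ _ _ q(1), of _ G _ _ H', OF _ _ _ H']
    unfolding spectrally_arbitrary_SSP_def by metis
  moreover have "H' \<subseteq> H"
  proof
    fix e assume "e \<in> H'"
    then obtain i j where "e = {i, j}" "{q i, q j} \<in> G" by (auto simp: H'_def)
    then show "e \<in> H" using H q by force
  qed
  ultimately show ?thesis by (rule spectrally_arbitrary_supergraph)
qed

text \<open>In the applications below, the vertices given after \<open>of\<close> are the images of
  1, 2, 3, 4, 5, in this order.\<close>

lemma spectrally_arbitrary_embed_5:
  fixes a b c d e :: 5
  assumes "spectrally_arbitrary_SSP G ms" "distinct [a, b, c, d, e]"
    and "\<forall>x\<in>G. (\<lambda>i. vector [a, b, c, d, e] $ (i :: 5)) ` x \<in> H"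
  shows "spectrally_arbitrary_SSP H ms"
proof (rule spectrally_arbitrary_embed[OF assms(1) _ assms(3)])
  have "\<forall>i j. vector [a, b, c, d, e] $ (i :: 5) = (vector [a, b, c, d, e] $ j :: 5) \<longrightarrow> i = j"
    using assms(2) by (simp add: forall_5 eq_commute)
  then show "inj (\<lambda>i. vector [a, b, c, d, e] $ (i :: 5) :: 5)" by (simp add: inj_def)
qed

lemma spectrally_arbitrary_allowed:
  assumes "spectrally_arbitrary_SSP G ms"
  shows "allowed G ms"
proof -
  have "sorted_wrt (<) (map real [0..<length ms])"
    by (simp add: sorted_wrt_map)
  then show ?thesis using assms
    unfolding spectrally_arbitrary_SSP_def allowed_def has_ordered_mult_list_def
    by (metis length_map length_upt diff_zero)
qed

lemma spectrally_arbitrary_2I: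
  assumes "\<And>a b. a < b \<Longrightarrow> \<exists>A\<in>schroedinger G. SSP A \<and> has_spectrum A [a, b] [m1, m2]"
  shows "spectrally_arbitrary_SSP G [m1, m2]"
  using assms by (auto simp: spectrally_arbitrary_SSP_def length_Suc_conv)

lemma spectrally_arbitrary_3I:
  assumes "\<And>a b c. a < b \<Longrightarrow> b < c \<Longrightarrow> \<exists>A\<in>schroedinger G. SSP A \<and> has_spectrum A [a, b, c] [m1, m2, m3]"
  shows "spectrally_arbitrary_SSP G [m1, m2, m3]"
  using assms by (auto simp: spectrally_arbitrary_SSP_def length_Suc_conv)

lemma spectrally_arbitrary_4I:
  assumes "\<And>a b c d. a < b \<Longrightarrow> b < c \<Longrightarrow> c < d \<Longrightarrow>
    \<exists>A\<in>schroedinger G. SSP A \<and> has_spectrum A [a, b, c, d] [m1, m2, m3, m4]"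
  shows "spectrally_arbitrary_SSP G [m1, m2, m3, m4]"
  using assms by (auto simp: spectrally_arbitrary_SSP_def length_Suc_conv)

lemma spectrally_arbitrary_5I:
  assumes "\<And>a b c d e. a < b \<Longrightarrow> b < c \<Longrightarrow> c < d \<Longrightarrow> d < e \<Longrightarrow>
    \<exists>A\<in>schroedinger G. SSP A \<and> has_spectrum A [a, b, c, d, e] [m1, m2, m3, m4, m5]"
  shows "spectrally_arbitrary_SSP G [m1, m2, m3, m4, m5]"
  using assms by (auto simp: spectrally_arbitrary_SSP_def length_Suc_conv)

lemma spectrally_arbitrary_11111: "spectrally_arbitrary_SSP (G :: graph5) [1,1,1,1,1]"
proof -
  have "spectrally_arbitrary_SSP ({} :: graph5) [1,1,1,1,1]"
  proof (rule spectrally_arbitrary_5I)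
    fix a b c d e :: real assume "a < b" "b < c" "c < d" "d < e"
    then show "\<exists>A\<in>schroedinger ({} :: graph5). SSP A \<and> has_spectrum A [a, b, c, d, e] [1,1,1,1,1]"
      using diagonal_SSP[of a b c d e "[a, b, c, d, e]"] by auto
  qed
  then show ?thesis by (rule spectrally_arbitrary_supergraph) simp
qed

text \<open>The double eigenvalue of the star lies between its two simple ones. The isolated vertex
  carries the largest eigenvalue for 1211 and the smallest for 1121.\<close>

lemma spectrally_arbitrary_K13:
  "spectrally_arbitrary_SSP ({{1,2},{1,3},{1,4}} :: graph5) [1,2,1,1]"
  "spectrally_arbitrary_SSP ({{1,2},{1,3},{1,4}} :: graph5) [1,1,2,1]"
proof (rule_tac [!] spectrally_arbitrary_4I)
  fix a b c d :: real assume *: "a < b" "b < c" "c < d"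
  show "\<exists>A\<in>schroedinger ({{1,2},{1,3},{1,4}} :: graph5). SSP A \<and> has_spectrum A [a, b, c, d] [1,2,1,1]"
    using K13_SSP[of a b c d "[a, b, c, d]"] * by (simp add: eval_nat_numeral insert_commute)
  show "\<exists>A\<in>schroedinger ({{1,2},{1,3},{1,4}} :: graph5). SSP A \<and> has_spectrum A [a, b, c, d] [1,1,2,1]"
    using K13_SSP[of b c d a "[a, b, c, d]"] * by (simp add: eval_nat_numeral insert_commute)
qed

lemma spectrally_arbitrary_K3:
  "spectrally_arbitrary_SSP ({{1,2},{1,3},{2,3}} :: graph5) [1,2,1,1]"
  "spectrally_arbitrary_SSP ({{1,2},{1,3},{2,3}} :: graph5) [1,1,2,1]"
  "spectrally_arbitrary_SSP ({{1,2},{1,3},{2,3}} :: graph5) [1,1,1,2]"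
proof (rule_tac [!] spectrally_arbitrary_4I)
  fix a b c d :: real assume *: "a < b" "b < c" "c < d"
  show "\<exists>A\<in>schroedinger ({{1,2},{1,3},{2,3}} :: graph5). SSP A \<and> has_spectrum A [a, b, c, d] [1,2,1,1]"
    using K3_SSP[of a b c d "[a, b, c, d]"] * by (simp add: eval_nat_numeral insert_commute)
  show "\<exists>A\<in>schroedinger ({{1,2},{1,3},{2,3}} :: graph5). SSP A \<and> has_spectrum A [a, b, c, d] [1,1,2,1]"
    using K3_SSP[of a c b d "[a, b, c, d]"] * by (simp add: eval_nat_numeral insert_commute)
  show "\<exists>A\<in>schroedinger ({{1,2},{1,3},{2,3}} :: graph5). SSP A \<and> has_spectrum A [a, b, c, d] [1,1,1,2]"
    using K3_SSP[of a d b c "[a, b, c, d]"] * by (simp add: eval_nat_numeral insert_commute)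
qed

lemma spectrally_arbitrary_K4:
  "spectrally_arbitrary_SSP ({{1,2},{1,3},{1,4},{2,3},{2,4},{3,4}} :: graph5) [1,3,1]"
  "spectrally_arbitrary_SSP ({{1,2},{1,3},{1,4},{2,3},{2,4},{3,4}} :: graph5) [1,1,3]"
proof (rule_tac [!] spectrally_arbitrary_3I)
  fix a b c :: real assume *: "a < b" "b < c"
  show "\<exists>A\<in>schroedinger ({{1,2},{1,3},{1,4},{2,3},{2,4},{3,4}} :: graph5). SSP A \<and> has_spectrum A [a, b, c] [1,3,1]"
    using K4_SSP[of a b c "[a, b, c]"] * by (simp add: eval_nat_numeral insert_commute)
  show "\<exists>A\<in>schroedinger ({{1,2},{1,3},{1,4},{2,3},{2,4},{3,4}} :: graph5). SSP A \<and> has_spectrum A [a, b, c] [1,1,3]"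
    using K4_SSP[of a c b "[a, b, c]"] * by (simp add: eval_nat_numeral insert_commute)
qed

lemma spectrally_arbitrary_K5: "spectrally_arbitrary_SSP K5 [1,4]"
proof (rule spectrally_arbitrary_2I)
  fix a b :: real assume *: "a < b"
  show "\<exists>A\<in>schroedinger K5. SSP A \<and> has_spectrum A [a, b] [1,4]"
    using K5_SSP[of a b] * by (simp add: eval_nat_numeral insert_commute)
qed

lemma spectrally_arbitrary_Camp: "spectrally_arbitrary_SSP Camp [1,2,2]"
proof (rule spectrally_arbitrary_3I)
  fix a b c :: real assume *: "a < b" "b < c"
  show "\<exists>A\<in>schroedinger Camp. SSP A \<and> has_spectrum A [a, b, c] [1,2,2]"
    using Camp_SSP[of a b c] * by (simp add: eval_nat_numeral insert_commute)
qed

lemma spectrally_arbitrary_K23: "spectrally_arbitrary_SSP K23 [1,3,1]"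
proof (rule spectrally_arbitrary_3I)
  fix a b c :: real assume *: "a < b" "b < c"
  show "\<exists>A\<in>schroedinger K23. SSP A \<and> has_spectrum A [a, b, c] [1,3,1]"
    using K23_SSP[of a b c] * by (simp add: eval_nat_numeral insert_commute)
qed

lemma spectrally_arbitrary_C5:
  "spectrally_arbitrary_SSP C5 [1,2,1,1]" "spectrally_arbitrary_SSP C5 [1,1,1,2]"
  "spectrally_arbitrary_SSP C5 [1,2,2]"
proof -
  show "spectrally_arbitrary_SSP C5 [1,2,1,1]" "spectrally_arbitrary_SSP C5 [1,1,1,2]"
  proof (rule_tac [!] spectrally_arbitrary_4I)
    fix a b c d :: real assume *: "a < b" "b < c" "c < d"
    show "\<exists>A\<in>schroedinger C5. SSP A \<and> has_spectrum A [a, b, c, d] [1,2,1,1]"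
      using C5_SSP[of a b b c d "[a, b, c, d]"] * by (simp add: eval_nat_numeral insert_commute)
    show "\<exists>A\<in>schroedinger C5. SSP A \<and> has_spectrum A [a, b, c, d] [1,1,1,2]"
      using C5_SSP[of a b c d d "[a, b, c, d]"] * by (simp add: eval_nat_numeral insert_commute)
  qed
  show "spectrally_arbitrary_SSP C5 [1,2,2]"
  proof (rule spectrally_arbitrary_3I)
    fix a b c :: real assume *: "a < b" "b < c"
    show "\<exists>A\<in>schroedinger C5. SSP A \<and> has_spectrum A [a, b, c] [1,2,2]"
      using C5_SSP[of a b b c c "[a, b, c]"] * by (simp add: eval_nat_numeral insert_commute)
  qed
qed

section \<open>The twenty-one graphs\<close>

text \<open>A spanning tree grown from \<open>p\<close>: each \<open>q\<close> vertex is joined to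
  an earlier one.\<close>

lemma connected_edges_5I:
  fixes G :: graph5
  assumes e: "{p, q1} \<in> G" "{r2, q2} \<in> G" "{r3, q3} \<in> G" "{r4, q4} \<in> G"
    and r: "r2 \<in> {p, q1}" "r3 \<in> {p, q1, q2}" "r4 \<in> {p, q1, q2, q3}" and V: "\<forall>x. x \<in> {p, q1, q2, q3, q4}"
  shows "connected_edges G"
  unfolding connected_edges_def
proof (intro allI impI)
  fix S assume "S \<noteq> {}" and cl: "\<forall>i\<in>S. \<forall>j. {i, j} \<in> G \<longrightarrow> j \<in> S"
  then obtain x where "x \<in> S" by blast
  have cl': "{i, j} \<in> G \<Longrightarrow> i \<in> S \<longleftrightarrow> j \<in> S" for i j using cl by (metis insert_commute)
  have "x \<in> {p, q1, q2, q3, q4}" using V by blast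
  then have "p \<in> S" using \<open>x \<in> S\<close> cl'[OF e(1)] cl'[OF e(2)] cl'[OF e(3)] cl'[OF e(4)] r by auto
  then have "{p, q1, q2, q3, q4} \<subseteq> S" using cl'[OF e(1)] cl'[OF e(2)] cl'[OF e(3)] cl'[OF e(4)] r by auto
  then show "S = UNIV" using V by auto
qed

lemma K14_edge_iff: "{i, j} \<in> K14 \<longleftrightarrow> i = 1 \<and> j \<in> {2,3,4,5} \<or> j = 1 \<and> i \<in> {2,3,4,5}"
  unfolding K14_def by (auto simp: doubleton_eq_iff)

lemma K23_edge_iff: "{i, j} \<in> K23 \<longleftrightarrow> i \<in> {1,2} \<and> j \<in> {3,4,5} \<or> j \<in> {1,2} \<and> i \<in> {3,4,5}"
  unfolding K23_def by (auto simp: doubleton_eq_iff)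

lemma K23_Ball: "(\<forall>e\<in>K23. P e) \<longleftrightarrow> (\<forall>i\<in>{1,2}. \<forall>j\<in>{3,4,5}. P {i, j})"
  unfolding K23_def by blast

lemma K5_edge_iff: "{i, j} \<in> K5 \<longleftrightarrow> i \<noteq> j"
  unfolding K5_def by (auto simp: doubleton_eq_iff)

lemma K5_minus_e_edge_iff: "{i, j} \<in> K5_minus_e \<longleftrightarrow> i \<noteq> j \<and> {i, j} \<noteq> {1, 2}"
  unfolding K5_minus_e_def by (simp add: K5_edge_iff)

lemmas graph_defs = P5_def S211_def L32_def Bull_def C5_def Camp_def Bnr_def Dart_def Kite_def Hs_def
  Gem_def Bfly_def T5_def L41_def K4e_def W5_def FHs_def
  K14_edge_iff K23_edge_iff K5_edge_iff K5_minus_e_edge_iff doubleton_eq_iff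

definition classified :: "graph5 \<Rightarrow> nat list set \<Rightarrow> nat list set \<Rightarrow> bool" where
  "classified G L N \<longleftrightarrow> {ms. allowed G ms} = L \<union> N \<and>
    (\<forall>ms\<in>L. spectrally_arbitrary_SSP G ms) \<and>
    (\<forall>ms\<in>N. \<forall>A\<in>schroedinger G. has_ordered_mult_list A ms \<longrightarrow> \<not> SSP A)"

text \<open>Connectedness leaves eight candidates, so only the candidates outside both given sets
  remain to be excluded.\<close>

lemma classifiedI:
  assumes conn: "connected_edges G"
    and L: "\<And>ms. ms \<in> L \<Longrightarrow> spectrally_arbitrary_SSP G ms"
    and N: "\<And>ms. ms \<in> N \<Longrightarrow> allowed G ms"
      "\<And>ms A ls. ms \<in> N \<Longrightarrow> A \<in> schroedinger G \<Longrightarrow> has_spectrum A ls ms \<Longrightarrow> \<not> SSP A"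
    and excluded: "\<And>ms A ls.
      ms \<in> {[1,1,1,1,1], [1,2,1,1], [1,1,2,1], [1,1,1,2], [1,2,2], [1,3,1], [1,1,3], [1,4]} - (L \<union> N) \<Longrightarrow>
      A \<in> schroedinger G \<Longrightarrow> has_spectrum A ls ms \<Longrightarrow> False"
  shows "classified G L N"
proof -
  have "ms \<in> L \<union> N" if "allowed G ms" for ms
    using that has_spectrum_connected_5[OF _ conn] excluded
    unfolding allowed_def has_ordered_mult_list_def by blast
  moreover have "allowed G ms" if "ms \<in> L \<union> N" for ms
    using that L N(1) spectrally_arbitrary_allowed by blast
  ultimately show ?thesis
    using L N(2) unfolding classified_def has_ordered_mult_list_def by blast
qed

lemma K14_1_3_1_allowed: "allowed K14 [1,3,1]"
proof -
  define A :: "real^5^5" where "A = vector [vector [0,-1,-1,-1,-1], vector [-1,0,0,0,0],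
    vector [-1,0,0,0,0], vector [-1,0,0,0,0], vector [-1,0,0,0,0]]"
  have sym: "transpose A = A" by (simp add: A_def entries_5)
  have "A \<in> schroedinger K14"
    by (rule schroedinger_5I[OF sym]) (simp_all add: A_def graph_defs)
  moreover have "has_spectrum A [-2, 0, 2] (map (count_list [-2, 2, 0, 0, 0 :: real]) [-2, 0, 2])"
    by (rule has_spectrum_5I[OF sym, where ?v1.0="vector [2,1,1,1,1]" and ?v2.0="vector [2,-1,-1,-1,-1]"
          and ?v3.0="vector [0,1,-1,0,0]" and ?v4.0="vector [0,1,1,-2,0]" and ?v5.0="vector [0,1,1,1,-3]"])
      (simp_all add: A_def entries_5 insert_commute)
  then have "has_spectrum A [-2, 0, 2] [1,3,1]" by (simp add: eval_nat_numeral)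
  ultimately show ?thesis unfolding allowed_def has_ordered_mult_list_def by blast
qed

lemma Bfly_1_1_3_allowed: "allowed Bfly [1,1,3]"
proof -
  \<comment> \<open>Minus the Gram matrix of the plane vectors (1,1), (1,0), (1,0), (0,1),
    (0,1).\<close>
  define A :: "real^5^5" where "A = vector [vector [-2,-1,-1,-1,-1], vector [-1,-1,-1,0,0],
    vector [-1,-1,-1,0,0], vector [-1,0,0,-1,-1], vector [-1,0,0,-1,-1]]"
  have sym: "transpose A = A" by (simp add: A_def entries_5)
  have "A \<in> schroedinger Bfly"
    by (rule schroedinger_5I[OF sym]) (simp_all add: A_def graph_defs)
  moreover have "has_spectrum A [-4, -2, 0] (map (count_list [-4, -2, 0, 0, 0 :: real]) [-4, -2, 0])"
    by (rule has_spectrum_5I[OF sym, where ?v1.0="vector [2,1,1,1,1]" and ?v2.0="vector [0,1,1,-1,-1]"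
          and ?v3.0="vector [0,1,-1,0,0]" and ?v4.0="vector [0,0,0,1,-1]" and ?v5.0="vector [-2,1,1,1,1]"])
      (simp_all add: A_def entries_5)
  then have "has_spectrum A [-4, -2, 0] [1,1,3]" by (simp add: eval_nat_numeral)
  ultimately show ?thesis unfolding allowed_def has_ordered_mult_list_def by blast
qed

text \<open>Zero forcing from the single end vertex 1.\<close>

lemma P5_multiplicity_1:
  assumes A: "A \<in> schroedinger P5" and "has_spectrum A ls ms" "m \<in> set ms"
  shows "m \<le> 1"
proof -
  note e = schroedinger_edge[OF A] and n = schroedinger_nonedge[OF A]
  have a: "A $ 1 $ 2 < 0" "A $ 2 $ 3 < 0" "A $ 3 $ 4 < 0" "A $ 4 $ 5 < 0"
    "A $ 1 $ 3 = 0" "A $ 1 $ 4 = 0" "A $ 1 $ 5 = 0" "A $ 2 $ 4 = 0" "A $ 2 $ 5 = 0" "A $ 3 $ 5 = 0"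
    by (simp_all add: e n graph_defs)
  have "v = 0" if v: "A *v v = c *\<^sub>R v" "v $ 1 = 0" for v c
  proof -
    note r = eigenvector_rows_5[OF v(1)]
    have 2: "v $ 2 = 0" using r[of 1] v(2) a by simp
    have 3: "v $ 3 = 0" using r[of 2] v(2) 2 a by simp
    have 4: "v $ 4 = 0" using r[of 3] v(2) 2 3 a by simp
    have 5: "v $ 5 = 0" using r[of 4] v(2) 2 3 4 a by simp
    show ?thesis using v(2) 2 3 4 5 by (rule vec5_eq_0I)
  qed
  then have "multiplicity_of A c \<le> card {1 :: 5}" for c
    by (intro multiplicity_le_card_determining) blast
  then show ?thesis using assms(2,3) by (auto simp: has_spectrum_def)
qed

lemma P5_classified: "classified P5 {[1,1,1,1,1]} {}"
proof (rule classifiedI)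
  show "connected_edges P5"
    by (rule connected_edges_5I[of 1 2 _ 2 3 3 4 4 5]) (simp_all add: graph_defs forall_5)
  show "spectrally_arbitrary_SSP P5 ms" if "ms \<in> {[1,1,1,1,1]}" for ms
    using that spectrally_arbitrary_11111 by auto
next
  fix ms A ls
  assume ms: "ms \<in> {[1,1,1,1,1], [1,2,1,1], [1,1,2,1], [1,1,1,2], [1,2,2], [1,3,1], [1,1,3], [1,4]} -
    ({[1,1,1,1,1]} \<union> {})"
    and A: "A \<in> schroedinger P5" and spec: "has_spectrum A ls ms"
  have zf: "\<forall>m\<in>set ms. m \<le> 1" using P5_multiplicity_1[OF A spec] by blast
  show False using ms spec zf by auto
qed simp_all

text \<open>Zero forcing bounds multiplicities by 2; the colour classes \<open>{1, 3}\<close> and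
  \<open>{2, 4, 5}\<close> make the last multiplicity 1.\<close>

lemma S211_classified: "classified S211 {[1,1,1,1,1], [1,2,1,1], [1,1,2,1]} {}"
proof (rule classifiedI)
  show "connected_edges S211"
    by (rule connected_edges_5I[of 1 2 _ 2 3 3 4 3 5]) (simp_all add: graph_defs forall_5)
  have s1: "spectrally_arbitrary_SSP S211 [1,2,1,1]"
    by (rule spectrally_arbitrary_embed_5[OF spectrally_arbitrary_K13(1), of 3 2 4 5 1]) (simp_all add: graph_defs)
  have s2: "spectrally_arbitrary_SSP S211 [1,1,2,1]"
    by (rule spectrally_arbitrary_embed_5[OF spectrally_arbitrary_K13(2), of 3 2 4 5 1]) (simp_all add: graph_defs)
  show "spectrally_arbitrary_SSP S211 ms" if "ms \<in> {[1,1,1,1,1], [1,2,1,1], [1,1,2,1]}" for ms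
    using that s1 s2 spectrally_arbitrary_11111 by auto
next
  fix ms A ls
  assume ms: "ms \<in> {[1,1,1,1,1], [1,2,1,1], [1,1,2,1], [1,1,1,2], [1,2,2], [1,3,1], [1,1,3], [1,4]} -
    ({[1,1,1,1,1], [1,2,1,1], [1,1,2,1]} \<union> {})"
    and A: "A \<in> schroedinger S211" and spec: "has_spectrum A ls ms"
  \<comment> \<open>Arguments in the order \<open>p q x1 x2 x3 r1 r2 r3\<close>: starting from 1 and
    4, vertex 1 forces 2, 2 forces 3, and 3 forces 5.\<close>
  have zf: "\<forall>m\<in>set ms. m \<le> card {1, 4 :: 5}"
    by (rule ballI, rule zero_forcing_5[OF A spec, of 1 4 2 3 5 1 2 3])
      (auto simp: graph_defs forall_5)
  have "s \<noteq> t" if "{i, j} \<in> S211" "s = (i \<in> {1,3})" "t = (j \<in> {1,3})" for i j s t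
    using that by (auto simp: graph_defs)
  then have "\<exists>ms'. ms = ms' @ [1]"
    by (intro largest_eigenvalue_simple_bipartite[OF A _ spec, of "\<lambda>i. i \<in> {1,3}"]
        connected_edges_5I[of 1 2 _ 2 3 3 4 3 5]) (simp_all add: graph_defs forall_5)
  then have bip: "last ms = 1" by auto
  show False using ms spec zf bip by auto
qed simp_all

lemma K14_classified: "classified K14 {[1,1,1,1,1], [1,2,1,1], [1,1,2,1]} {[1,3,1]}"
proof (rule classifiedI)
  show "connected_edges K14"
    by (rule connected_edges_5I[of 1 2 _ 1 3 1 4 1 5]) (simp_all add: graph_defs forall_5)
  have s1: "spectrally_arbitrary_SSP K14 [1,2,1,1]"
    by (rule spectrally_arbitrary_embed_5[OF spectrally_arbitrary_K13(1), of 1 2 3 4 5]) (simp_all add: graph_defs)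
  have s2: "spectrally_arbitrary_SSP K14 [1,1,2,1]"
    by (rule spectrally_arbitrary_embed_5[OF spectrally_arbitrary_K13(2), of 1 2 3 4 5]) (simp_all add: graph_defs)
  show "spectrally_arbitrary_SSP K14 ms" if "ms \<in> {[1,1,1,1,1], [1,2,1,1], [1,1,2,1]}" for ms
    using that s1 s2 spectrally_arbitrary_11111 by auto
  show "allowed K14 ms" if "ms \<in> {[1,3,1]}" for ms using that K14_1_3_1_allowed by auto
  show "\<not> SSP A" if "ms \<in> {[1,3,1]}" "A \<in> schroedinger K14" "has_spectrum A ls ms" for ms A ls
    using that K14_1_3_1_not_SSP by auto
next
  fix ms A ls
  assume ms: "ms \<in> {[1,1,1,1,1], [1,2,1,1], [1,1,2,1], [1,1,1,2], [1,2,2], [1,3,1], [1,1,3], [1,4]} -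
    ({[1,1,1,1,1], [1,2,1,1], [1,1,2,1]} \<union> {[1,3,1]})"
    and A: "A \<in> schroedinger K14" and spec: "has_spectrum A ls ms"
  have "s \<noteq> t" if "{i, j} \<in> K14" "s = (i \<in> {1})" "t = (j \<in> {1})" for i j s t
    using that by (auto simp: graph_defs)
  then have "\<exists>ms'. ms = ms' @ [1]"
    by (intro largest_eigenvalue_simple_bipartite[OF A _ spec, of "\<lambda>i. i \<in> {1}"]
        connected_edges_5I[of 1 2 _ 1 3 1 4 1 5]) (simp_all add: graph_defs forall_5)
  then have bip: "last ms = 1" by auto
  have n14: "\<not> has_spectrum A ls [1,4]"
    by (rule not_1_4[OF A, of 2 3 1 1]) (simp_all add: graph_defs)
  show False using ms spec bip n14 by auto
qed

lemma L32_classified: "classified L32 {[1,1,1,1,1], [1,2,1,1], [1,1,2,1], [1,1,1,2]} {}"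
proof (rule classifiedI)
  show "connected_edges L32"
    by (rule connected_edges_5I[of 1 2 _ 2 3 3 4 4 5]) (simp_all add: graph_defs forall_5)
  have s1: "spectrally_arbitrary_SSP L32 [1,2,1,1]"
    by (rule spectrally_arbitrary_embed_5[OF spectrally_arbitrary_K3(1), of 3 4 5 1 2]) (simp_all add: graph_defs)
  have s2: "spectrally_arbitrary_SSP L32 [1,1,2,1]"
    by (rule spectrally_arbitrary_embed_5[OF spectrally_arbitrary_K3(2), of 3 4 5 1 2]) (simp_all add: graph_defs)
  have s3: "spectrally_arbitrary_SSP L32 [1,1,1,2]"
    by (rule spectrally_arbitrary_embed_5[OF spectrally_arbitrary_K3(3), of 3 4 5 1 2]) (simp_all add: graph_defs)
  show "spectrally_arbitrary_SSP L32 ms" if "ms \<in> {[1,1,1,1,1], [1,2,1,1], [1,1,2,1], [1,1,1,2]}" for ms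
    using that s1 s2 s3 spectrally_arbitrary_11111 by auto
next
  fix ms A ls
  assume ms: "ms \<in> {[1,1,1,1,1], [1,2,1,1], [1,1,2,1], [1,1,1,2], [1,2,2], [1,3,1], [1,1,3], [1,4]} -
    ({[1,1,1,1,1], [1,2,1,1], [1,1,2,1], [1,1,1,2]} \<union> {})"
    and A: "A \<in> schroedinger L32" and spec: "has_spectrum A ls ms"
  have zf: "\<forall>m\<in>set ms. m \<le> card {1, 4 :: 5}"
    by (rule ballI, rule zero_forcing_5[OF A spec, of 1 4 2 3 5 1 2 3])
      (auto simp: graph_defs forall_5)
  show False using ms spec zf L32_not_1_2_2[OF A, of ls] by auto
qed simp_all

lemma Bull_classified: "classified Bull {[1,1,1,1,1], [1,2,1,1], [1,1,2,1], [1,1,1,2]} {}"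
proof (rule classifiedI)
  show "connected_edges Bull"
    by (rule connected_edges_5I[of 1 2 _ 2 3 3 4 2 5]) (simp_all add: graph_defs forall_5)
  have s1: "spectrally_arbitrary_SSP Bull [1,2,1,1]"
    by (rule spectrally_arbitrary_embed_5[OF spectrally_arbitrary_K3(1), of 2 3 5 1 4]) (simp_all add: graph_defs)
  have s2: "spectrally_arbitrary_SSP Bull [1,1,2,1]"
    by (rule spectrally_arbitrary_embed_5[OF spectrally_arbitrary_K3(2), of 2 3 5 1 4]) (simp_all add: graph_defs)
  have s3: "spectrally_arbitrary_SSP Bull [1,1,1,2]"
    by (rule spectrally_arbitrary_embed_5[OF spectrally_arbitrary_K3(3), of 2 3 5 1 4]) (simp_all add: graph_defs)
  show "spectrally_arbitrary_SSP Bull ms" if "ms \<in> {[1,1,1,1,1], [1,2,1,1], [1,1,2,1], [1,1,1,2]}" for ms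
    using that s1 s2 s3 spectrally_arbitrary_11111 by auto
next
  fix ms A ls
  assume ms: "ms \<in> {[1,1,1,1,1], [1,2,1,1], [1,1,2,1], [1,1,1,2], [1,2,2], [1,3,1], [1,1,3], [1,4]} -
    ({[1,1,1,1,1], [1,2,1,1], [1,1,2,1], [1,1,1,2]} \<union> {})"
    and A: "A \<in> schroedinger Bull" and spec: "has_spectrum A ls ms"
  have zf: "\<forall>m\<in>set ms. m \<le> card {1, 4 :: 5}"
    by (rule ballI, rule zero_forcing_5[OF A spec, of 1 4 2 3 5 1 4 2])
      (auto simp: graph_defs forall_5)
  show False using ms spec zf Bull_not_1_2_2[OF A, of ls] by auto
qed simp_all

lemma C5_classified: "classified C5 {[1,1,1,1,1], [1,2,1,1], [1,1,1,2], [1,2,2]} {}"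
proof (rule classifiedI)
  show "connected_edges C5"
    by (rule connected_edges_5I[of 1 2 _ 2 3 3 4 4 5]) (simp_all add: graph_defs forall_5)
  show "spectrally_arbitrary_SSP C5 ms" if "ms \<in> {[1,1,1,1,1], [1,2,1,1], [1,1,1,2], [1,2,2]}" for ms
    using that spectrally_arbitrary_11111 spectrally_arbitrary_C5 by auto
next
  fix ms A ls
  assume ms: "ms \<in> {[1,1,1,1,1], [1,2,1,1], [1,1,2,1], [1,1,1,2], [1,2,2], [1,3,1], [1,1,3], [1,4]} -
    ({[1,1,1,1,1], [1,2,1,1], [1,1,1,2], [1,2,2]} \<union> {})"
    and A: "A \<in> schroedinger C5" and spec: "has_spectrum A ls ms"
  have zf: "\<forall>m\<in>set ms. m \<le> card {1, 2 :: 5}"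
    by (rule ballI, rule zero_forcing_5[OF A spec, of 1 2 5 3 4 1 2 3])
      (auto simp: graph_defs forall_5)
  show False using ms spec zf C5_not_1_1_2_1[OF A, of ls] by auto
qed simp_all

lemma Camp_classified: "classified Camp {[1,1,1,1,1], [1,2,1,1], [1,1,2,1], [1,1,1,2], [1,2,2]} {}"
proof (rule classifiedI)
  show "connected_edges Camp"
    by (rule connected_edges_5I[of 1 2 _ 1 3 1 4 1 5]) (simp_all add: graph_defs forall_5)
  have s1: "spectrally_arbitrary_SSP Camp [1,2,1,1]"
    by (rule spectrally_arbitrary_embed_5[OF spectrally_arbitrary_K3(1), of 1 2 3 4 5]) (simp_all add: graph_defs)
  have s2: "spectrally_arbitrary_SSP Camp [1,1,2,1]"
    by (rule spectrally_arbitrary_embed_5[OF spectrally_arbitrary_K3(2), of 1 2 3 4 5]) (simp_all add: graph_defs)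
  have s3: "spectrally_arbitrary_SSP Camp [1,1,1,2]"
    by (rule spectrally_arbitrary_embed_5[OF spectrally_arbitrary_K3(3), of 1 2 3 4 5]) (simp_all add: graph_defs)
  show "spectrally_arbitrary_SSP Camp ms" if "ms \<in> {[1,1,1,1,1], [1,2,1,1], [1,1,2,1], [1,1,1,2], [1,2,2]}" for ms
    using that s1 s2 s3 spectrally_arbitrary_11111 spectrally_arbitrary_Camp by auto
next
  fix ms A ls
  assume ms: "ms \<in> {[1,1,1,1,1], [1,2,1,1], [1,1,2,1], [1,1,1,2], [1,2,2], [1,3,1], [1,1,3], [1,4]} -
    ({[1,1,1,1,1], [1,2,1,1], [1,1,2,1], [1,1,1,2], [1,2,2]} \<union> {})"
    and A: "A \<in> schroedinger Camp" and spec: "has_spectrum A ls ms"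
  have zf: "\<forall>m\<in>set ms. m \<le> card {4, 2 :: 5}"
    by (rule ballI, rule zero_forcing_5[OF A spec, of 4 2 1 3 5 4 2 1])
      (auto simp: graph_defs forall_5)
  show False using ms spec zf by auto
qed simp_all

text \<open>As for \<open>S211\<close>: zero forcing from 1 and 3, and the colour classes
  \<open>{2, 4}\<close> and \<open>{1, 3, 5}\<close>.\<close>

lemma Bnr_classified: "classified Bnr {[1,1,1,1,1], [1,2,1,1], [1,1,2,1]} {}"
proof (rule classifiedI)
  show "connected_edges Bnr"
    by (rule connected_edges_5I[of 1 2 _ 2 3 3 4 4 5]) (simp_all add: graph_defs forall_5)
  have s1: "spectrally_arbitrary_SSP Bnr [1,2,1,1]"
    by (rule spectrally_arbitrary_embed_5[OF spectrally_arbitrary_K13(1), of 2 1 3 5 4]) (simp_all add: graph_defs)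
  have s2: "spectrally_arbitrary_SSP Bnr [1,1,2,1]"
    by (rule spectrally_arbitrary_embed_5[OF spectrally_arbitrary_K13(2), of 2 1 3 5 4]) (simp_all add: graph_defs)
  show "spectrally_arbitrary_SSP Bnr ms" if "ms \<in> {[1,1,1,1,1], [1,2,1,1], [1,1,2,1]}" for ms
    using that s1 s2 spectrally_arbitrary_11111 by auto
next
  fix ms A ls
  assume ms: "ms \<in> {[1,1,1,1,1], [1,2,1,1], [1,1,2,1], [1,1,1,2], [1,2,2], [1,3,1], [1,1,3], [1,4]} -
    ({[1,1,1,1,1], [1,2,1,1], [1,1,2,1]} \<union> {})"
    and A: "A \<in> schroedinger Bnr" and spec: "has_spectrum A ls ms"
  have zf: "\<forall>m\<in>set ms. m \<le> card {1, 3 :: 5}"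
    by (rule ballI, rule zero_forcing_5[OF A spec, of 1 3 2 4 5 1 3 4])
      (auto simp: graph_defs forall_5)
  have "s \<noteq> t" if "{i, j} \<in> Bnr" "s = (i \<in> {2,4})" "t = (j \<in> {2,4})" for i j s t
    using that by (auto simp: graph_defs)
  then have "\<exists>ms'. ms = ms' @ [1]"
    by (intro largest_eigenvalue_simple_bipartite[OF A _ spec, of "\<lambda>i. i \<in> {2,4}"]
        connected_edges_5I[of 1 2 _ 2 3 3 4 4 5]) (simp_all add: graph_defs forall_5)
  then have bip: "last ms = 1" by auto
  show False using ms spec zf bip by auto
qed simp_all

lemma Dart_classified: "classified Dart {[1,1,1,1,1], [1,2,1,1], [1,1,2,1], [1,1,1,2], [1,2,2]} {}"
proof (rule classifiedI)
  show "connected_edges Dart"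
    by (rule connected_edges_5I[of 1 2 _ 2 3 3 4 4 5]) (simp_all add: graph_defs forall_5)
  have s1: "spectrally_arbitrary_SSP Dart [1,2,1,1]"
    by (rule spectrally_arbitrary_embed_5[OF spectrally_arbitrary_K3(1), of 2 3 4 1 5]) (simp_all add: graph_defs)
  have s2: "spectrally_arbitrary_SSP Dart [1,1,2,1]"
    by (rule spectrally_arbitrary_embed_5[OF spectrally_arbitrary_K3(2), of 2 3 4 1 5]) (simp_all add: graph_defs)
  have s3: "spectrally_arbitrary_SSP Dart [1,1,1,2]"
    by (rule spectrally_arbitrary_embed_5[OF spectrally_arbitrary_K3(3), of 2 3 4 1 5]) (simp_all add: graph_defs)
  have s4: "spectrally_arbitrary_SSP Dart [1,2,2]"
    by (rule spectrally_arbitrary_embed_5[OF spectrally_arbitrary_Camp, of 2 3 4 1 5]) (simp_all add: graph_defs)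
  show "spectrally_arbitrary_SSP Dart ms" if "ms \<in> {[1,1,1,1,1], [1,2,1,1], [1,1,2,1], [1,1,1,2], [1,2,2]}" for ms
    using that s1 s2 s3 s4 spectrally_arbitrary_11111 by auto
next
  fix ms A ls
  assume ms: "ms \<in> {[1,1,1,1,1], [1,2,1,1], [1,1,2,1], [1,1,1,2], [1,2,2], [1,3,1], [1,1,3], [1,4]} -
    ({[1,1,1,1,1], [1,2,1,1], [1,1,2,1], [1,1,1,2], [1,2,2]} \<union> {})"
    and A: "A \<in> schroedinger Dart" and spec: "has_spectrum A ls ms"
  have zf: "\<forall>m\<in>set ms. m \<le> card {1, 3 :: 5}"
    by (rule ballI, rule zero_forcing_5[OF A spec, of 1 3 2 4 5 1 3 4])
      (auto simp: graph_defs forall_5)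
  show False using ms spec zf by auto
qed simp_all

lemma Kite_classified: "classified Kite {[1,1,1,1,1], [1,2,1,1], [1,1,2,1], [1,1,1,2]} {}"
proof (rule classifiedI)
  show "connected_edges Kite"
    by (rule connected_edges_5I[of 1 2 _ 2 3 3 4 4 5]) (simp_all add: graph_defs forall_5)
  have s1: "spectrally_arbitrary_SSP Kite [1,2,1,1]"
    by (rule spectrally_arbitrary_embed_5[OF spectrally_arbitrary_K3(1), of 2 3 5 1 4]) (simp_all add: graph_defs)
  have s2: "spectrally_arbitrary_SSP Kite [1,1,2,1]"
    by (rule spectrally_arbitrary_embed_5[OF spectrally_arbitrary_K3(2), of 2 3 5 1 4]) (simp_all add: graph_defs)
  have s3: "spectrally_arbitrary_SSP Kite [1,1,1,2]"
    by (rule spectrally_arbitrary_embed_5[OF spectrally_arbitrary_K3(3), of 2 3 5 1 4]) (simp_all add: graph_defs)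
  show "spectrally_arbitrary_SSP Kite ms" if "ms \<in> {[1,1,1,1,1], [1,2,1,1], [1,1,2,1], [1,1,1,2]}" for ms
    using that s1 s2 s3 spectrally_arbitrary_11111 by auto
next
  fix ms A ls
  assume ms: "ms \<in> {[1,1,1,1,1], [1,2,1,1], [1,1,2,1], [1,1,1,2], [1,2,2], [1,3,1], [1,1,3], [1,4]} -
    ({[1,1,1,1,1], [1,2,1,1], [1,1,2,1], [1,1,1,2]} \<union> {})"
    and A: "A \<in> schroedinger Kite" and spec: "has_spectrum A ls ms"
  have zf: "\<forall>m\<in>set ms. m \<le> card {1, 3 :: 5}"
    by (rule ballI, rule zero_forcing_5[OF A spec, of 1 3 2 5 4 1 2 3])
      (auto simp: graph_defs forall_5)
  show False using ms spec zf Kite_not_1_2_2[OF A, of ls] by auto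
qed simp_all

text \<open>The list 122 comes from the Hamiltonian cycle 1-2-3-5-4, the other lists with a double
  eigenvalue from the triangle 345.\<close>

lemma Hs_classified: "classified Hs {[1,1,1,1,1], [1,2,1,1], [1,1,2,1], [1,1,1,2], [1,2,2]} {}"
proof (rule classifiedI)
  show "connected_edges Hs"
    by (rule connected_edges_5I[of 1 2 _ 2 3 3 4 4 5]) (simp_all add: graph_defs forall_5)
  have s1: "spectrally_arbitrary_SSP Hs [1,2,1,1]"
    by (rule spectrally_arbitrary_embed_5[OF spectrally_arbitrary_K3(1), of 3 4 5 1 2]) (simp_all add: graph_defs)
  have s2: "spectrally_arbitrary_SSP Hs [1,1,2,1]"
    by (rule spectrally_arbitrary_embed_5[OF spectrally_arbitrary_K3(2), of 3 4 5 1 2]) (simp_all add: graph_defs)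
  have s3: "spectrally_arbitrary_SSP Hs [1,1,1,2]"
    by (rule spectrally_arbitrary_embed_5[OF spectrally_arbitrary_K3(3), of 3 4 5 1 2]) (simp_all add: graph_defs)
  have s4: "spectrally_arbitrary_SSP Hs [1,2,2]"
    by (rule spectrally_arbitrary_embed_5[OF spectrally_arbitrary_C5(3), of 1 2 3 5 4]) (simp_all add: graph_defs)
  show "spectrally_arbitrary_SSP Hs ms" if "ms \<in> {[1,1,1,1,1], [1,2,1,1], [1,1,2,1], [1,1,1,2], [1,2,2]}" for ms
    using that s1 s2 s3 s4 spectrally_arbitrary_11111 by auto
next
  fix ms A ls
  assume ms: "ms \<in> {[1,1,1,1,1], [1,2,1,1], [1,1,2,1], [1,1,1,2], [1,2,2], [1,3,1], [1,1,3], [1,4]} -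
    ({[1,1,1,1,1], [1,2,1,1], [1,1,2,1], [1,1,1,2], [1,2,2]} \<union> {})"
    and A: "A \<in> schroedinger Hs" and spec: "has_spectrum A ls ms"
  have zf: "\<forall>m\<in>set ms. m \<le> card {1, 2 :: 5}"
    by (rule ballI, rule zero_forcing_5[OF A spec, of 1 2 4 3 5 1 2 3])
      (auto simp: graph_defs forall_5)
  show False using ms spec zf by auto
qed simp_all

lemma Gem_classified: "classified Gem {[1,1,1,1,1], [1,2,1,1], [1,1,2,1], [1,1,1,2], [1,2,2]} {}"
proof (rule classifiedI)
  show "connected_edges Gem"
    by (rule connected_edges_5I[of 1 2 _ 2 3 3 4 4 5]) (simp_all add: graph_defs forall_5)
  have s1: "spectrally_arbitrary_SSP Gem [1,2,1,1]"
    by (rule spectrally_arbitrary_embed_5[OF spectrally_arbitrary_K3(1), of 1 2 3 4 5]) (simp_all add: graph_defs)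
  have s2: "spectrally_arbitrary_SSP Gem [1,1,2,1]"
    by (rule spectrally_arbitrary_embed_5[OF spectrally_arbitrary_K3(2), of 1 2 3 4 5]) (simp_all add: graph_defs)
  have s3: "spectrally_arbitrary_SSP Gem [1,1,1,2]"
    by (rule spectrally_arbitrary_embed_5[OF spectrally_arbitrary_K3(3), of 1 2 3 4 5]) (simp_all add: graph_defs)
  have s4: "spectrally_arbitrary_SSP Gem [1,2,2]"
    by (rule spectrally_arbitrary_embed_5[OF spectrally_arbitrary_C5(3), of 1 2 3 4 5]) (simp_all add: graph_defs)
  show "spectrally_arbitrary_SSP Gem ms" if "ms \<in> {[1,1,1,1,1], [1,2,1,1], [1,1,2,1], [1,1,1,2], [1,2,2]}" for ms
    using that s1 s2 s3 s4 spectrally_arbitrary_11111 by auto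
next
  fix ms A ls
  assume ms: "ms \<in> {[1,1,1,1,1], [1,2,1,1], [1,1,2,1], [1,1,1,2], [1,2,2], [1,3,1], [1,1,3], [1,4]} -
    ({[1,1,1,1,1], [1,2,1,1], [1,1,2,1], [1,1,1,2], [1,2,2]} \<union> {})"
    and A: "A \<in> schroedinger Gem" and spec: "has_spectrum A ls ms"
  have zf: "\<forall>m\<in>set ms. m \<le> card {1, 2 :: 5}"
    by (rule ballI, rule zero_forcing_5[OF A spec, of 1 2 3 4 5 2 3 4])
      (auto simp: graph_defs forall_5)
  show False using ms spec zf by auto
qed simp_all

lemma Bfly_classified: "classified Bfly {[1,1,1,1,1], [1,2,1,1], [1,1,2,1], [1,1,1,2], [1,2,2]} {[1,1,3]}"
proof (rule classifiedI)
  show "connected_edges Bfly"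
    by (rule connected_edges_5I[of 1 2 _ 1 3 1 4 1 5]) (simp_all add: graph_defs forall_5)
  have s1: "spectrally_arbitrary_SSP Bfly [1,2,1,1]"
    by (rule spectrally_arbitrary_embed_5[OF spectrally_arbitrary_K3(1), of 1 2 3 4 5]) (simp_all add: graph_defs)
  have s2: "spectrally_arbitrary_SSP Bfly [1,1,2,1]"
    by (rule spectrally_arbitrary_embed_5[OF spectrally_arbitrary_K3(2), of 1 2 3 4 5]) (simp_all add: graph_defs)
  have s3: "spectrally_arbitrary_SSP Bfly [1,1,1,2]"
    by (rule spectrally_arbitrary_embed_5[OF spectrally_arbitrary_K3(3), of 1 2 3 4 5]) (simp_all add: graph_defs)
  have s4: "spectrally_arbitrary_SSP Bfly [1,2,2]"
    by (rule spectrally_arbitrary_embed_5[OF spectrally_arbitrary_Camp, of 1 2 3 4 5]) (simp_all add: graph_defs)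
  show "spectrally_arbitrary_SSP Bfly ms" if "ms \<in> {[1,1,1,1,1], [1,2,1,1], [1,1,2,1], [1,1,1,2], [1,2,2]}" for ms
    using that s1 s2 s3 s4 spectrally_arbitrary_11111 by auto
  show "allowed Bfly ms" if "ms \<in> {[1,1,3]}" for ms using that Bfly_1_1_3_allowed by auto
  show "\<not> SSP A" if "ms \<in> {[1,1,3]}" "A \<in> schroedinger Bfly" "has_spectrum A ls ms" for ms A ls
    using that Bfly_1_1_3_not_SSP by auto
next
  fix ms A ls
  assume ms: "ms \<in> {[1,1,1,1,1], [1,2,1,1], [1,1,2,1], [1,1,1,2], [1,2,2], [1,3,1], [1,1,3], [1,4]} -
    ({[1,1,1,1,1], [1,2,1,1], [1,1,2,1], [1,1,1,2], [1,2,2]} \<union> {[1,1,3]})"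
    and A: "A \<in> schroedinger Bfly" and spec: "has_spectrum A ls ms"
  have n14: "\<not> has_spectrum A ls [1,4]"
    by (rule not_1_4[OF A, of 2 4 1 1]) (simp_all add: graph_defs)
  show False using ms spec n14 Bfly_not_1_3_1[OF A, of ls] by auto
qed

text \<open>Bipartiteness alone removes every list whose last multiplicity exceeds 1.\<close>

lemma K23_classified: "classified K23 {[1,1,1,1,1], [1,2,1,1], [1,1,2,1], [1,3,1]} {}"
proof (rule classifiedI)
  show "connected_edges K23"
    by (rule connected_edges_5I[of 1 3 _ 3 2 1 4 1 5]) (simp_all add: graph_defs forall_5)
  have s1: "spectrally_arbitrary_SSP K23 [1,2,1,1]"
    by (rule spectrally_arbitrary_embed_5[OF spectrally_arbitrary_K13(1), of 1 3 4 5 2]) (simp_all add: graph_defs)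
  have s2: "spectrally_arbitrary_SSP K23 [1,1,2,1]"
    by (rule spectrally_arbitrary_embed_5[OF spectrally_arbitrary_K13(2), of 1 3 4 5 2]) (simp_all add: graph_defs)
  show "spectrally_arbitrary_SSP K23 ms" if "ms \<in> {[1,1,1,1,1], [1,2,1,1], [1,1,2,1], [1,3,1]}" for ms
    using that s1 s2 spectrally_arbitrary_11111 spectrally_arbitrary_K23 by auto
next
  fix ms A ls
  assume ms: "ms \<in> {[1,1,1,1,1], [1,2,1,1], [1,1,2,1], [1,1,1,2], [1,2,2], [1,3,1], [1,1,3], [1,4]} -
    ({[1,1,1,1,1], [1,2,1,1], [1,1,2,1], [1,3,1]} \<union> {})"
    and A: "A \<in> schroedinger K23" and spec: "has_spectrum A ls ms"
  have "s \<noteq> t" if "{i, j} \<in> K23" "s = (i \<in> {1,2})" "t = (j \<in> {1,2})" for i j s t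
    using that by (auto simp: graph_defs)
  then have "\<exists>ms'. ms = ms' @ [1]"
    by (intro largest_eigenvalue_simple_bipartite[OF A _ spec, of "\<lambda>i. i \<in> {1,2}"]
        connected_edges_5I[of 1 3 _ 3 2 1 4 1 5]) (simp_all add: graph_defs forall_5)
  then have bip: "last ms = 1" by auto
  show False using ms spec bip by auto
qed simp_all

lemma T5_classified: "classified T5 {[1,1,1,1,1], [1,2,1,1], [1,1,2,1], [1,1,1,2], [1,2,2], [1,3,1]} {}"
proof (rule classifiedI)
  show "connected_edges T5"
    by (rule connected_edges_5I[of 1 2 _ 1 3 1 4 1 5]) (simp_all add: graph_defs forall_5)
  have s1: "spectrally_arbitrary_SSP T5 [1,2,1,1]"
    by (rule spectrally_arbitrary_embed_5[OF spectrally_arbitrary_K3(1), of 1 2 3 4 5]) (simp_all add: graph_defs)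
  have s2: "spectrally_arbitrary_SSP T5 [1,1,2,1]"
    by (rule spectrally_arbitrary_embed_5[OF spectrally_arbitrary_K3(2), of 1 2 3 4 5]) (simp_all add: graph_defs)
  have s3: "spectrally_arbitrary_SSP T5 [1,1,1,2]"
    by (rule spectrally_arbitrary_embed_5[OF spectrally_arbitrary_K3(3), of 1 2 3 4 5]) (simp_all add: graph_defs)
  have s4: "spectrally_arbitrary_SSP T5 [1,2,2]"
    by (rule spectrally_arbitrary_embed_5[OF spectrally_arbitrary_Camp, of 1 2 3 4 5]) (simp_all add: graph_defs)
  have s5: "spectrally_arbitrary_SSP T5 [1,3,1]"
    by (rule spectrally_arbitrary_embed_5[OF spectrally_arbitrary_K23, of 1 2 3 4 5]) (simp_all add: graph_defs K23_Ball)
  show "spectrally_arbitrary_SSP T5 ms" if "ms \<in> {[1,1,1,1,1], [1,2,1,1], [1,1,2,1], [1,1,1,2], [1,2,2], [1,3,1]}" for ms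
    using that s1 s2 s3 s4 s5 spectrally_arbitrary_11111 by auto
next
  fix ms A ls
  assume ms: "ms \<in> {[1,1,1,1,1], [1,2,1,1], [1,1,2,1], [1,1,1,2], [1,2,2], [1,3,1], [1,1,3], [1,4]} -
    ({[1,1,1,1,1], [1,2,1,1], [1,1,2,1], [1,1,1,2], [1,2,2], [1,3,1]} \<union> {})"
    and A: "A \<in> schroedinger T5" and spec: "has_spectrum A ls ms"
  have n14: "\<not> has_spectrum A ls [1,4]"
    by (rule not_1_4[OF A, of 3 4 1 1]) (simp_all add: graph_defs)
  show False using ms spec n14 T5_not_1_1_3[OF A, of ls] by auto
qed simp_all

lemma L41_classified: "classified L41 {[1,1,1,1,1], [1,2,1,1], [1,1,2,1], [1,1,1,2], [1,2,2], [1,3,1], [1,1,3]} {}"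
proof (rule classifiedI)
  show "connected_edges L41"
    by (rule connected_edges_5I[of 1 2 _ 2 3 3 4 4 5]) (simp_all add: graph_defs forall_5)
  have s1: "spectrally_arbitrary_SSP L41 [1,2,1,1]"
    by (rule spectrally_arbitrary_embed_5[OF spectrally_arbitrary_K3(1), of 2 3 4 1 5]) (simp_all add: graph_defs)
  have s2: "spectrally_arbitrary_SSP L41 [1,1,2,1]"
    by (rule spectrally_arbitrary_embed_5[OF spectrally_arbitrary_K3(2), of 2 3 4 1 5]) (simp_all add: graph_defs)
  have s3: "spectrally_arbitrary_SSP L41 [1,1,1,2]"
    by (rule spectrally_arbitrary_embed_5[OF spectrally_arbitrary_K3(3), of 2 3 4 1 5]) (simp_all add: graph_defs)
  have s4: "spectrally_arbitrary_SSP L41 [1,2,2]"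
    by (rule spectrally_arbitrary_embed_5[OF spectrally_arbitrary_Camp, of 2 3 4 1 5]) (simp_all add: graph_defs)
  have s5: "spectrally_arbitrary_SSP L41 [1,3,1]"
    by (rule spectrally_arbitrary_embed_5[OF spectrally_arbitrary_K4(1), of 2 3 4 5 1]) (simp_all add: graph_defs)
  have s6: "spectrally_arbitrary_SSP L41 [1,1,3]"
    by (rule spectrally_arbitrary_embed_5[OF spectrally_arbitrary_K4(2), of 2 3 4 5 1]) (simp_all add: graph_defs)
  show "spectrally_arbitrary_SSP L41 ms" if "ms \<in> {[1,1,1,1,1], [1,2,1,1], [1,1,2,1], [1,1,1,2], [1,2,2], [1,3,1], [1,1,3]}" for ms
    using that s1 s2 s3 s4 s5 s6 spectrally_arbitrary_11111 by auto
next
  fix ms A ls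
  assume ms: "ms \<in> {[1,1,1,1,1], [1,2,1,1], [1,1,2,1], [1,1,1,2], [1,2,2], [1,3,1], [1,1,3], [1,4]} -
    ({[1,1,1,1,1], [1,2,1,1], [1,1,2,1], [1,1,1,2], [1,2,2], [1,3,1], [1,1,3]} \<union> {})"
    and A: "A \<in> schroedinger L41" and spec: "has_spectrum A ls ms"
  have n14: "\<not> has_spectrum A ls [1,4]"
    by (rule not_1_4[OF A, of 1 3 2 2]) (simp_all add: graph_defs)
  show False using ms spec n14 by auto
qed simp_all

text \<open>The list 122 comes from the Hamiltonian cycle 1-2-5-4-3 and 131 from a copy of
  \<open>K23\<close> with parts \<open>{2, 4}\<close> and \<open>{1, 3, 5}\<close>; the induced
  4-cycle 2-3-4-5 rules out 113. The same copies serve \<open>W5\<close>.\<close>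

lemma K4e_classified: "classified K4e {[1,1,1,1,1], [1,2,1,1], [1,1,2,1], [1,1,1,2], [1,2,2], [1,3,1]} {}"
proof (rule classifiedI)
  show "connected_edges K4e"
    by (rule connected_edges_5I[of 1 2 _ 2 3 3 4 4 5]) (simp_all add: graph_defs forall_5)
  have s1: "spectrally_arbitrary_SSP K4e [1,2,1,1]"
    by (rule spectrally_arbitrary_embed_5[OF spectrally_arbitrary_K3(1), of 1 2 3 4 5]) (simp_all add: graph_defs)
  have s2: "spectrally_arbitrary_SSP K4e [1,1,2,1]"
    by (rule spectrally_arbitrary_embed_5[OF spectrally_arbitrary_K3(2), of 1 2 3 4 5]) (simp_all add: graph_defs)
  have s3: "spectrally_arbitrary_SSP K4e [1,1,1,2]"
    by (rule spectrally_arbitrary_embed_5[OF spectrally_arbitrary_K3(3), of 1 2 3 4 5]) (simp_all add: graph_defs)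
  have s4: "spectrally_arbitrary_SSP K4e [1,2,2]"
    by (rule spectrally_arbitrary_embed_5[OF spectrally_arbitrary_C5(3), of 1 2 5 4 3]) (simp_all add: graph_defs)
  have s5: "spectrally_arbitrary_SSP K4e [1,3,1]"
    by (rule spectrally_arbitrary_embed_5[OF spectrally_arbitrary_K23, of 2 4 1 3 5]) (simp_all add: graph_defs K23_Ball)
  show "spectrally_arbitrary_SSP K4e ms" if "ms \<in> {[1,1,1,1,1], [1,2,1,1], [1,1,2,1], [1,1,1,2], [1,2,2], [1,3,1]}" for ms
    using that s1 s2 s3 s4 s5 spectrally_arbitrary_11111 by auto
next
  fix ms A ls
  assume ms: "ms \<in> {[1,1,1,1,1], [1,2,1,1], [1,1,2,1], [1,1,1,2], [1,2,2], [1,3,1], [1,1,3], [1,4]} -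
    ({[1,1,1,1,1], [1,2,1,1], [1,1,2,1], [1,1,1,2], [1,2,2], [1,3,1]} \<union> {})"
    and A: "A \<in> schroedinger K4e" and spec: "has_spectrum A ls ms"
  have n14: "\<not> has_spectrum A ls [1,4]"
    by (rule not_1_4[OF A, of 2 4 1 1]) (simp_all add: graph_defs)
  have n113: "\<not> has_spectrum A ls [1,1,3]"
    by (rule induced_C4_not_1_1_3[OF A]) (simp_all add: graph_defs)
  show False using ms spec n14 n113 by auto
qed simp_all

lemma W5_classified: "classified W5 {[1,1,1,1,1], [1,2,1,1], [1,1,2,1], [1,1,1,2], [1,2,2], [1,3,1]} {}"
proof (rule classifiedI)
  show "connected_edges W5"
    by (rule connected_edges_5I[of 1 2 _ 2 3 3 4 4 5]) (simp_all add: graph_defs forall_5)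
  have s1: "spectrally_arbitrary_SSP W5 [1,2,1,1]"
    by (rule spectrally_arbitrary_embed_5[OF spectrally_arbitrary_K3(1), of 1 2 3 4 5]) (simp_all add: graph_defs)
  have s2: "spectrally_arbitrary_SSP W5 [1,1,2,1]"
    by (rule spectrally_arbitrary_embed_5[OF spectrally_arbitrary_K3(2), of 1 2 3 4 5]) (simp_all add: graph_defs)
  have s3: "spectrally_arbitrary_SSP W5 [1,1,1,2]"
    by (rule spectrally_arbitrary_embed_5[OF spectrally_arbitrary_K3(3), of 1 2 3 4 5]) (simp_all add: graph_defs)
  have s4: "spectrally_arbitrary_SSP W5 [1,2,2]"
    by (rule spectrally_arbitrary_embed_5[OF spectrally_arbitrary_C5(3), of 1 2 5 4 3]) (simp_all add: graph_defs)
  have s5: "spectrally_arbitrary_SSP W5 [1,3,1]"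
    by (rule spectrally_arbitrary_embed_5[OF spectrally_arbitrary_K23, of 2 4 1 3 5]) (simp_all add: graph_defs K23_Ball)
  show "spectrally_arbitrary_SSP W5 ms" if "ms \<in> {[1,1,1,1,1], [1,2,1,1], [1,1,2,1], [1,1,1,2], [1,2,2], [1,3,1]}" for ms
    using that s1 s2 s3 s4 s5 spectrally_arbitrary_11111 by auto
next
  fix ms A ls
  assume ms: "ms \<in> {[1,1,1,1,1], [1,2,1,1], [1,1,2,1], [1,1,1,2], [1,2,2], [1,3,1], [1,1,3], [1,4]} -
    ({[1,1,1,1,1], [1,2,1,1], [1,1,2,1], [1,1,1,2], [1,2,2], [1,3,1]} \<union> {})"
    and A: "A \<in> schroedinger W5" and spec: "has_spectrum A ls ms"
  have n14: "\<not> has_spectrum A ls [1,4]"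
    by (rule not_1_4[OF A, of 2 4 1 1]) (simp_all add: graph_defs)
  have n113: "\<not> has_spectrum A ls [1,1,3]"
    by (rule induced_C4_not_1_1_3[OF A]) (simp_all add: graph_defs)
  show False using ms spec n14 n113 by auto
qed simp_all

lemma FHs_classified: "classified FHs {[1,1,1,1,1], [1,2,1,1], [1,1,2,1], [1,1,1,2], [1,2,2], [1,3,1], [1,1,3]} {}"
proof (rule classifiedI)
  show "connected_edges FHs"
    by (rule connected_edges_5I[of 1 2 _ 2 3 3 4 4 5]) (simp_all add: graph_defs forall_5)
  have s1: "spectrally_arbitrary_SSP FHs [1,2,1,1]"
    by (rule spectrally_arbitrary_embed_5[OF spectrally_arbitrary_K3(1), of 1 2 3 4 5]) (simp_all add: graph_defs)
  have s2: "spectrally_arbitrary_SSP FHs [1,1,2,1]"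
    by (rule spectrally_arbitrary_embed_5[OF spectrally_arbitrary_K3(2), of 1 2 3 4 5]) (simp_all add: graph_defs)
  have s3: "spectrally_arbitrary_SSP FHs [1,1,1,2]"
    by (rule spectrally_arbitrary_embed_5[OF spectrally_arbitrary_K3(3), of 1 2 3 4 5]) (simp_all add: graph_defs)
  have s4: "spectrally_arbitrary_SSP FHs [1,2,2]"
    by (rule spectrally_arbitrary_embed_5[OF spectrally_arbitrary_C5(3), of 1 2 3 5 4]) (simp_all add: graph_defs)
  have s5: "spectrally_arbitrary_SSP FHs [1,3,1]"
    by (rule spectrally_arbitrary_embed_5[OF spectrally_arbitrary_K4(1), of 1 2 3 4 5]) (simp_all add: graph_defs)
  have s6: "spectrally_arbitrary_SSP FHs [1,1,3]"
    by (rule spectrally_arbitrary_embed_5[OF spectrally_arbitrary_K4(2), of 1 2 3 4 5]) (simp_all add: graph_defs)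
  show "spectrally_arbitrary_SSP FHs ms" if "ms \<in> {[1,1,1,1,1], [1,2,1,1], [1,1,2,1], [1,1,1,2], [1,2,2], [1,3,1], [1,1,3]}" for ms
    using that s1 s2 s3 s4 s5 s6 spectrally_arbitrary_11111 by auto
next
  fix ms A ls
  assume ms: "ms \<in> {[1,1,1,1,1], [1,2,1,1], [1,1,2,1], [1,1,1,2], [1,2,2], [1,3,1], [1,1,3], [1,4]} -
    ({[1,1,1,1,1], [1,2,1,1], [1,1,2,1], [1,1,1,2], [1,2,2], [1,3,1], [1,1,3]} \<union> {})"
    and A: "A \<in> schroedinger FHs" and spec: "has_spectrum A ls ms"
  have n14: "\<not> has_spectrum A ls [1,4]"
    by (rule not_1_4[OF A, of 1 5 2 3]) (simp_all add: graph_defs)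
  show False using ms spec n14 by auto
qed simp_all

lemma K5_minus_e_classified: "classified K5_minus_e {[1,1,1,1,1], [1,2,1,1], [1,1,2,1], [1,1,1,2], [1,2,2], [1,3,1], [1,1,3]} {}"
proof (rule classifiedI)
  show "connected_edges K5_minus_e"
    by (rule connected_edges_5I[of 1 3 _ 3 2 3 4 4 5]) (simp_all add: graph_defs forall_5)
  have s1: "spectrally_arbitrary_SSP K5_minus_e [1,2,1,1]"
    by (rule spectrally_arbitrary_embed_5[OF spectrally_arbitrary_K3(1), of 3 4 5 1 2]) (simp_all add: graph_defs)
  have s2: "spectrally_arbitrary_SSP K5_minus_e [1,1,2,1]"
    by (rule spectrally_arbitrary_embed_5[OF spectrally_arbitrary_K3(2), of 3 4 5 1 2]) (simp_all add: graph_defs)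
  have s3: "spectrally_arbitrary_SSP K5_minus_e [1,1,1,2]"
    by (rule spectrally_arbitrary_embed_5[OF spectrally_arbitrary_K3(3), of 3 4 5 1 2]) (simp_all add: graph_defs)
  have s4: "spectrally_arbitrary_SSP K5_minus_e [1,2,2]"
    by (rule spectrally_arbitrary_embed_5[OF spectrally_arbitrary_C5(3), of 1 3 2 4 5]) (simp_all add: graph_defs)
  have s5: "spectrally_arbitrary_SSP K5_minus_e [1,3,1]"
    by (rule spectrally_arbitrary_embed_5[OF spectrally_arbitrary_K4(1), of 2 3 4 5 1]) (simp_all add: graph_defs)
  have s6: "spectrally_arbitrary_SSP K5_minus_e [1,1,3]"
    by (rule spectrally_arbitrary_embed_5[OF spectrally_arbitrary_K4(2), of 2 3 4 5 1]) (simp_all add: graph_defs)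
  show "spectrally_arbitrary_SSP K5_minus_e ms" if "ms \<in> {[1,1,1,1,1], [1,2,1,1], [1,1,2,1], [1,1,1,2], [1,2,2], [1,3,1], [1,1,3]}" for ms
    using that s1 s2 s3 s4 s5 s6 spectrally_arbitrary_11111 by auto
next
  fix ms A ls
  assume ms: "ms \<in> {[1,1,1,1,1], [1,2,1,1], [1,1,2,1], [1,1,1,2], [1,2,2], [1,3,1], [1,1,3], [1,4]} -
    ({[1,1,1,1,1], [1,2,1,1], [1,1,2,1], [1,1,1,2], [1,2,2], [1,3,1], [1,1,3]} \<union> {})"
    and A: "A \<in> schroedinger K5_minus_e" and spec: "has_spectrum A ls ms"
  have n14: "\<not> has_spectrum A ls [1,4]"
    by (rule not_1_4[OF A, of 1 2 3 3]) (simp_all add: graph_defs)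
  show False using ms spec n14 by auto
qed simp_all

lemma K5_classified: "classified K5 {[1,1,1,1,1], [1,2,1,1], [1,1,2,1], [1,1,1,2], [1,2,2], [1,3,1], [1,1,3], [1,4]} {}"
proof (rule classifiedI)
  show "connected_edges K5"
    by (rule connected_edges_5I[of 1 2 _ 2 3 3 4 4 5]) (simp_all add: graph_defs forall_5)
  have s1: "spectrally_arbitrary_SSP K5 [1,2,1,1]"
    by (rule spectrally_arbitrary_embed_5[OF spectrally_arbitrary_K3(1), of 1 2 3 4 5]) (simp_all add: graph_defs)
  have s2: "spectrally_arbitrary_SSP K5 [1,1,2,1]"
    by (rule spectrally_arbitrary_embed_5[OF spectrally_arbitrary_K3(2), of 1 2 3 4 5]) (simp_all add: graph_defs)
  have s3: "spectrally_arbitrary_SSP K5 [1,1,1,2]"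
    by (rule spectrally_arbitrary_embed_5[OF spectrally_arbitrary_K3(3), of 1 2 3 4 5]) (simp_all add: graph_defs)
  have s4: "spectrally_arbitrary_SSP K5 [1,2,2]"
    by (rule spectrally_arbitrary_embed_5[OF spectrally_arbitrary_C5(3), of 1 2 3 4 5]) (simp_all add: graph_defs)
  have s5: "spectrally_arbitrary_SSP K5 [1,3,1]"
    by (rule spectrally_arbitrary_embed_5[OF spectrally_arbitrary_K4(1), of 1 2 3 4 5]) (simp_all add: graph_defs)
  have s6: "spectrally_arbitrary_SSP K5 [1,1,3]"
    by (rule spectrally_arbitrary_embed_5[OF spectrally_arbitrary_K4(2), of 1 2 3 4 5]) (simp_all add: graph_defs)
  show "spectrally_arbitrary_SSP K5 ms" if "ms \<in> {[1,1,1,1,1], [1,2,1,1], [1,1,2,1], [1,1,1,2], [1,2,2], [1,3,1], [1,1,3], [1,4]}" for ms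
    using that s1 s2 s3 s4 s5 s6 spectrally_arbitrary_11111 spectrally_arbitrary_K5 by auto
next
  fix ms A ls
  assume ms: "ms \<in> {[1,1,1,1,1], [1,2,1,1], [1,1,2,1], [1,1,1,2], [1,2,2], [1,3,1], [1,1,3], [1,4]} -
    ({[1,1,1,1,1], [1,2,1,1], [1,1,2,1], [1,1,1,2], [1,2,2], [1,3,1], [1,1,3], [1,4]} \<union> {})"
    and A: "A \<in> schroedinger K5" and spec: "has_spectrum A ls ms"
  show False using ms spec  by auto
qed simp_all

theorem theorem4p2:
  fixes G :: graph5 and L N :: "nat list set"
  assumes "(G, L, N) \<in> {
    (P5, {[1,1,1,1,1]}, {}),
    (S211, {[1,1,1,1,1], [1,2,1,1], [1,1,2,1]}, {}),
    (K14, {[1,1,1,1,1], [1,2,1,1], [1,1,2,1]}, {[1,3,1]}),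
    (L32, {[1,1,1,1,1], [1,2,1,1], [1,1,2,1], [1,1,1,2]}, {}),
    (Bull, {[1,1,1,1,1], [1,2,1,1], [1,1,2,1], [1,1,1,2]}, {}),
    (C5, {[1,1,1,1,1], [1,2,1,1], [1,1,1,2], [1,2,2]}, {}),
    (Camp, {[1,1,1,1,1], [1,2,1,1], [1,1,2,1], [1,1,1,2], [1,2,2]}, {}),
    (Bnr, {[1,1,1,1,1], [1,2,1,1], [1,1,2,1]}, {}),
    (Dart, {[1,1,1,1,1], [1,2,1,1], [1,1,2,1], [1,1,1,2], [1,2,2]}, {}),
    (Kite, {[1,1,1,1,1], [1,2,1,1], [1,1,2,1], [1,1,1,2]}, {}),
    (Hs, {[1,1,1,1,1], [1,2,1,1], [1,1,2,1], [1,1,1,2], [1,2,2]}, {}),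
    (Gem, {[1,1,1,1,1], [1,2,1,1], [1,1,2,1], [1,1,1,2], [1,2,2]}, {}),
    (Bfly, {[1,1,1,1,1], [1,2,1,1], [1,1,2,1], [1,1,1,2], [1,2,2]}, {[1,1,3]}),
    (K23, {[1,1,1,1,1], [1,2,1,1], [1,1,2,1], [1,3,1]}, {}),
    (T5, {[1,1,1,1,1], [1,2,1,1], [1,1,2,1], [1,1,1,2], [1,2,2], [1,3,1]}, {}),
    (L41, {[1,1,1,1,1], [1,2,1,1], [1,1,2,1], [1,1,1,2], [1,2,2], [1,3,1], [1,1,3]}, {}),
    (K4e, {[1,1,1,1,1], [1,2,1,1], [1,1,2,1], [1,1,1,2], [1,2,2], [1,3,1]}, {}),
    (W5, {[1,1,1,1,1], [1,2,1,1], [1,1,2,1], [1,1,1,2], [1,2,2], [1,3,1]}, {}),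
    (FHs, {[1,1,1,1,1], [1,2,1,1], [1,1,2,1], [1,1,1,2], [1,2,2], [1,3,1], [1,1,3]}, {}),
    (K5_minus_e, {[1,1,1,1,1], [1,2,1,1], [1,1,2,1], [1,1,1,2], [1,2,2], [1,3,1], [1,1,3]}, {}),
    (K5, {[1,1,1,1,1], [1,2,1,1], [1,1,2,1], [1,1,1,2], [1,2,2], [1,3,1], [1,1,3], [1,4]}, {})}"
  shows "{ms. allowed G ms} = L \<union> N \<and>
    (\<forall>ms\<in>L. spectrally_arbitrary_SSP G ms) \<and>
    (\<forall>ms\<in>N. \<forall>A\<in>schroedinger G. has_ordered_mult_list A ms \<longrightarrow> \<not> SSP A)"
proof -
  have "classified G L N"
    using assms unfolding insert_iff empty_iff prod.inject
    by (elim disjE conjE FalseE)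
      (simp_all only: P5_classified S211_classified K14_classified L32_classified Bull_classified
        C5_classified Camp_classified Bnr_classified Dart_classified Kite_classified
        Hs_classified Gem_classified Bfly_classified K23_classified T5_classified
        L41_classified K4e_classified W5_classified FHs_classified K5_minus_e_classified
        K5_classified)
  then show ?thesis unfolding classified_def .
qed

end
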